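(* Let $X,\nu,R,M_p,M_p^*$ be as in the context, with $R\nabla$ closable in $L^p(X,\nu)$ for every $p\in(1,\infty)$, and let $g:X\to\mathbb{R}$ be a Borel function such that, for every $p>1$, $g\in W^{1,p}(X,\nu)$ and $Mg\,\|Mg\|^{-2}\in D(M_p^* )$. Let $g^*$ be a $C_{\bar p}$-quasicontinuous version of $g$ for some $\bar p>1$. Let $p>1$, $F\in D(M_p^* )$, $\varphi\in W^{1,p_1}(X,\nu)$ for some $p_1>p$, and assume that $\langle Mg,F\rangle\varphi$ belongs to $C_b(X)$ or to $W^{1,q}(X,\nu)$ for some $q>1$. Then for every $r\in\mathbb{R}$ $$\int_{\{g<r\}}\langle M_{p_1}\varphi,F\rangle\,d\nu=\int_{\{g<r\}}\varphi\,M_p^*(F)\,d\nu+\int_X T(\langle Mg,F\rangle\varphi)\,d\sigma_r^g=\int_{\{g<r\}}\varphi\,M_p^*(F)\,d\nu+\int_{(g^* )^{-1}(r)}T(\langle Mg,F\rangle\varphi)\,d\sigma_r^g.$$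
   Context: $X$ is a separable infinite-dimensional real Hilbert space with inner product $\langle\cdot,\cdot\rangle$ and norm $\|\cdot\|$, and $\nu$ is a non-degenerate Borel probability measure on $X$ (non-degenerate: not concentrated on any proper closed linear subspace). $C_b(X)$ is the space of bounded continuous real functions; $C_b^1(X)$ is the space of bounded continuously Fréchet differentiable $\varphi:X\to\mathbb{R}$ with bounded gradient $\nabla\varphi$. $R\in\mathcal{L}(X)$ is a bounded linear operator such that for every $p\in(1,\infty)$ the operator $\varphi\mapsto R\nabla\varphi$, with domain $C^1_b(X)\subset L^p(X,\nu)$ and values in $L^p(X,\nu;X)$, is closable. $M_p$ denotes its closure, $W^{1,p}(X,\nu)$ the domain of $M_p$, with norm $\|f\|_{W^{1,p}}=\|f\|_{L^p(X,\nu)}+\|M_pf\|_{L^p(X,\nu;X)}$. With $p'=p/(p-1)$, $M_p^*:D(M_p^* )\subset L^{p'}(X,\nu;X)\to L^{p'}(X,\nu)$ is the adjoint: $\int_X\langle M_p\varphi,F\rangle\,d\nu=\int_X\varphi\,M_p^*F\,d\nu$ for $\varphi\in W^{1,p}(X,\nu)$, $F\in D(M_p^* )$. One writes $M$, $M^*$ on $\bigcap_{p>1}W^{1,p}(X,\nu)$, $\bigcap_{p>1}D(M_p^* )$, where the operators do not depend on $p$. The condition on $Mg\,\|Mg\|^{-2}$ includes that it is defined $\nu$-a.e. For $r\in\mathbb{R}$, $\sigma_r^g$ is the unique finite nonnegative Borel measure on $X$ such that $\int_X\varphi\,d\sigma_r^g=\frac{d}{dr}\int_{\{g\le r\}}\varphi\,d\nu$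 for every $\varphi\in C_b(X)$ (the derivatives and the measure exist whenever $R\nabla$ is closable in $L^p(X,\nu)$ for every $p\in(1,\infty)$ and $g:X\to\mathbb{R}$ is a Borel function such that $g\in W^{1,p}(X,\nu)$ and $Mg\,\|Mg\|^{-2}\in D(M_p^* )$ for every $p>1$). Trace: for $f\in W^{1,q}(X,\nu)$, $q>1$, $Tf\in L^1(X,\sigma_r^g)$ is the common limit in $L^1(X,\sigma_r^g)$ of all sequences in $C_b^1(X)$ converging to $f$ in $W^{1,q}(X,\nu)$ (it is well defined); for $f\in C_b(X)$, $Tf:=f$ (the two agree when both apply). Capacity: for $O\subset X$ open, $C_p(O)=\inf\{\|f\|_{W^{1,p}(X,\nu)}: f\in W^{1,p}(X,\nu),\ f\ge \mathbf{1}_O\ \nu\text{-a.e.}\}$. A function $f:X\to\mathbb{R}$ is $C_p$-quasicontinuous if for every $\varepsilon>0$ there is an open set $O$ with $C_p(O)<\varepsilon$ such that the restriction of $f$ to $X\setminus O$ is continuous. A version of $g$ is a function equal to $g$ $\nu$-a.e. *)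

theory Defs
  imports "HOL-Probability.Probability"
begin

text \<open>
  A separable real Hilbert space is a type of sort \<open>{real_inner, polish_space}\<close>
  (\<open>polish_space\<close> is complete and second countable). Elements of \<open>L\<^sup>p\<close> and of
  \<open>W\<^sup>1\<^sup>,\<^sup>p\<close> are represented by functions; the operators
  below return some representative of an almost-everywhere class.
\<close>

definition infinite_dimensional :: "'a::real_vector itself \<Rightarrow> bool" where
  "infinite_dimensional _ \<longleftrightarrow> (\<nexists>B :: 'a set. finite B \<and> span B = UNIV)"

definition nondegenerate :: "'a::real_normed_vector measure \<Rightarrow> bool" where
  "nondegenerate \<nu> \<longleftrightarrow>
     (\<forall>V. subspace V \<and> closed V \<and> V \<noteq> UNIV \<longrightarrow> \<not> (AE x in \<nu>. x \<in> V))"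

subsection \<open>The spaces \<open>L\<^sup>p\<close> and \<open>C\<^sub>b\<^sup>1\<close>\<close>

definition Lp :: "real \<Rightarrow> 'a measure \<Rightarrow> ('a \<Rightarrow> 'b::real_normed_vector) set" where
  "Lp p \<nu> = {f \<in> borel_measurable \<nu>. integrable \<nu> (\<lambda>x. norm (f x) powr p)}"

definition Lp_norm :: "real \<Rightarrow> 'a measure \<Rightarrow> ('a \<Rightarrow> 'b::real_normed_vector) \<Rightarrow> real" where
  "Lp_norm p \<nu> f = (LINT x|\<nu>. norm (f x) powr p) powr (1 / p)"

text \<open>Convergence in \<open>L\<^sup>p\<close>. \<open>Lp_norm\<close> is meaningful only on \<open>Lp\<close>, since
  the Bochner integral of a non-integrable function is \<open>0\<close>; hence the membership conditions.\<close>

definition Lp_tendsto ::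
  "real \<Rightarrow> 'a measure \<Rightarrow> (nat \<Rightarrow> 'a \<Rightarrow> 'b::real_normed_vector) \<Rightarrow> ('a \<Rightarrow> 'b) \<Rightarrow> bool" where
  "Lp_tendsto p \<nu> fs f \<longleftrightarrow> (\<forall>n. fs n \<in> Lp p \<nu>) \<and> f \<in> Lp p \<nu> \<and>
     (\<lambda>n. Lp_norm p \<nu> (\<lambda>x. fs n x - f x)) \<longlonglongrightarrow> 0"

definition grad :: "('a::real_inner \<Rightarrow> real) \<Rightarrow> 'a \<Rightarrow> 'a" where
  "grad \<phi> x = (THE D. GDERIV \<phi> x :> D)"

definition C1b :: "('a::real_inner \<Rightarrow> real) set" where
  "C1b = {\<phi> \<in> bcontfun. (\<forall>x. GDERIV \<phi> x :> grad \<phi> x) \<and>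
            continuous_on UNIV (grad \<phi>) \<and> bounded (range (grad \<phi>))}"

subsection \<open>The operator \<open>M\<^sub>p\<close> and its domain\<close>

definition Rgrad_closable ::
  "'a::{real_inner,polish_space} measure \<Rightarrow> ('a \<Rightarrow> 'a) \<Rightarrow> real \<Rightarrow> bool" where
  "Rgrad_closable \<nu> R p \<longleftrightarrow>
     (\<forall>\<phi>s \<Psi>. (\<forall>n. \<phi>s n \<in> C1b) \<and> Lp_tendsto p \<nu> \<phi>s (\<lambda>_. 0) \<and>
        Lp_tendsto p \<nu> (\<lambda>n x. R (grad (\<phi>s n) x)) \<Psi> \<longrightarrow> (AE x in \<nu>. \<Psi> x = 0))"

text \<open>The closure in \<open>L\<^sup>p(X,\<nu>) \<times> L\<^sup>p(X,\<nu>;X)\<close> of the graph of \<open>R\<nabla>\<close>:\<close>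

definition closure_graph ::
  "'a::{real_inner,polish_space} measure \<Rightarrow> ('a \<Rightarrow> 'a) \<Rightarrow> real \<Rightarrow> ('a \<Rightarrow> real) \<Rightarrow> ('a \<Rightarrow> 'a) \<Rightarrow> bool"
where
  "closure_graph \<nu> R p f G \<longleftrightarrow>
     (\<exists>\<phi>s. (\<forall>n. \<phi>s n \<in> C1b) \<and> Lp_tendsto p \<nu> \<phi>s f \<and>
        Lp_tendsto p \<nu> (\<lambda>n x. R (grad (\<phi>s n) x)) G)"

definition W1 ::
  "'a::{real_inner,polish_space} measure \<Rightarrow> ('a \<Rightarrow> 'a) \<Rightarrow> real \<Rightarrow> ('a \<Rightarrow> real) set" where
  "W1 \<nu> R p = {f. \<exists>G. closure_graph \<nu> R p f G}"

definition Mp ::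
  "'a::{real_inner,polish_space} measure \<Rightarrow> ('a \<Rightarrow> 'a) \<Rightarrow> real \<Rightarrow> ('a \<Rightarrow> real) \<Rightarrow> 'a \<Rightarrow> 'a" where
  "Mp \<nu> R p f = (SOME G. closure_graph \<nu> R p f G)"

definition W1_norm ::
  "'a::{real_inner,polish_space} measure \<Rightarrow> ('a \<Rightarrow> 'a) \<Rightarrow> real \<Rightarrow> ('a \<Rightarrow> real) \<Rightarrow> real" where
  "W1_norm \<nu> R p f = Lp_norm p \<nu> f + Lp_norm p \<nu> (Mp \<nu> R p f)"

text \<open>\<open>M f\<close> for \<open>f\<close> in all the spaces \<open>W\<^sup>1\<^sup>,\<^sup>p\<close>, \<open>p > 1\<close>: one function
  representing \<open>M\<^sub>p f\<close> for every \<open>p\<close>.\<close>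

definition M_op ::
  "'a::{real_inner,polish_space} measure \<Rightarrow> ('a \<Rightarrow> 'a) \<Rightarrow> ('a \<Rightarrow> real) \<Rightarrow> 'a \<Rightarrow> 'a" where
  "M_op \<nu> R f = (SOME G. \<forall>p>1. closure_graph \<nu> R p f G)"

subsection \<open>The adjoint of \<open>M\<^sub>p\<close>\<close>

definition adjoint_pair ::
  "'a::{real_inner,polish_space} measure \<Rightarrow> ('a \<Rightarrow> 'a) \<Rightarrow> real \<Rightarrow> ('a \<Rightarrow> 'a) \<Rightarrow> ('a \<Rightarrow> real) \<Rightarrow> bool"
where
  "adjoint_pair \<nu> R p F v \<longleftrightarrow> F \<in> Lp (p / (p - 1)) \<nu> \<and> v \<in> Lp (p / (p - 1)) \<nu> \<and>
     (\<forall>\<phi> \<in> W1 \<nu> R p. (LINT x|\<nu>. Mp \<nu> R p \<phi> x \<bullet> F x) = (LINT x|\<nu>. \<phi> x * v x))"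

definition dom_Mp_adj ::
  "'a::{real_inner,polish_space} measure \<Rightarrow> ('a \<Rightarrow> 'a) \<Rightarrow> real \<Rightarrow> ('a \<Rightarrow> 'a) set" where
  "dom_Mp_adj \<nu> R p = {F. \<exists>v. adjoint_pair \<nu> R p F v}"

definition Mp_adj ::
  "'a::{real_inner,polish_space} measure \<Rightarrow> ('a \<Rightarrow> 'a) \<Rightarrow> real \<Rightarrow> ('a \<Rightarrow> 'a) \<Rightarrow> 'a \<Rightarrow> real" where
  "Mp_adj \<nu> R p F = (SOME v. adjoint_pair \<nu> R p F v)"

subsection \<open>The measures \<open>\<sigma>\<^sub>r\<^sup>g\<close> and the trace\<close>

definition surface_measure ::
  "'a::{real_inner,polish_space} measure \<Rightarrow> ('a \<Rightarrow> real) \<Rightarrow> real \<Rightarrow> 'a measure" where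
  "surface_measure \<nu> g r = (THE \<sigma>. finite_measure \<sigma> \<and> sets \<sigma> = sets borel \<and>
     (\<forall>\<phi> \<in> bcontfun. ((\<lambda>s. LINT x:{x. g x \<le> s}|\<nu>. \<phi> x)
         has_real_derivative (LINT x|\<sigma>. \<phi> x)) (at r)))"

text \<open>
  The trace of \<open>f\<close> with respect to \<open>\<sigma>\<close>. As \<open>f\<close> is given up to \<open>\<nu>\<close>-null sets,
  ``\<open>f\<close> belongs to \<open>C\<^sub>b\<close>'' means that \<open>f\<close> has a bounded continuous representative,
  and the trace is then that representative. It need not be unique as a function when the
  support of \<open>\<nu>\<close> is not the whole space, but two of them agree on the support of \<open>\<nu>\<close>,
  outside of which the measures \<open>\<sigma>\<^sub>r\<^sup>g\<close> vanish.
\<close>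

definition has_Cb_version :: "'a::topological_space measure \<Rightarrow> ('a \<Rightarrow> real) \<Rightarrow> bool" where
  "has_Cb_version \<nu> f \<longleftrightarrow> (\<exists>h \<in> bcontfun. AE x in \<nu>. h x = f x)"

definition is_W1_trace ::
  "'a::{real_inner,polish_space} measure \<Rightarrow> ('a \<Rightarrow> 'a) \<Rightarrow> real \<Rightarrow> 'a measure \<Rightarrow>
     ('a \<Rightarrow> real) \<Rightarrow> ('a \<Rightarrow> real) \<Rightarrow> bool" where
  "is_W1_trace \<nu> R q \<sigma> f t \<longleftrightarrow> f \<in> W1 \<nu> R q \<and> integrable \<sigma> t \<and>
     (\<forall>\<phi>s. (\<forall>n. \<phi>s n \<in> C1b) \<and> (\<lambda>n. W1_norm \<nu> R q (\<lambda>x. \<phi>s n x - f x)) \<longlonglongrightarrow> 0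
        \<longrightarrow> Lp_tendsto 1 \<sigma> \<phi>s t)"

definition trace_op ::
  "'a::{real_inner,polish_space} measure \<Rightarrow> ('a \<Rightarrow> 'a) \<Rightarrow> 'a measure \<Rightarrow> ('a \<Rightarrow> real) \<Rightarrow> 'a \<Rightarrow> real"
where
  "trace_op \<nu> R \<sigma> f =
     (if has_Cb_version \<nu> f then SOME h. h \<in> bcontfun \<and> (AE x in \<nu>. h x = f x)
      else SOME t. \<exists>q>1. is_W1_trace \<nu> R q \<sigma> f t)"

subsection \<open>Capacity and quasicontinuity\<close>

definition capacity ::
  "'a::{real_inner,polish_space} measure \<Rightarrow> ('a \<Rightarrow> 'a) \<Rightarrow> real \<Rightarrow> 'a set \<Rightarrow> real" where
  "capacity \<nu> R p U = Inf {W1_norm \<nu> R p f |f. f \<in> W1 \<nu> R p \<and> (AE x in \<nu>. f x \<ge> indicator U x)}"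

definition quasicontinuous ::
  "'a::{real_inner,polish_space} measure \<Rightarrow> ('a \<Rightarrow> 'a) \<Rightarrow> real \<Rightarrow> ('a \<Rightarrow> real) \<Rightarrow> bool" where
  "quasicontinuous \<nu> R p f \<longleftrightarrow>
     (\<forall>\<epsilon>>0. \<exists>U. open U \<and> capacity \<nu> R p U < \<epsilon> \<and> continuous_on (- U) f)"

end

theory Submission
  imports Defs
begin

text \<open>Let \<open>\<Psi> = Mg / \<parallel>Mg\<parallel>\<^sup>2\<close>, so that \<open>\<langle>Mg, \<Psi>\<rangle> = 1\<close>, and write \<open>\<sigma>\<^sub>r\<close> for the surface measure. The proof
  consists of one integration by parts, which is used twice: for the given field \<open>F\<close>, and for \<open>\<Psi>\<close>,
  where it is what makes the surface measure and the traces exist.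

  For a bounded \<open>C\<^sup>1\<close> function \<open>\<theta>\<close> with bounded derivative, \<open>\<theta>(g) \<phi>\<close> has the derivative
  \<open>\<theta>(g) M\<phi> + \<theta>'(g) \<phi> Mg\<close>, and the definition of the adjoint gives
  \<open>\<integral> \<theta>'(g) \<langle>Mg, F\<rangle> \<phi> d\<nu> = \<integral> \<theta>(g) (\<phi> M\<^sup>*F - \<langle>M\<phi>, F\<rangle>) d\<nu>\<close> (\<open>integral_by_parts\<close>). Let \<open>\<theta>'\<close> tend to the
  indicator function of an interval between \<open>r\<close> and \<open>r + h\<close>, divide by \<open>h\<close>, and let \<open>h\<close> tend to \<open>0\<close>:
  the integral of \<open>\<langle>Mg, F\<rangle> \<phi>\<close> over \<open>{g \<le> s}\<close> is differentiable in \<open>s\<close> at each \<open>r\<close>, and its derivative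
  is the integral of \<open>\<phi> M\<^sup>*F - \<langle>M\<phi>, F\<rangle>\<close> over \<open>{g > r}\<close> (\<open>by_parts_derivative\<close>). As \<open>\<theta> = 1\<close> shows that
  this function has integral zero, the derivative equals the integral of \<open>\<langle>M\<phi>, F\<rangle> - \<phi> M\<^sup>*F\<close> over
  \<open>{g < r}\<close>. The first equation of the theorem therefore says that the derivative of the integral of
  \<open>f = \<langle>Mg, F\<rangle> \<phi>\<close> over sublevel sets is \<open>\<integral> T f d\<sigma>\<^sub>r\<close>. For \<open>f\<close> in \<open>C\<^sub>b\<close> this is the definition of
  \<open>\<sigma>\<^sub>r\<close>. For \<open>f\<close> in \<open>W\<^sup>1\<^sup>,\<^sup>q\<close>, the formula with \<open>\<Psi>\<close> for \<open>F\<close> and \<open>f\<close> for \<open>\<phi>\<close> shows that the derivative is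
  bounded by a multiple of the norm of \<open>f\<close> (\<open>sobolev_derivative_bound\<close>). Applied to smooth versions of
  \<open>\<bar>u - w\<bar>\<close> with \<open>u\<close> and \<open>w\<close> in \<open>C\<^sub>b\<^sup>1\<close>, the same bound proves the existence of the trace
  (\<open>trace_exists\<close>), and the equation follows by approximation (\<open>dlevel_is_W1_trace\<close>).

  The existence of \<open>\<sigma>\<^sub>r\<close> for every \<open>r\<close> is the longest part. The derivative exists on \<open>C\<^sub>b\<^sup>1\<close>, and it is a
  positive functional there. It is tight: there are functions in \<open>C\<^sub>b\<^sup>1\<close> that vanish near the first \<open>n\<close>
  points of a dense sequence and are bounded below at some distance from them, with gradients bounded
  uniformly in \<open>n\<close> (\<open>ball_cutoffs\<close>). By dominated convergence the functional is small on them for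
  large \<open>n\<close>, so up to small errors it only sees finitely many balls of any given radius, hence a compact set
  (\<open>dlevel_tight\<close>). On compact sets, functions in \<open>C\<^sub>b\<close> are approximated by Stone--Weierstrass, so the
  derivative exists on \<open>C\<^sub>b\<close> (\<open>dlevel_bcontfun\<close>), and by Dini's theorem it is continuous along sequences
  that decrease to zero. The construction of Daniell then gives the measure (\<open>integral_repr\<close>,
  \<open>surface_measure\<close>).

  For the last equation, \<open>g\<^sup>* = r\<close> has to hold \<open>\<sigma>\<^sub>r\<close>-almost everywhere. Let \<open>O\<close> be an open set of small
  capacity off which \<open>g\<^sup>*\<close> is continuous. Then \<open>{\<bar>g\<^sup>* - r\<bar> > \<delta>} \<union> O\<close> is open. On the layers
  \<open>{r < g \<le> r + h}\<close> with \<open>h < \<delta>\<close> it is contained in \<open>O\<close> up to a null set, so a function in \<open>C\<^sub>b\<close> below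
  its indicator function is there below any \<open>f\<close> that is admissible for the capacity of \<open>O\<close>. Hence its
  surface measure is at most a multiple of the capacity (\<open>surface_measure_off_level\<close>).\<close>

section \<open>The spaces \<open>L\<^sup>p\<close>\<close>

lemma Lp_measurable: "f \<in> Lp p M \<Longrightarrow> f \<in> borel_measurable M"
  by (simp add: Lp_def)

lemma Lp_integrable: "f \<in> Lp p M \<Longrightarrow> integrable M (\<lambda>x. norm (f x) powr p)"
  by (simp add: Lp_def)

lemma Lp_norm_nonneg: "Lp_norm p M f \<ge> 0"
  by (simp add: Lp_norm_def)

lemma Lp_norm_powr:
  assumes "p > 0"
  shows "Lp_norm p M f powr p = (LINT x|M. norm (f x) powr p)"
  using assms by (simp add: Lp_norm_def powr_powr)

lemma Lp_norm_cong_AE: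
  assumes "f \<in> borel_measurable M" "g \<in> borel_measurable M" "AE x in M. f x = g x"
  shows "Lp_norm p M f = Lp_norm p M g"
  unfolding Lp_norm_def
  by (intro arg_cong2[where f="(powr)"] integral_cong_AE) (use assms in auto)

lemma Lp_cong_AE:
  assumes "f \<in> Lp p M" "g \<in> borel_measurable M" "AE x in M. f x = g x"
  shows "g \<in> Lp p M"
proof -
  have "integrable M (\<lambda>x. norm (g x) powr p)"
    by (rule integrable_cong_AE_imp[OF Lp_integrable[OF assms(1)]])
       (use assms(2,3) in auto)
  then show ?thesis using assms by (simp add: Lp_def)
qed

lemma Lp_norm_mono:
  assumes f: "f \<in> Lp p M" and h: "h \<in> Lp p M" and le: "\<And>x. norm (f x) \<le> norm (h x)" and p: "p > 0"
  shows "Lp_norm p M f \<le> Lp_norm p M h"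
proof -
  have "(LINT x|M. norm (f x) powr p) \<le> (LINT x|M. norm (h x) powr p)"
  proof (rule integral_mono[OF Lp_integrable[OF f] Lp_integrable[OF h]])
    show "norm (f x) powr p \<le> norm (h x) powr p" for x
      using le p by (intro powr_mono2) auto
  qed
  then show ?thesis unfolding Lp_norm_def using p by (intro powr_mono2) auto
qed

lemma bounded_in_Lp:
  assumes "finite_measure M" "f \<in> borel_measurable M" "\<And>x. norm (f x) \<le> B" "p > 0"
  shows "f \<in> Lp p M"
proof -
  interpret finite_measure M by fact
  have "integrable M (\<lambda>x. norm (f x) powr p)"
    by (rule integrable_const_bound[where B="B powr p"])
       (use assms in \<open>auto intro!: powr_mono2\<close>)
  then show ?thesis using assms by (simp add: Lp_def)
qed

lemma powr_add_le_two:
  fixes a b p :: real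
  assumes "a \<ge> 0" "b \<ge> 0" "p > 0"
  shows "(a + b) powr p \<le> 2 powr p * (a powr p + b powr p)"
proof -
  have "(a + b) powr p \<le> (2 * max a b) powr p"
    by (rule powr_mono2) (use assms in auto)
  also have "\<dots> = 2 powr p * (max a b) powr p"
    using assms by (simp add: powr_mult)
  also have "(max a b) powr p \<le> a powr p + b powr p"
    by (auto simp: max_def)
  finally show ?thesis by simp
qed

lemma Lp_add:
  fixes f g :: "'a \<Rightarrow> 'b::{real_normed_vector,second_countable_topology}"
  assumes "f \<in> Lp p M" "g \<in> Lp p M" "p > 0"
  shows "(\<lambda>x. f x + g x) \<in> Lp p M"
proof -
  note [measurable] = Lp_measurable[OF assms(1)] Lp_measurable[OF assms(2)]
  have "integrable M (\<lambda>x. norm (f x + g x) powr p)"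
  proof (rule Bochner_Integration.integrable_bound)
    show "integrable M (\<lambda>x. 2 powr p * (norm (f x) powr p + norm (g x) powr p))"
      using assms by (simp add: Lp_integrable)
    have "norm (f x + g x) powr p \<le> (norm (f x) + norm (g x)) powr p" for x
      by (rule powr_mono2) (use assms in \<open>auto simp: norm_triangle_ineq\<close>)
    also have "(norm (f x) + norm (g x)) powr p \<le> 2 powr p * (norm (f x) powr p + norm (g x) powr p)" for x
      by (rule powr_add_le_two) (use assms in auto)
    finally show "AE x in M. norm (norm (f x + g x) powr p)
        \<le> norm (2 powr p * (norm (f x) powr p + norm (g x) powr p))"
      by (intro AE_I2) (simp add: abs_of_nonneg)
  qed measurable
  then show ?thesis by (simp add: Lp_def)
qed

text \<open>The constant \<open>4\<close> replaces Minkowski's constant \<open>1\<close>; it comes from the crude bound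
  \<open>(a + b)\<^sup>p \<le> 2\<^sup>p (a\<^sup>p + b\<^sup>p)\<close> and is good enough for all limits.\<close>

lemma Lp_norm_add_le:
  fixes f g :: "'a \<Rightarrow> 'b::{real_normed_vector,second_countable_topology}"
  assumes "f \<in> Lp p M" "g \<in> Lp p M" "p \<ge> 1"
  shows "Lp_norm p M (\<lambda>x. f x + g x) \<le> 4 * (Lp_norm p M f + Lp_norm p M g)"
proof -
  define A where "A = Lp_norm p M f" 
  define B where "B = Lp_norm p M g"
  have AB: "A \<ge> 0" "B \<ge> 0" by (auto simp: A_def B_def Lp_norm_nonneg)
  have "(LINT x|M. norm (f x + g x) powr p)
      \<le> (LINT x|M. 2 powr p * (norm (f x) powr p + norm (g x) powr p))"
  proof (rule integral_mono)
    show "integrable M (\<lambda>x. norm (f x + g x) powr p)"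
      using Lp_integrable[OF Lp_add[OF assms(1,2)]] assms by simp
    show "integrable M (\<lambda>x. 2 powr p * (norm (f x) powr p + norm (g x) powr p))"
      using assms by (simp add: Lp_integrable)
    fix x
    have "norm (f x + g x) powr p \<le> (norm (f x) + norm (g x)) powr p"
      by (rule powr_mono2) (use assms in \<open>auto simp: norm_triangle_ineq\<close>)
    also have "\<dots> \<le> 2 powr p * (norm (f x) powr p + norm (g x) powr p)"
      by (rule powr_add_le_two) (use assms in auto)
    finally show "norm (f x + g x) powr p \<le> 2 powr p * (norm (f x) powr p + norm (g x) powr p)" .
  qed
  also have "\<dots> = 2 powr p * (A powr p + B powr p)"
    using assms by (simp add: A_def B_def Lp_norm_powr Lp_integrable)
  also have "\<dots> \<le> 2 powr p * (2 * (A + B) powr p)"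
  proof -
    have "A powr p \<le> (A + B) powr p" "B powr p \<le> (A + B) powr p"
      by (rule powr_mono2; use AB assms in auto)+
    then show ?thesis by simp
  qed
  also have "\<dots> \<le> 2 powr p * (2 powr p * (A + B) powr p)"
  proof -
    have "2 powr 1 \<le> (2::real) powr p" by (rule powr_mono) (use assms in auto)
    then show ?thesis by (simp add: mult_right_mono)
  qed
  also have "\<dots> = (4 * (A + B)) powr p"
    using AB powr_mult[of 2 2 p] powr_mult[of 4 "A + B" p] by (simp add: mult.assoc)
  finally have "Lp_norm p M (\<lambda>x. f x + g x) \<le> ((4 * (A + B)) powr p) powr (1 / p)"
    unfolding Lp_norm_def by (intro powr_mono2) (use assms in auto)
  also have "\<dots> = 4 * (A + B)"
    using assms AB by (simp add: powr_powr)
  finally show ?thesis by (simp add: A_def B_def)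
qed

lemma Lp_minus:
  fixes f :: "'a \<Rightarrow> 'b::{real_normed_vector,second_countable_topology}"
  shows "f \<in> Lp p M \<Longrightarrow> (\<lambda>x. - f x) \<in> Lp p M"
  by (simp add: Lp_def)

lemma Lp_norm_minus: "Lp_norm p M (\<lambda>x. - f x) = Lp_norm p M f"
  by (simp add: Lp_norm_def)

lemma Lp_diff:
  fixes f g :: "'a \<Rightarrow> 'b::{real_normed_vector,second_countable_topology}"
  assumes "f \<in> Lp p M" "g \<in> Lp p M" "p > 0"
  shows "(\<lambda>x. f x - g x) \<in> Lp p M"
  using Lp_add[OF assms(1) Lp_minus[OF assms(2)] assms(3)] by simp

lemma Lp_norm_diff_le:
  fixes f g :: "'a \<Rightarrow> 'b::{real_normed_vector,second_countable_topology}"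
  assumes "f \<in> Lp p M" "g \<in> Lp p M" "p \<ge> 1"
  shows "Lp_norm p M (\<lambda>x. f x - g x) \<le> 4 * (Lp_norm p M f + Lp_norm p M g)"
  using Lp_norm_add_le[OF assms(1) Lp_minus[OF assms(2)] assms(3)] by (simp add: Lp_norm_minus)

lemma Lp_tendsto_diff:
  fixes f g :: "'a \<Rightarrow> 'b::{real_normed_vector,second_countable_topology}"
  assumes f: "Lp_tendsto p M fs f" and g: "Lp_tendsto p M gs g" and "p \<ge> 1"
  shows "Lp_tendsto p M (\<lambda>n x. fs n x - gs n x) (\<lambda>x. f x - g x)"
proof -
  have Lp: "fs n \<in> Lp p M" "gs n \<in> Lp p M" "f \<in> Lp p M" "g \<in> Lp p M" for n
    using f g by (auto simp: Lp_tendsto_def)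
  have "(\<lambda>n. Lp_norm p M (\<lambda>x. (fs n x - gs n x) - (f x - g x))) \<longlonglongrightarrow> 0"
  proof (rule tendsto_sandwich[OF always_eventually always_eventually])
    show "\<forall>n. 0 \<le> Lp_norm p M (\<lambda>x. (fs n x - gs n x) - (f x - g x))"
      by (simp add: Lp_norm_nonneg)
    show "\<forall>n. Lp_norm p M (\<lambda>x. (fs n x - gs n x) - (f x - g x))
        \<le> 4 * (Lp_norm p M (\<lambda>x. fs n x - f x) + Lp_norm p M (\<lambda>x. gs n x - g x))"
    proof
      fix n
      have "(\<lambda>x. (fs n x - gs n x) - (f x - g x)) = (\<lambda>x. (fs n x - f x) - (gs n x - g x))"
        by auto
      then show "Lp_norm p M (\<lambda>x. (fs n x - gs n x) - (f x - g x))
        \<le> 4 * (Lp_norm p M (\<lambda>x. fs n x - f x) + Lp_norm p M (\<lambda>x. gs n x - g x))"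
        using Lp_norm_diff_le[of "\<lambda>x. fs n x - f x" p M "\<lambda>x. gs n x - g x"] Lp assms(3)
        by (simp add: Lp_diff)
    qed
    have "(\<lambda>n. 4 * (Lp_norm p M (\<lambda>x. fs n x - f x) + Lp_norm p M (\<lambda>x. gs n x - g x)))
       \<longlonglongrightarrow> 4 * (0 + 0)"
      by (intro tendsto_intros) (use f g in \<open>auto simp: Lp_tendsto_def\<close>)
    then show "(\<lambda>n. 4 * (Lp_norm p M (\<lambda>x. fs n x - f x) + Lp_norm p M (\<lambda>x. gs n x - g x)))
       \<longlonglongrightarrow> 0" by simp
  qed simp
  then show ?thesis using Lp assms(3) by (simp add: Lp_tendsto_def Lp_diff)
qed

lemma Lp_tendsto_const:
  "f \<in> Lp p M \<Longrightarrow> Lp_tendsto p M (\<lambda>_. f) f"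
  by (simp add: Lp_tendsto_def Lp_norm_def)

lemma Lp_tendsto_iff_integral:
  assumes "p > 0"
  shows "Lp_tendsto p M fs f \<longleftrightarrow> (\<forall>n. fs n \<in> Lp p M) \<and> f \<in> Lp p M \<and>
     (\<lambda>n. LINT x|M. norm (fs n x - f x) powr p) \<longlonglongrightarrow> 0"
proof -
  let ?I = "\<lambda>n. LINT x|M. norm (fs n x - f x) powr p"
  have "(\<lambda>n. Lp_norm p M (\<lambda>x. fs n x - f x)) \<longlonglongrightarrow> 0 \<longleftrightarrow> ?I \<longlonglongrightarrow> 0"
  proof
    assume "(\<lambda>n. Lp_norm p M (\<lambda>x. fs n x - f x)) \<longlonglongrightarrow> 0"
    then have "(\<lambda>n. Lp_norm p M (\<lambda>x. fs n x - f x) powr p) \<longlonglongrightarrow> 0"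
      using assms by (intro tendsto_zero_powrI[where b=p]) (auto simp: Lp_norm_nonneg)
    then show "?I \<longlonglongrightarrow> 0" using assms by (simp add: Lp_norm_powr)
  next
    assume "?I \<longlonglongrightarrow> 0"
    then show "(\<lambda>n. Lp_norm p M (\<lambda>x. fs n x - f x)) \<longlonglongrightarrow> 0"
      unfolding Lp_norm_def
      using assms by (intro tendsto_zero_powrI[where b="1/p"]) (auto simp: integral_nonneg)
  qed
  then show ?thesis by (simp add: Lp_tendsto_def)
qed

lemma Lp_tendsto_AE_subseq:
  fixes f :: "'a \<Rightarrow> 'b::{real_normed_vector,second_countable_topology}"
  assumes "Lp_tendsto p M fs f" "p > 0"
  shows "\<exists>k. strict_mono k \<and> (AE x in M. (\<lambda>n. fs (k n) x) \<longlonglongrightarrow> f x)"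
proof -
  have Lp: "fs n \<in> Lp p M" "f \<in> Lp p M" for n
    using assms by (auto simp: Lp_tendsto_def)
  have "\<exists>k. strict_mono k \<and> (AE x in M. (\<lambda>n. norm (fs (k n) x - f x) powr p) \<longlonglongrightarrow> 0)"
    by (rule tendsto_L1_AE_subseq)
       (use assms Lp in \<open>auto simp: Lp_tendsto_iff_integral intro!: Lp_integrable Lp_diff\<close>)
  then obtain k where k: "strict_mono k"
    "AE x in M. (\<lambda>n. norm (fs (k n) x - f x) powr p) \<longlonglongrightarrow> 0" by blast
  have "(\<lambda>n. fs (k n) x) \<longlonglongrightarrow> f x" if "(\<lambda>n. norm (fs (k n) x - f x) powr p) \<longlonglongrightarrow> 0" for x
  proof -
    have "(\<lambda>n. (norm (fs (k n) x - f x) powr p) powr (1/p)) \<longlonglongrightarrow> 0"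
      by (rule tendsto_zero_powrI[where b="1/p", OF that tendsto_const]) (use assms(2) in auto)
    then have "(\<lambda>n. norm (fs (k n) x - f x)) \<longlonglongrightarrow> 0"
      using assms(2) by (simp add: powr_powr)
    then show ?thesis
      using LIM_zero_iff tendsto_norm_zero_iff by blast
  qed
  with k show ?thesis by (intro exI[of _ k]) (auto elim: eventually_mono)
qed

lemma Lp_tendsto_subseq:
  "Lp_tendsto p M fs f \<Longrightarrow> strict_mono k \<Longrightarrow> Lp_tendsto p M (\<lambda>n. fs (k n)) f"
  unfolding Lp_tendsto_def
  using LIMSEQ_subseq_LIMSEQ[of "\<lambda>n. Lp_norm p M (\<lambda>x. fs n x - f x)" 0 k] by (auto simp: o_def)

subsection \<open>Duality\<close>

lemma conjugate_exponent:
  fixes p :: real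
  assumes "p > 1"
  shows "p / (p - 1) > 1" "1 / p + 1 / (p / (p - 1)) = 1"
  using assms by (auto simp: field_simps)

lemma conjugate_less:
  fixes p p1 :: real
  assumes "1 < p" "p < p1"
  shows "p1 / (p1 - 1) < p / (p - 1)" "p1 / (p1 - 1) \<ge> 1"
proof -
  have "1 + 1 / (p1 - 1) < 1 + 1 / (p - 1)"
    using assms by (simp add: frac_less2)
  then show "p1 / (p1 - 1) < p / (p - 1)" "p1 / (p1 - 1) \<ge> 1"
    using assms by (simp_all add: add_divide_eq_iff)
qed

lemma integrable_norm_mult_Lp:
  assumes f: "f \<in> Lp p M" and w: "w \<in> Lp (p / (p - 1)) M" and p: "p > 1"
  shows "integrable M (\<lambda>x. norm (f x) * norm (w x))"
proof (rule Bochner_Integration.integrable_bound)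
  let ?q = "p / (p - 1)"
  note q = conjugate_exponent[OF p]
  show "integrable M (\<lambda>x. norm (f x) powr p / p + norm (w x) powr ?q / ?q)"
    using Lp_integrable[OF f] Lp_integrable[OF w] by (intro Bochner_Integration.integrable_add integrable_divide)
  have "norm (f x) * norm (w x) \<le> norm (f x) powr p / p + norm (w x) powr ?q / ?q" for x
    by (rule Youngs_inequality) (use p q in auto)
  then show "AE x in M. norm (norm (f x) * norm (w x))
      \<le> norm (norm (f x) powr p / p + norm (w x) powr ?q / ?q)"
    using order_trans[OF _ abs_ge_self] by (intro AE_I2) auto
qed (use Lp_measurable[OF f] Lp_measurable[OF w] in measurable)

lemma Lp_norm_eq_0_AE:
  assumes f: "f \<in> Lp p M" and "Lp_norm p M f = 0" "p > 0"
  shows "AE x in M. f x = 0"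
proof -
  have "(LINT x|M. norm (f x) powr p) = 0"
    using Lp_norm_powr[OF assms(3), of M f] assms by simp
  then have "AE x in M. norm (f x) powr p = 0"
    using integral_nonneg_eq_0_iff_AE[OF Lp_integrable[OF f]] by simp
  then show ?thesis by (auto elim: eventually_mono)
qed

text \<open>Young's inequality, applied to the two functions divided by their norms.\<close>

lemma Holder_inequality:
  assumes f: "f \<in> Lp p M" and w: "w \<in> Lp (p / (p - 1)) M" and p: "p > 1"
  shows "(LINT x|M. norm (f x) * norm (w x)) \<le> Lp_norm p M f * Lp_norm (p / (p - 1)) M w"
proof -
  let ?q = "p / (p - 1)"
  define A where "A = Lp_norm p M f" 
  define B where "B = Lp_norm ?q M w"
  note q = conjugate_exponent[OF p]
  note [measurable] = Lp_measurable[OF f] Lp_measurable[OF w]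
  show ?thesis
  proof (cases "A = 0 \<or> B = 0")
    case True
    then have "(AE x in M. f x = 0) \<or> (AE x in M. w x = 0)"
      using Lp_norm_eq_0_AE[OF f] Lp_norm_eq_0_AE[OF w] p q by (auto simp: A_def B_def)
    then have "AE x in M. norm (f x) * norm (w x) = 0"
      by (auto elim: eventually_mono)
    then have "(LINT x|M. norm (f x) * norm (w x)) = 0"
      using integral_cong_AE[of "\<lambda>x. norm (f x) * norm (w x)" M "\<lambda>_. 0"] by simp
    then show ?thesis by (simp add: Lp_norm_nonneg)
  next
    case False
    then have AB: "A > 0" "B > 0" 
      using Lp_norm_nonneg[of p M f] Lp_norm_nonneg[of ?q M w] unfolding A_def B_def by linarith+
    have "(LINT x|M. norm (f x) * norm (w x) / (A * B))
       \<le> (LINT x|M. norm (f x) powr p / A powr p / p + norm (w x) powr ?q / B powr ?q / ?q)"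
    proof (rule integral_mono)
      show "integrable M (\<lambda>x. norm (f x) * norm (w x) / (A * B))"
        using integrable_norm_mult_Lp[OF f w p] by simp
      show "integrable M (\<lambda>x. norm (f x) powr p / A powr p / p + norm (w x) powr ?q / B powr ?q / ?q)"
        using Lp_integrable[OF f] Lp_integrable[OF w]
        by (intro Bochner_Integration.integrable_add integrable_divide)
      fix x
      have "(norm (f x) / A) * (norm (w x) / B)
          \<le> (norm (f x) / A) powr p / p + (norm (w x) / B) powr ?q / ?q"
        by (rule Youngs_inequality) (use p q AB in auto)
      then show "norm (f x) * norm (w x) / (A * B)
          \<le> norm (f x) powr p / A powr p / p + norm (w x) powr ?q / B powr ?q / ?q"
        using AB by (simp add: powr_divide)
    qed
    also have "\<dots> = (A powr p) / A powr p / p + (B powr ?q) / B powr ?q / ?q"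
      using Lp_integrable[OF f] Lp_integrable[OF w] p q
      using q(1) by (subst Bochner_Integration.integral_add)
         (simp_all only: A_def B_def Lp_norm_powr integral_divide_zero
            Bochner_Integration.integrable_divide)
    also have "\<dots> = 1" using AB q(2) by simp
    finally have "(LINT x|M. norm (f x) * norm (w x)) / (A * B) \<le> 1" by simp
    then show ?thesis using AB by (simp add: A_def B_def divide_le_eq)
  qed
qed

lemma integrable_inner_Lp:
  fixes f w :: "'a \<Rightarrow> 'b::{real_inner,second_countable_topology}"
  assumes f: "f \<in> Lp p M" and w: "w \<in> Lp (p / (p - 1)) M" and p: "p > 1"
  shows "integrable M (\<lambda>x. f x \<bullet> w x)"
proof (rule Bochner_Integration.integrable_bound[OF integrable_norm_mult_Lp[OF f w p]])
  show "(\<lambda>x. f x \<bullet> w x) \<in> borel_measurable M"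
    using Lp_measurable[OF f] Lp_measurable[OF w] by measurable
qed (auto simp: Cauchy_Schwarz_ineq2)

lemma abs_integral_inner_le:
  fixes f w :: "'a \<Rightarrow> 'b::{real_inner,second_countable_topology}"
  assumes f: "f \<in> Lp p M" and w: "w \<in> Lp (p / (p - 1)) M" and p: "p > 1"
    and k: "k \<in> borel_measurable M" "\<And>x. \<bar>k x\<bar> \<le> C"
  shows "integrable M (\<lambda>x. k x * (f x \<bullet> w x))"
    "\<bar>LINT x|M. k x * (f x \<bullet> w x)\<bar> \<le> C * (Lp_norm p M f * Lp_norm (p / (p - 1)) M w)"
proof -
  have C: "C \<ge> 0" using k(2) abs_ge_zero order_trans by blast
  note [measurable] = Lp_measurable[OF f] Lp_measurable[OF w] k(1)
  have le: "\<bar>k x * (f x \<bullet> w x)\<bar> \<le> C * (norm (f x) * norm (w x))" for x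
    unfolding abs_mult by (intro mult_mono k Cauchy_Schwarz_ineq2) (use C in auto)
  have int: "integrable M (\<lambda>x. C * (norm (f x) * norm (w x)))"
    using integrable_norm_mult_Lp[OF f w p] by simp
  show i: "integrable M (\<lambda>x. k x * (f x \<bullet> w x))"
  proof (rule Bochner_Integration.integrable_bound[OF int])
    show "AE x in M. norm (k x * (f x \<bullet> w x)) \<le> norm (C * (norm (f x) * norm (w x)))"
      using order_trans[OF le abs_ge_self] by simp
  qed measurable
  have "\<bar>LINT x|M. k x * (f x \<bullet> w x)\<bar> \<le> (LINT x|M. \<bar>k x * (f x \<bullet> w x)\<bar>)"
    by (rule integral_abs_bound)
  also have "\<dots> \<le> (LINT x|M. C * (norm (f x) * norm (w x)))"
    by (rule integral_mono) (use i int le in auto)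
  also have "\<dots> \<le> C * (Lp_norm p M f * Lp_norm (p / (p - 1)) M w)"
    using Holder_inequality[OF f w p] C by (simp add: mult_left_mono)
  finally show "\<bar>LINT x|M. k x * (f x \<bullet> w x)\<bar> \<le> C * (Lp_norm p M f * Lp_norm (p / (p - 1)) M w)" .
qed

text \<open>The limit passes through a product of three factors when one converges in \<open>L\<^sup>p\<close>, one
  is fixed in the dual space, and one is bounded and converges almost everywhere.\<close>

lemma tendsto_integral_inner:
  fixes f w :: "'a \<Rightarrow> 'b::{real_inner,second_countable_topology}"
  assumes fs: "Lp_tendsto p M fs f" and w: "w \<in> Lp (p / (p - 1)) M" and p: "p > 1"
    and k: "\<And>n. ks n \<in> borel_measurable M" "k \<in> borel_measurable M"
      "\<And>n x. \<bar>ks n x\<bar> \<le> C" "AE x in M. (\<lambda>n. ks n x) \<longlonglongrightarrow> k x"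
  shows "(\<lambda>n. LINT x|M. ks n x * (fs n x \<bullet> w x)) \<longlonglongrightarrow> (LINT x|M. k x * (f x \<bullet> w x))"
proof -
  have Lp: "fs n \<in> Lp p M" "f \<in> Lp p M" "(\<lambda>x. fs n x - f x) \<in> Lp p M" for n
    using fs p by (auto simp: Lp_tendsto_def Lp_diff)
  note [measurable] = Lp_measurable[OF Lp(1)] Lp_measurable[OF Lp(2)] Lp_measurable[OF w] k(1,2)
  have 1: "(\<lambda>n. LINT x|M. ks n x * ((fs n x - f x) \<bullet> w x)) \<longlonglongrightarrow> 0"
  proof (rule Lim_null_comparison[OF always_eventually])
    show "\<forall>n. norm (LINT x|M. ks n x * ((fs n x - f x) \<bullet> w x))
       \<le> C * (Lp_norm p M (\<lambda>x. fs n x - f x) * Lp_norm (p / (p - 1)) M w)"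
      using abs_integral_inner_le(2)[OF Lp(3) w p k(1,3)] by simp
    have "(\<lambda>n. C * (Lp_norm p M (\<lambda>x. fs n x - f x) * Lp_norm (p / (p - 1)) M w))
       \<longlonglongrightarrow> C * (0 * Lp_norm (p / (p - 1)) M w)"
      by (intro tendsto_intros) (use fs in \<open>auto simp: Lp_tendsto_def\<close>)
    then show "(\<lambda>n. C * (Lp_norm p M (\<lambda>x. fs n x - f x) * Lp_norm (p / (p - 1)) M w)) \<longlonglongrightarrow> 0"
      by simp
  qed
  have 2: "(\<lambda>n. LINT x|M. ks n x * (f x \<bullet> w x)) \<longlonglongrightarrow> (LINT x|M. k x * (f x \<bullet> w x))"
  proof (rule integral_dominated_convergence[where w="\<lambda>x. C * (norm (f x) * norm (w x))"])
    show "integrable M (\<lambda>x. C * (norm (f x) * norm (w x)))"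
      using integrable_norm_mult_Lp[OF Lp(2) w p] by simp
    show "AE x in M. (\<lambda>n. ks n x * (f x \<bullet> w x)) \<longlonglongrightarrow> k x * (f x \<bullet> w x)"
      using k(4) by (auto elim!: eventually_mono intro!: tendsto_intros)
    show "AE x in M. norm (ks n x * (f x \<bullet> w x)) \<le> C * (norm (f x) * norm (w x))" for n
    proof (rule AE_I2)
      fix x
      have "C \<ge> 0" using k(3) abs_ge_zero order_trans by blast
      then show "norm (ks n x * (f x \<bullet> w x)) \<le> C * (norm (f x) * norm (w x))"
        unfolding real_norm_def abs_mult by (intro mult_mono k Cauchy_Schwarz_ineq2) auto
    qed
  qed measurable
  have eq: "(LINT x|M. ks n x * (fs n x \<bullet> w x))
      = (LINT x|M. ks n x * ((fs n x - f x) \<bullet> w x)) + (LINT x|M. ks n x * (f x \<bullet> w x))" for n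
    by (subst Bochner_Integration.integral_add[symmetric])
       (simp_all add: abs_integral_inner_le(1)[OF Lp(3) w p k(1,3)] abs_integral_inner_le(1)[OF Lp(2) w p k(1,3)]
          flip: distrib_left inner_add_left)
  show ?thesis using tendsto_add[OF 1 2] by (simp add: eq)
qed

lemma Lp_mono_exponent:
  assumes "finite_measure M" "f \<in> Lp p M" "0 < s" "s \<le> p"
  shows "f \<in> Lp s M"
proof -
  interpret finite_measure M by fact
  have "integrable M (\<lambda>x. norm (f x) powr s)"
  proof (rule Bochner_Integration.integrable_bound)
    show "integrable M (\<lambda>x. 1 + norm (f x) powr p)"
      using Lp_integrable[OF assms(2)] by simp
    have "norm (f x) powr s \<le> 1 + norm (f x) powr p" for x
    proof (cases "norm (f x) \<le> 1")
      case True
      then have "norm (f x) powr s \<le> 1" using assms by (simp add: powr_le1)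
      then show ?thesis by (simp add: add_increasing2)
    next
      case False
      then have "norm (f x) powr s \<le> norm (f x) powr p" using assms by (intro powr_mono) auto
      then show ?thesis by simp
    qed
    then show "AE x in M. norm (norm (f x) powr s) \<le> norm (1 + norm (f x) powr p)"
      by (simp add: abs_of_nonneg)
  qed (use Lp_measurable[OF assms(2)] in measurable)
  then show ?thesis using assms by (simp add: Lp_def)
qed

text \<open>Hoelder for \<open>\<parallel>f\<parallel>\<^sup>s\<close> and the constant \<open>1\<close>, with the exponent \<open>p / s\<close>.\<close>

lemma Lp_norm_mono_exponent:
  assumes "prob_space M" "f \<in> Lp p M" "0 < s" "s \<le> p"
  shows "Lp_norm s M f \<le> Lp_norm p M f"
proof (cases "s = p")
  case False
  interpret prob_space M by fact
  let ?t = "p / s"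
  have t: "?t > 1" using False assms by simp
  have f: "(\<lambda>x. norm (f x) powr s) \<in> Lp ?t M"
    using assms by (auto simp: Lp_def powr_powr)
  have one: "(\<lambda>_. 1::real) \<in> Lp (?t / (?t - 1)) M"
    using conjugate_exponent[OF t] by (intro bounded_in_Lp[where B=1] finite_measure) auto
  have "(LINT x|M. norm (f x) powr s)
      \<le> Lp_norm ?t M (\<lambda>x. norm (f x) powr s) * Lp_norm (?t / (?t - 1)) M (\<lambda>_. 1::real)"
    using Holder_inequality[OF f one t] by simp
  also have "Lp_norm (?t / (?t - 1)) M (\<lambda>_. 1::real) = 1"
    by (simp add: Lp_norm_def prob_space)
  also have "Lp_norm ?t M (\<lambda>x. norm (f x) powr s) = Lp_norm p M f powr s"
    using assms by (simp add: Lp_norm_def powr_powr)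
  finally have "Lp_norm s M f \<le> (Lp_norm p M f powr s) powr (1/s)"
    unfolding Lp_norm_def[of s] using assms by (intro powr_mono2) auto
  also have "\<dots> = Lp_norm p M f"
    using assms by (simp add: powr_powr Lp_norm_nonneg)
  finally show ?thesis .
qed simp

lemma Lp_tendsto_mono_exponent:
  fixes f :: "'a \<Rightarrow> 'b::{real_normed_vector,second_countable_topology}"
  assumes M: "prob_space M" and fs: "Lp_tendsto p M fs f" and s: "0 < s" "s \<le> p"
  shows "Lp_tendsto s M fs f"
proof -
  interpret prob_space M by fact
  have Lp: "fs n \<in> Lp p M" "f \<in> Lp p M" "(\<lambda>x. fs n x - f x) \<in> Lp p M" for n
    using fs s by (auto simp: Lp_tendsto_def Lp_diff)
  have "(\<lambda>n. Lp_norm s M (\<lambda>x. fs n x - f x)) \<longlonglongrightarrow> 0"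
  proof (rule tendsto_sandwich[OF always_eventually always_eventually])
    show "\<forall>n. 0 \<le> Lp_norm s M (\<lambda>x. fs n x - f x)"
      by (simp add: Lp_norm_nonneg)
    show "\<forall>n. Lp_norm s M (\<lambda>x. fs n x - f x) \<le> Lp_norm p M (\<lambda>x. fs n x - f x)"
      using Lp_norm_mono_exponent[OF M Lp(3) s] by simp
  qed (use fs in \<open>auto simp: Lp_tendsto_def Lp_norm_nonneg\<close>)
  then show ?thesis
    using Lp s by (auto simp: Lp_tendsto_def intro: Lp_mono_exponent[OF finite_measure])
qed

text \<open>Hoelder with the exponents \<open>q / s\<close> and its conjugate, for \<open>\<parallel>w\<parallel>\<^sup>s\<close> and \<open>\<parallel>f\<parallel>\<^sup>s\<close>.\<close>

lemma Lp_inner: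
  fixes f w :: "'a \<Rightarrow> 'b::{real_inner,second_countable_topology}"
  assumes f: "\<And>m. m > 1 \<Longrightarrow> f \<in> Lp m M" and w: "w \<in> Lp q M" and s: "1 \<le> s" "s < q"
  shows "(\<lambda>x. f x \<bullet> w x) \<in> Lp s M"
proof -
  let ?t = "q / s"
  have t: "?t > 1" using s by simp
  note t' = conjugate_exponent[OF t]
  have ex: "s * (?t / (?t - 1)) > 1"
    using mult_strict_mono'[of 1 "?t / (?t - 1)" 1 s] s t' 
    by (metis less_1_mult mult.right_neutral mult_1 nless_le order_le_less)
  have 1: "(\<lambda>x. norm (w x) powr s) \<in> Lp ?t M"
    using w s by (auto simp: Lp_def powr_powr)
  have 2: "(\<lambda>x. norm (f x) powr s) \<in> Lp (?t / (?t - 1)) M"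
    using f[OF ex] by (auto simp: Lp_def powr_powr)
  note [measurable] = Lp_measurable[OF f[of 2]] Lp_measurable[OF w]
  have "integrable M (\<lambda>x. norm (f x \<bullet> w x) powr s)"
  proof (rule Bochner_Integration.integrable_bound[OF integrable_norm_mult_Lp[OF 1 2 t]])
    have "\<bar>f x \<bullet> w x\<bar> powr s \<le> (norm (f x) * norm (w x)) powr s" for x
      by (rule powr_mono2) (use s Cauchy_Schwarz_ineq2 in auto)
    then show "AE x in M. norm (norm (f x \<bullet> w x) powr s)
       \<le> norm (norm (norm (w x) powr s) * norm (norm (f x) powr s))"
      by (simp add: powr_mult mult.commute)
  qed simp
  then show ?thesis by (simp add: Lp_def)
qed

subsection \<open>Completeness of \<open>L\<^sup>1\<close>\<close>

text \<open>A subsequence converges almost everywhere, and Fatou's lemma along it turns the Cauchy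
  condition into a bound on the distance to its limit.\<close>

lemma L1_complete:
  fixes s :: "nat \<Rightarrow> 'a \<Rightarrow> real"
  assumes int: "\<And>n. integrable M (s n)"
    and Cauchy: "\<And>e. e > 0 \<Longrightarrow> \<exists>N. \<forall>i\<ge>N. \<forall>j\<ge>N. (LINT x|M. \<bar>s i x - s j x\<bar>) < e"
  shows "\<exists>t. integrable M t \<and> (\<lambda>n. LINT x|M. \<bar>s n x - t x\<bar>) \<longlonglongrightarrow> 0"
proof -
  note [measurable] = borel_measurable_integrable[OF int]
  obtain k where k: "strict_mono k" "AE x in M. Cauchy (\<lambda>i. s (k i) x)"
    using cauchy_L1_AE_cauchy_subseq[of M s] int Cauchy by auto
  define t where "t x = lim (\<lambda>i. s (k i) x)" for x
  have [measurable]: "t \<in> borel_measurable M" unfolding t_def by measurable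
  have lim: "AE x in M. (\<lambda>i. s (k i) x) \<longlonglongrightarrow> t x"
    using k(2) by eventually_elim (simp add: t_def Cauchy_convergent_iff convergent_LIMSEQ_iff)
  have bound: "(\<integral>\<^sup>+x. ennreal \<bar>s n x - t x\<bar> \<partial>M) \<le> ennreal e"
    if N: "\<And>i. i \<ge> N \<Longrightarrow> (LINT x|M. \<bar>s n x - s i x\<bar>) < e" for n N e
  proof -
    have "(\<integral>\<^sup>+x. ennreal \<bar>s n x - t x\<bar> \<partial>M) = (\<integral>\<^sup>+x. liminf (\<lambda>i. ennreal \<bar>s n x - s (k i) x\<bar>) \<partial>M)"
    proof (rule nn_integral_cong_AE)
      show "AE x in M. ennreal \<bar>s n x - t x\<bar> = liminf (\<lambda>i. ennreal \<bar>s n x - s (k i) x\<bar>)"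
        using lim
      proof eventually_elim
        case (elim x)
        then have "(\<lambda>i. ennreal \<bar>s n x - s (k i) x\<bar>) \<longlonglongrightarrow> ennreal \<bar>s n x - t x\<bar>"
          by (intro tendsto_ennrealI tendsto_intros)
        then show ?case by (rule lim_imp_Liminf[OF sequentially_bot, symmetric])
      qed
    qed
    also have "\<dots> \<le> liminf (\<lambda>i. \<integral>\<^sup>+x. ennreal \<bar>s n x - s (k i) x\<bar> \<partial>M)"
      by (rule nn_integral_liminf) measurable
    also have "\<dots> \<le> ennreal e"
    proof (rule Liminf_le)
      have "(\<integral>\<^sup>+x. ennreal \<bar>s n x - s (k i) x\<bar> \<partial>M) \<le> ennreal e" if "i \<ge> N" for i
      proof -
        have "k i \<ge> N" using that seq_suble[OF k(1), of i] by simp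
        then have "(LINT x|M. \<bar>s n x - s (k i) x\<bar>) \<le> e" using N by (simp add: less_imp_le)
        moreover have "integrable M (\<lambda>x. \<bar>s n x - s (k i) x\<bar>)" using int by simp
        ultimately show ?thesis by (simp add: nn_integral_eq_integral ennreal_leI)
      qed
      then show "\<forall>\<^sub>F i in sequentially. (\<integral>\<^sup>+x. ennreal \<bar>s n x - s (k i) x\<bar> \<partial>M) \<le> ennreal e"
        unfolding eventually_sequentially by blast
    qed simp
    finally show ?thesis .
  qed
  have intd: "integrable M (\<lambda>x. s n x - t x)"
    if N: "\<And>i. i \<ge> N \<Longrightarrow> (LINT x|M. \<bar>s n x - s i x\<bar>) < e" for n N e
  proof (rule integrableI_bounded)
    have "(\<integral>\<^sup>+x. ennreal \<bar>s n x - t x\<bar> \<partial>M) \<le> ennreal e" by (rule bound[of N]) (rule N)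
    then show "(\<integral>\<^sup>+x. ennreal (norm (s n x - t x)) \<partial>M) < \<infinity>"
      unfolding real_norm_def infinity_ennreal_def by (rule le_less_trans[OF _ ennreal_less_top])
  qed measurable
  obtain N1 where N1: "\<And>i j. i \<ge> N1 \<Longrightarrow> j \<ge> N1 \<Longrightarrow> (LINT x|M. \<bar>s i x - s j x\<bar>) < 1"
    using Cauchy[of 1] by auto
  have "integrable M (\<lambda>x. s N1 x - (s N1 x - t x))"
    by (intro Bochner_Integration.integrable_diff int intd[of N1 N1 1] N1) auto
  then have t: "integrable M t" by simp
  have "(\<lambda>n. LINT x|M. \<bar>s n x - t x\<bar>) \<longlonglongrightarrow> 0"
  proof (rule LIMSEQ_I)
    fix e :: real assume e: "e > 0"
    then obtain N where N: "\<And>i j. i \<ge> N \<Longrightarrow> j \<ge> N \<Longrightarrow> (LINT x|M. \<bar>s i x - s j x\<bar>) < e / 2"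
      using Cauchy[of "e / 2"] by auto
    have "norm ((LINT x|M. \<bar>s n x - t x\<bar>) - 0) < e" if "n \<ge> N" for n
    proof -
      have "ennreal (LINT x|M. \<bar>s n x - t x\<bar>) = (\<integral>\<^sup>+x. ennreal \<bar>s n x - t x\<bar> \<partial>M)"
        using int t by (intro nn_integral_eq_integral[symmetric]) auto
      also have "\<dots> \<le> ennreal (e / 2)" using that by (intro bound[of N] N) auto
      finally have "(LINT x|M. \<bar>s n x - t x\<bar>) \<le> e / 2" using e by (simp add: ennreal_le_iff)
      then show ?thesis using e by simp
    qed
    then show "\<exists>N. \<forall>n\<ge>N. norm ((LINT x|M. \<bar>s n x - t x\<bar>) - 0) < e" by blast
  qed
  with t show ?thesis by blast
qed

lemma Lp_tendsto_1_iff: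
  fixes f :: "'a \<Rightarrow> real"
  shows "Lp_tendsto 1 M fs f \<longleftrightarrow> (\<forall>n. integrable M (fs n)) \<and> integrable M f \<and>
     (\<lambda>n. LINT x|M. \<bar>fs n x - f x\<bar>) \<longlonglongrightarrow> 0"
proof -
  have Lp1: "h \<in> Lp 1 M \<longleftrightarrow> integrable M h" for h :: "'a \<Rightarrow> real"
  proof -
    have "integrable M (\<lambda>x. \<bar>h x\<bar>) \<longleftrightarrow> integrable M h" if "h \<in> borel_measurable M"
      by (rule integrable_abs_iff[OF that])
    then show ?thesis unfolding Lp_def using borel_measurable_integrable by auto
  qed
  show ?thesis by (simp add: Lp_tendsto_iff_integral Lp1)
qed

section \<open>Functions of class \<open>C\<^sub>b\<^sup>1\<close>\<close>

lemma grad_eq: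
  assumes "GDERIV f x :> D"
  shows "grad f x = D"
proof -
  have "D' = D" if "GDERIV f x :> D'" for D'
  proof -
    have "(\<lambda>h. h \<bullet> D') = (\<lambda>h. h \<bullet> D)"
      using that assms unfolding gderiv_def by (rule has_derivative_unique)
    then have "h \<bullet> D' = h \<bullet> D" for h by meson
    then show ?thesis using vector_eq_ldot by blast
  qed
  then show ?thesis unfolding grad_def using assms by blast
qed

lemma GDERIV_continuous_on:
  assumes "\<And>x. GDERIV f x :> D x"
  shows "continuous_on UNIV f"
  using assms has_derivative_continuous unfolding gderiv_def continuous_on_eq_continuous_within
  by blast

lemma C1bI:
  assumes "\<And>x. GDERIV f x :> D x" "continuous_on UNIV D" "\<And>x. \<bar>f x\<bar> \<le> B" "\<And>x. norm (D x) \<le> C"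
  shows "f \<in> C1b" "grad f = D"
proof -
  show eq: "grad f = D" using grad_eq[OF assms(1)] by auto
  have "bounded (range f)" "bounded (range D)"
    using assms(3,4) by (auto simp: bounded_iff)
  then show "f \<in> C1b"
    using assms GDERIV_continuous_on[OF assms(1)] by (simp add: C1b_def eq bcontfun_def)
qed

lemma
  assumes "f \<in> C1b"
  shows C1b_GDERIV: "GDERIV f x :> grad f x"
    and C1b_continuous_grad: "continuous_on UNIV (grad f)"
    and C1b_bcontfun: "f \<in> bcontfun"
  using assms by (auto simp: C1b_def)

lemma bcontfun_bounded:
  fixes f :: "'a::topological_space \<Rightarrow> real"
  assumes "f \<in> bcontfun"
  obtains B where "\<And>x. \<bar>f x\<bar> \<le> B" "B \<ge> 0"
proof -
  obtain B where B: "\<And>x. \<bar>f x\<bar> \<le> B"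
    using assms by (auto simp: bcontfun_def bounded_iff)
  moreover have "B \<ge> 0" using B abs_ge_zero order_trans by blast
  ultimately show thesis using that by blast
qed

lemma C1b_bounded_grad:
  assumes "f \<in> C1b"
  obtains B where "\<And>x. norm (grad f x) \<le> B" "B \<ge> 0"
proof -
  obtain B where B: "\<And>x. norm (grad f x) \<le> B"
    using assms by (auto simp: C1b_def bounded_iff)
  moreover have "B \<ge> 0" using B norm_ge_zero order_trans by blast
  ultimately show thesis using that by blast
qed

lemma C1b_const: "(\<lambda>_. c) \<in> C1b"
  by (rule C1bI[where D="\<lambda>_. 0" and B="\<bar>c\<bar>" and C=0]) (auto intro: GDERIV_const)

lemma
  assumes f: "f \<in> C1b" and h: "h \<in> C1b"
  shows C1b_add: "(\<lambda>x. f x + h x) \<in> C1b"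
    and C1b_diff: "(\<lambda>x. f x - h x) \<in> C1b"
    and grad_diff: "grad (\<lambda>x. f x - h x) = (\<lambda>x. grad f x - grad h x)"
    and C1b_mult: "(\<lambda>x. f x * h x) \<in> C1b"
    and grad_mult: "grad (\<lambda>x. f x * h x) = (\<lambda>x. f x *\<^sub>R grad h x + h x *\<^sub>R grad f x)"
proof -
  obtain Bf where Bf: "\<And>x. \<bar>f x\<bar> \<le> Bf" "Bf \<ge> 0" by (blast intro: bcontfun_bounded[OF C1b_bcontfun[OF f]])
  obtain Bh where Bh: "\<And>x. \<bar>h x\<bar> \<le> Bh" "Bh \<ge> 0" by (blast intro: bcontfun_bounded[OF C1b_bcontfun[OF h]])
  obtain Cf where Cf: "\<And>x. norm (grad f x) \<le> Cf" "Cf \<ge> 0" by (blast intro: C1b_bounded_grad[OF f])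
  obtain Ch where Ch: "\<And>x. norm (grad h x) \<le> Ch" "Ch \<ge> 0" by (blast intro: C1b_bounded_grad[OF h])
  have cont: "continuous_on UNIV f" "continuous_on UNIV h"
    using f h by (auto simp: C1b_def bcontfun_def)
  note cont = cont C1b_continuous_grad[OF f] C1b_continuous_grad[OF h]
  note D = C1b_GDERIV[OF f] C1b_GDERIV[OF h]
  show "(\<lambda>x. f x + h x) \<in> C1b"
  proof (rule C1bI[where D="\<lambda>x. grad f x + grad h x"])
    show "\<bar>f x + h x\<bar> \<le> Bf + Bh" for x using Bf(1)[of x] Bh(1)[of x] by linarith
    show "norm (grad f x + grad h x) \<le> Cf + Ch" for x by (rule norm_triangle_mono[OF Cf(1) Ch(1)])
  qed (intro GDERIV_add D continuous_intros cont)+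
  have 1: "norm (grad f x - grad h x) \<le> Cf + Ch" for x 
    using norm_triangle_ineq4[of "grad f x" "grad h x"] Cf(1)[of x] Ch(1)[of x] by linarith
  have 2: "\<bar>f x - h x\<bar> \<le> Bf + Bh" for x using Bf(1)[of x] Bh(1)[of x] by linarith
  show "(\<lambda>x. f x - h x) \<in> C1b" "grad (\<lambda>x. f x - h x) = (\<lambda>x. grad f x - grad h x)"
    by (rule C1bI[where D="\<lambda>x. grad f x - grad h x", OF _ _ 2 1];
        intro GDERIV_diff D continuous_intros cont)+
  have 3: "norm (f x *\<^sub>R grad h x + h x *\<^sub>R grad f x) \<le> Bf * Ch + Bh * Cf" for x
    by (rule norm_triangle_mono) (auto intro!: mult_mono Bf Bh Cf Ch)
  have 4: "\<bar>f x * h x\<bar> \<le> Bf * Bh" for x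
    unfolding abs_mult by (intro mult_mono) (use Bf Bh in auto)
  show "(\<lambda>x. f x * h x) \<in> C1b" "grad (\<lambda>x. f x * h x) = (\<lambda>x. f x *\<^sub>R grad h x + h x *\<^sub>R grad f x)"
    by (rule C1bI[where D="\<lambda>x. f x *\<^sub>R grad h x + h x *\<^sub>R grad f x", OF _ _ 4 3];
        intro GDERIV_mult D continuous_intros cont)+
qed

text \<open>The values of \<open>f\<close> lie in a compact interval, on which \<open>\<theta>\<close> and \<open>\<theta>'\<close> are bounded.\<close>

lemma
  assumes f: "f \<in> C1b" and \<theta>: "\<And>t. (\<theta> has_real_derivative \<theta>' t) (at t)" "continuous_on UNIV \<theta>'"
  shows C1b_compose: "(\<lambda>x. \<theta> (f x)) \<in> C1b"
    and grad_compose: "grad (\<lambda>x. \<theta> (f x)) = (\<lambda>x. \<theta>' (f x) *\<^sub>R grad f x)"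
proof -
  obtain B where B: "\<And>x. \<bar>f x\<bar> \<le> B" "B \<ge> 0" by (blast intro: bcontfun_bounded[OF C1b_bcontfun[OF f]])
  obtain C where C: "\<And>x. norm (grad f x) \<le> C" "C \<ge> 0" by (blast intro: C1b_bounded_grad[OF f])
  have cont: "continuous_on UNIV f" using f by (auto simp: C1b_def bcontfun_def)
  have "continuous_on {-B..B} \<theta>" 
    using \<theta>(1) by (meson DERIV_isCont continuous_at_imp_continuous_on)
  then have "bounded (\<theta> ` {-B..B})" by (intro compact_imp_bounded compact_continuous_image) auto
  then obtain C1 where C1: "\<And>t. t \<in> {-B..B} \<Longrightarrow> \<bar>\<theta> t\<bar> \<le> C1"
    by (fastforce simp: bounded_iff)
  have "bounded (\<theta>' ` {-B..B})" 
    by (intro compact_imp_bounded compact_continuous_image continuous_on_subset[OF \<theta>(2)]) auto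
  then obtain C2 where C2: "\<And>t. t \<in> {-B..B} \<Longrightarrow> \<bar>\<theta>' t\<bar> \<le> C2"
    by (fastforce simp: bounded_iff)
  have in_B: "f x \<in> {-B..B}" for x using B(1)[of x] by (auto simp: abs_le_iff)
  have bound: "norm (\<theta>' (f x) *\<^sub>R grad f x) \<le> C2 * C" for x
    unfolding norm_scaleR using C2[OF in_B, of x] C by (intro mult_mono) (auto intro: order_trans[OF abs_ge_zero])
  have "continuous_on UNIV (\<lambda>x. \<theta>' (f x))"
    by (rule continuous_on_compose2[OF \<theta>(2) cont]) auto
  note cont' = this C1b_continuous_grad[OF f]
  show "(\<lambda>x. \<theta> (f x)) \<in> C1b" "grad (\<lambda>x. \<theta> (f x)) = (\<lambda>x. \<theta>' (f x) *\<^sub>R grad f x)"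
    by (rule C1bI[where D="\<lambda>x. \<theta>' (f x) *\<^sub>R grad f x", OF _ _ C1[OF in_B] bound];
        intro GDERIV_DERIV_compose C1b_GDERIV[OF f] \<theta>(1) continuous_intros cont')+
qed

section \<open>The closure of \<open>R\<nabla>\<close>\<close>

locale sobolev = prob_space \<nu> for \<nu> :: "'a::{real_inner,polish_space} measure" +
  fixes R :: "'a \<Rightarrow> 'a"
  assumes sets_nu [measurable_cong]: "sets \<nu> = sets borel"
    and R: "bounded_linear R"
    and closable: "\<And>s. s > 1 \<Longrightarrow> Rgrad_closable \<nu> R s"
begin

lemma space_nu [simp]: "space \<nu> = UNIV"
  using sets_eq_imp_space_eq[OF sets_nu] by simp

lemma continuous_measurable: "continuous_on UNIV f \<Longrightarrow> f \<in> borel_measurable \<nu>"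
  using borel_measurable_continuous_onI measurable_cong_sets[OF sets_nu refl] by blast

lemma bcontfun_measurable: "f \<in> bcontfun \<Longrightarrow> f \<in> borel_measurable \<nu>"
  by (simp add: bcontfun_def continuous_measurable)

lemma C1b_measurable: "f \<in> C1b \<Longrightarrow> f \<in> borel_measurable \<nu>"
  by (simp add: C1b_bcontfun bcontfun_measurable)

lemma bcontfun_integrable: 
  fixes f :: "'a \<Rightarrow> real"
  assumes "f \<in> bcontfun"
  shows "integrable \<nu> f"
  using bcontfun_bounded[OF assms] bcontfun_measurable[OF assms]
  by (metis AE_I2 integrable_const_bound real_norm_def)

lemma C1b_Lp:
  assumes "f \<in> C1b" "q > 0"
  shows "f \<in> Lp q \<nu>" "(\<lambda>x. R (grad f x)) \<in> Lp q \<nu>"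
proof -
  obtain B where B: "\<And>x. \<bar>f x\<bar> \<le> B" by (blast intro: bcontfun_bounded[OF C1b_bcontfun[OF assms(1)]])
  show "f \<in> Lp q \<nu>"
    by (rule bounded_in_Lp[OF finite_measure]) (use assms B in \<open>auto intro: C1b_measurable\<close>)
  obtain C where C: "\<And>x. norm (grad f x) \<le> C" by (blast intro: C1b_bounded_grad[OF assms(1)])
  obtain K where K: "\<And>x. norm (R x) \<le> norm x * K" "K \<ge> 0"
    using bounded_linear.nonneg_bounded[OF R] by blast
  have "norm (R (grad f x)) \<le> C * K" for x
    using K(1)[of "grad f x"] mult_right_mono[OF C[of x] K(2)] by linarith
  moreover have "continuous_on UNIV (\<lambda>x. R (grad f x))"
    using C1b_continuous_grad[OF assms(1)] by (rule bounded_linear.continuous_on[OF R])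
  ultimately show "(\<lambda>x. R (grad f x)) \<in> Lp q \<nu>"
    using assms(2) by (intro bounded_in_Lp[OF finite_measure] continuous_measurable)
qed

lemma closure_graph_Lp:
  assumes "closure_graph \<nu> R q f G"
  shows "f \<in> Lp q \<nu>" "G \<in> Lp q \<nu>"
  using assms by (auto simp: closure_graph_def Lp_tendsto_def)

lemma closure_graph_C1b:
  assumes "f \<in> C1b" "q > 0"
  shows "closure_graph \<nu> R q f (\<lambda>x. R (grad f x))"
  unfolding closure_graph_def
  using Lp_tendsto_const[OF C1b_Lp(1)[OF assms]] Lp_tendsto_const[OF C1b_Lp(2)[OF assms]] assms(1)
  by (intro exI[of _ "\<lambda>_. f"]) auto

lemma R_grad_diff:
  assumes "f \<in> C1b" "h \<in> C1b"
  shows "R (grad (\<lambda>x. f x - h x) x) = R (grad f x) - R (grad h x)"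
  using R by (simp add: grad_diff[OF assms] linear_diff bounded_linear.linear)

text \<open>This is what closability is for: the difference of two approximating sequences of the same
  function converges to zero.\<close>

lemma closure_graph_unique:
  assumes "closure_graph \<nu> R q f G" "closure_graph \<nu> R q f G'" "q > 1"
  shows "AE x in \<nu>. G x = G' x"
proof -
  obtain a where a: "\<And>n. a n \<in> C1b" "Lp_tendsto q \<nu> a f" "Lp_tendsto q \<nu> (\<lambda>n x. R (grad (a n) x)) G"
    using assms(1) by (auto simp: closure_graph_def)
  obtain b where b: "\<And>n. b n \<in> C1b" "Lp_tendsto q \<nu> b f" "Lp_tendsto q \<nu> (\<lambda>n x. R (grad (b n) x)) G'"
    using assms(2) by (auto simp: closure_graph_def)
  have "Lp_tendsto q \<nu> (\<lambda>n x. a n x - b n x) (\<lambda>x. f x - f x)"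
    "Lp_tendsto q \<nu> (\<lambda>n x. R (grad (a n) x) - R (grad (b n) x)) (\<lambda>x. G x - G' x)"
    using a b assms(3) by (intro Lp_tendsto_diff; simp)+
  then have "AE x in \<nu>. G x - G' x = 0"
    using closable[OF assms(3), unfolded Rgrad_closable_def, rule_format,
        of "\<lambda>n x. a n x - b n x" "\<lambda>x. G x - G' x"] C1b_diff[OF a(1) b(1)]
    by (simp add: R_grad_diff[OF a(1) b(1)])
  then show ?thesis by simp
qed

lemma closure_graph_Mp: "f \<in> W1 \<nu> R q \<Longrightarrow> closure_graph \<nu> R q f (Mp \<nu> R q f)"
  by (simp add: W1_def Mp_def some_eq_ex)

lemma closure_graph_W1: "closure_graph \<nu> R q f G \<Longrightarrow> f \<in> W1 \<nu> R q"
  by (auto simp: W1_def)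

lemma closure_graph_AE_Mp:
  assumes "closure_graph \<nu> R q f G" "q > 1"
  shows "AE x in \<nu>. Mp \<nu> R q f x = G x"
  using closure_graph_unique[OF closure_graph_Mp[OF closure_graph_W1] assms(1)] assms by blast

text \<open>\<open>W1_norm\<close> refers to the chosen representative \<open>Mp \<nu> R q f\<close>; any other one has the same norm.\<close>

lemma W1_norm_eq:
  assumes "closure_graph \<nu> R q f G" "q > 1"
  shows "W1_norm \<nu> R q f = Lp_norm q \<nu> f + Lp_norm q \<nu> G"
proof -
  have "Lp_norm q \<nu> (Mp \<nu> R q f) = Lp_norm q \<nu> G"
    using closure_graph_AE_Mp[OF assms] closure_graph_Lp(2)[OF assms(1)]
      closure_graph_Lp(2)[OF closure_graph_Mp[OF closure_graph_W1[OF assms(1)]]]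
    by (intro Lp_norm_cong_AE) (auto intro: Lp_measurable)
  then show ?thesis by (simp add: W1_norm_def)
qed

text \<open>The special case of linearity by which the convergence in \<open>W\<^sup>1\<^sup>,\<^sup>q\<close> of a sequence in \<open>C\<^sub>b\<^sup>1\<close> is
  split into the convergence of the functions and of their gradients.\<close>

lemma closure_graph_C1b_diff:
  assumes "closure_graph \<nu> R q f G" "q \<ge> 1" "h \<in> C1b"
  shows "closure_graph \<nu> R q (\<lambda>x. h x - f x) (\<lambda>x. R (grad h x) - G x)"
proof -
  obtain a where a: "\<And>n. a n \<in> C1b" "Lp_tendsto q \<nu> a f" "Lp_tendsto q \<nu> (\<lambda>n x. R (grad (a n) x)) G"
    using assms(1) by (auto simp: closure_graph_def)
  have "Lp_tendsto q \<nu> (\<lambda>n x. h x - a n x) (\<lambda>x. h x - f x)"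
    "Lp_tendsto q \<nu> (\<lambda>n x. R (grad h x) - R (grad (a n) x)) (\<lambda>x. R (grad h x) - G x)"
    using a assms C1b_Lp[OF assms(3)] by (auto intro!: Lp_tendsto_diff Lp_tendsto_const)
  then show ?thesis unfolding closure_graph_def
    using C1b_diff[OF assms(3) a(1)]
    by (intro exI[of _ "\<lambda>n x. h x - a n x"]) (simp add: R_grad_diff[OF assms(3) a(1)])
qed

lemma closure_graph_mono_exponent:
  assumes "closure_graph \<nu> R q f G" "0 < s" "s \<le> q"
  shows "closure_graph \<nu> R s f G"
proof -
  obtain a where a: "\<And>n. a n \<in> C1b" "Lp_tendsto q \<nu> a f" "Lp_tendsto q \<nu> (\<lambda>n x. R (grad (a n) x)) G"
    using assms(1) by (auto simp: closure_graph_def)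
  note mono = Lp_tendsto_mono_exponent[OF prob_space_axioms _ assms(2,3)]
  show ?thesis unfolding closure_graph_def
    using a(1) mono[OF a(2)] mono[OF a(3)] by blast
qed

lemma closure_graph_cong_AE:
  assumes "closure_graph \<nu> R q f G" "G' \<in> borel_measurable \<nu>" "AE x in \<nu>. G x = G' x"
  shows "closure_graph \<nu> R q f G'"
proof -
  obtain a where a: "\<And>n. a n \<in> C1b" "Lp_tendsto q \<nu> a f" "Lp_tendsto q \<nu> (\<lambda>n x. R (grad (a n) x)) G"
    using assms(1) by (auto simp: closure_graph_def)
  have G: "G \<in> Lp q \<nu>" "G' \<in> Lp q \<nu>"
    using closure_graph_Lp(2)[OF assms(1)] Lp_cong_AE[OF closure_graph_Lp(2)[OF assms(1)] assms(2,3)] by blast+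
  have m: "(\<lambda>x. R (grad (a n) x)) \<in> borel_measurable \<nu>" for n
    by (rule Lp_measurable[OF C1b_Lp(2)[OF a(1) zero_less_one]])
  note Gm = G[THEN Lp_measurable]
  have eq: "Lp_norm q \<nu> (\<lambda>x. R (grad (a n) x) - G x) = Lp_norm q \<nu> (\<lambda>x. R (grad (a n) x) - G' x)" for n
  proof (rule Lp_norm_cong_AE)
    show "AE x in \<nu>. R (grad (a n) x) - G x = R (grad (a n) x) - G' x"
      using assms(3) by (rule eventually_mono) simp
  qed (intro borel_measurable_diff m Gm)+
  have "Lp_tendsto q \<nu> (\<lambda>n x. R (grad (a n) x)) G'"
    using a(3) G(2) unfolding Lp_tendsto_def eq by blast
  with a(1,2) show ?thesis unfolding closure_graph_def by blast
qed

text \<open>By closability and the monotonicity in the exponent, any two of the closures agree where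
  both are defined, hence a common representative exists.\<close>

lemma closure_graph_M_op:
  assumes "\<And>s. s > 1 \<Longrightarrow> f \<in> W1 \<nu> R s" and "s > 1"
  shows "closure_graph \<nu> R s f (M_op \<nu> R f)"
proof -
  have gr: "closure_graph \<nu> R s f (Mp \<nu> R s f)" if "s > 1" for s
    using assms(1)[OF that] by (rule closure_graph_Mp)
  have "closure_graph \<nu> R s f (Mp \<nu> R 2 f)" if s: "s > 1" for s
  proof -
    let ?m = "min s 2"
    have "closure_graph \<nu> R ?m f (Mp \<nu> R s f)" "closure_graph \<nu> R ?m f (Mp \<nu> R 2 f)"
      using s closure_graph_mono_exponent[OF gr[OF s], of ?m] closure_graph_mono_exponent[OF gr[of 2], of ?m]
      by simp_all
    then have "AE x in \<nu>. Mp \<nu> R s f x = Mp \<nu> R 2 f x"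
      by (rule closure_graph_unique) (use s in simp)
    moreover have "Mp \<nu> R 2 f \<in> borel_measurable \<nu>"
      by (rule Lp_measurable[OF closure_graph_Lp(2)[OF gr[of 2]]]) simp
    ultimately show ?thesis
      using closure_graph_cong_AE[OF gr[OF s], of "Mp \<nu> R 2 f"] by simp
  qed
  then have "\<exists>G. \<forall>s>1. closure_graph \<nu> R s f G" by blast
  then have "\<forall>s>1. closure_graph \<nu> R s f (M_op \<nu> R f)"
    unfolding M_op_def by (rule someI_ex)
  then show ?thesis using assms(2) by blast
qed

lemma adjoint_pair_Lp:
  assumes "adjoint_pair \<nu> R p F v"
  shows "F \<in> Lp (p / (p - 1)) \<nu>" "v \<in> Lp (p / (p - 1)) \<nu>"
  using assms unfolding adjoint_pair_def by blast+

lemma adjoint_C1b: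
  assumes "adjoint_pair \<nu> R p F v" "p > 1" "u \<in> C1b"
  shows "(LINT x|\<nu>. R (grad u x) \<bullet> F x) = (LINT x|\<nu>. u x * v x)"
proof -
  have gr: "closure_graph \<nu> R p u (\<lambda>x. R (grad u x))"
    using assms by (auto intro: closure_graph_C1b)
  have u: "u \<in> W1 \<nu> R p" using gr by (rule closure_graph_W1)
  have [measurable]: "Mp \<nu> R p u \<in> borel_measurable \<nu>" "(\<lambda>x. R (grad u x)) \<in> borel_measurable \<nu>"
    "F \<in> borel_measurable \<nu>"
    using closure_graph_Lp(2)[OF closure_graph_Mp[OF u]] closure_graph_Lp(2)[OF gr]
      adjoint_pair_Lp(1)[OF assms(1)]
    by (auto intro: Lp_measurable)
  have "(LINT x|\<nu>. R (grad u x) \<bullet> F x) = (LINT x|\<nu>. Mp \<nu> R p u x \<bullet> F x)"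
    by (rule integral_cong_AE) (use closure_graph_AE_Mp[OF gr assms(2)] in \<open>auto elim: eventually_mono\<close>)
  also have "\<dots> = (LINT x|\<nu>. u x * v x)"
    using assms(1) u by (simp add: adjoint_pair_def)
  finally show ?thesis .
qed

section \<open>Integration by parts against functions of \<open>g\<close>\<close>

text \<open>The strict inequality \<open>p < p\<^sub>1\<close> leaves room for the factor \<open>Dg\<close>, which is only known to
  belong to \<open>L\<^sup>s\<close> for finite \<open>s\<close>.\<close>

lemma by_parts_Lp:
  assumes p: "p > 1" "p < p1" and F: "adjoint_pair \<nu> R p F v"
    and g: "\<And>s. s > 1 \<Longrightarrow> closure_graph \<nu> R s g Dg"
  shows "F \<in> Lp (p1 / (p1 - 1)) \<nu>" "v \<in> Lp (p1 / (p1 - 1)) \<nu>"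
    "(\<lambda>x. Dg x \<bullet> F x) \<in> Lp (p1 / (p1 - 1)) \<nu>"
proof -
  note FL = adjoint_pair_Lp[OF F] and conj = conjugate_less[OF p]
  show "F \<in> Lp (p1 / (p1 - 1)) \<nu>" "v \<in> Lp (p1 / (p1 - 1)) \<nu>"
    using conj by (intro Lp_mono_exponent[OF finite_measure FL(1)] Lp_mono_exponent[OF finite_measure FL(2)]; simp)+
  show "(\<lambda>x. Dg x \<bullet> F x) \<in> Lp (p1 / (p1 - 1)) \<nu>"
    by (rule Lp_inner[OF _ FL(1)]) (use conj closure_graph_Lp(2)[OF g] in auto)
qed

text \<open>The formula \<open>\<integral> \<langle>M(\<theta>(g) \<phi>), F\<rangle> d\<nu> = \<integral> \<theta>(g) \<phi> M\<^sup>*F d\<nu>\<close>, expanded by the product and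
  chain rules. These rules are only applied to functions of class \<open>C\<^sub>b\<^sup>1\<close>: the integrals are
  continuous in \<open>g\<close> when \<open>\<phi>\<close> is a fixed function of that class, and then in \<open>\<phi>\<close>. Thus there is no
  need for a product rule in \<open>W\<^sup>1\<^sup>,\<^sup>p\<close>.\<close>

lemma integral_by_parts:
  assumes p: "p > 1" "p < p1" and F: "adjoint_pair \<nu> R p F v"
    and \<phi>: "closure_graph \<nu> R p1 \<phi> G"
    and g: "\<And>s. s > 1 \<Longrightarrow> closure_graph \<nu> R s g Dg"
    and \<theta>: "\<And>t. (\<theta> has_real_derivative \<theta>' t) (at t)" "continuous_on UNIV \<theta>'"
      "\<And>t. \<bar>\<theta> t\<bar> \<le> C" "\<And>t. \<bar>\<theta>' t\<bar> \<le> C"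
  shows "(LINT x|\<nu>. \<theta>' (g x) * ((Dg x \<bullet> F x) * \<phi> x)) = (LINT x|\<nu>. \<theta> (g x) * (\<phi> x * v x - G x \<bullet> F x))"
proof -
  have FL: "F \<in> Lp (p / (p - 1)) \<nu>" "v \<in> Lp (p / (p - 1)) \<nu>"
    using adjoint_pair_Lp[OF F] .
  have cont: "continuous_on UNIV \<theta>"
    using \<theta>(1) by (meson DERIV_isCont continuous_at_imp_continuous_on)
  have [measurable]: "\<theta> \<in> borel_measurable borel" "\<theta>' \<in> borel_measurable borel"
    using cont \<theta>(2) by (auto intro: borel_measurable_continuous_onI)
  have [measurable]: "g \<in> borel_measurable \<nu>" "Dg \<in> borel_measurable \<nu>"
    using closure_graph_Lp[OF g[of 2]] by (auto intro: Lp_measurable)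
  note [measurable] = FL[THEN Lp_measurable]
  obtain b0 where b0: "\<And>n. b0 n \<in> C1b" "Lp_tendsto p \<nu> b0 g" "Lp_tendsto p \<nu> (\<lambda>n x. R (grad (b0 n) x)) Dg"
    using g[OF p(1)] by (auto simp: closure_graph_def)
  obtain k where k: "strict_mono k" "AE x in \<nu>. (\<lambda>n. b0 (k n) x) \<longlonglongrightarrow> g x"
    using Lp_tendsto_AE_subseq[OF b0(2)] p by auto
  define b where "b n = b0 (k n)" for n
  have b: "\<And>n. b n \<in> C1b" "Lp_tendsto p \<nu> (\<lambda>n x. R (grad (b n) x)) Dg" 
    "AE x in \<nu>. (\<lambda>n. b n x) \<longlonglongrightarrow> g x"
    using b0(1) Lp_tendsto_subseq[OF b0(3) k(1)] k(2) by (auto simp: b_def)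
  note [measurable] = C1b_measurable[OF b(1)]
  have conv\<theta>: "AE x in \<nu>. (\<lambda>n. \<theta> (b n x)) \<longlonglongrightarrow> \<theta> (g x)" "AE x in \<nu>. (\<lambda>n. \<theta>' (b n x)) \<longlonglongrightarrow> \<theta>' (g x)"
    using b(3) continuous_on_tendsto_compose[OF cont] continuous_on_tendsto_compose[OF \<theta>(2)]
    by (auto elim!: eventually_mono)
  have smooth: "(LINT x|\<nu>. \<theta> (g x) * (R (grad u x) \<bullet> F x)) + (LINT x|\<nu>. (u x * \<theta>' (g x)) * (Dg x \<bullet> F x))
       = (LINT x|\<nu>. \<theta> (g x) * (u x \<bullet> v x))" if u: "u \<in> C1b" for u
  proof -
    obtain B where B: "\<And>x. \<bar>u x\<bar> \<le> B" "B \<ge> 0" by (blast intro: bcontfun_bounded[OF C1b_bcontfun[OF u]])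
    have C: "C \<ge> 0" using \<theta>(3) abs_ge_zero order_trans by blast
    have uC: "\<bar>u x * \<theta>' t\<bar> \<le> B * C" for x t
      unfolding abs_mult by (intro mult_mono) (use B C \<theta> in auto)
    note [measurable] = C1b_measurable[OF u]
    have uL: "u \<in> Lp p \<nu>" "(\<lambda>x. R (grad u x)) \<in> Lp p \<nu>" using C1b_Lp[OF u] p by auto
    have bL: "(\<lambda>x. R (grad (b n) x)) \<in> Lp p \<nu>" for n using C1b_Lp[OF b(1)] p by auto
    have eq: "(LINT x|\<nu>. \<theta> (b n x) * (R (grad u x) \<bullet> F x))
        + (LINT x|\<nu>. (u x * \<theta>' (b n x)) * (R (grad (b n) x) \<bullet> F x))
        = (LINT x|\<nu>. \<theta> (b n x) * (u x \<bullet> v x))" for n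
    proof -
      have un: "(\<lambda>x. u x * \<theta> (b n x)) \<in> C1b"
        by (intro C1b_mult u C1b_compose[OF b(1) \<theta>(1,2)])
      have gr: "R (grad (\<lambda>x. u x * \<theta> (b n x)) x)
          = (u x * \<theta>' (b n x)) *\<^sub>R R (grad (b n) x) + \<theta> (b n x) *\<^sub>R R (grad u x)" for x
        using R by (simp add: grad_mult[OF u C1b_compose[OF b(1) \<theta>(1,2)]] grad_compose[OF b(1) \<theta>(1,2)]
            linear_add linear_scale bounded_linear.linear)
      have "(LINT x|\<nu>. \<theta> (b n x) * (R (grad u x) \<bullet> F x))
        + (LINT x|\<nu>. (u x * \<theta>' (b n x)) * (R (grad (b n) x) \<bullet> F x))
        = (LINT x|\<nu>. \<theta> (b n x) * (R (grad u x) \<bullet> F x) + (u x * \<theta>' (b n x)) * (R (grad (b n) x) \<bullet> F x))"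
        by (intro Bochner_Integration.integral_add[symmetric]
            abs_integral_inner_le(1)[OF uL(2) FL(1) p(1), where C=C]
            abs_integral_inner_le(1)[OF bL FL(1) p(1), where C="B*C"]) (use \<theta> uC in auto)
      also have "\<dots> = (LINT x|\<nu>. R (grad (\<lambda>x. u x * \<theta> (b n x)) x) \<bullet> F x)"
        by (simp add: gr inner_add_left add.commute)
      also have "\<dots> = (LINT x|\<nu>. \<theta> (b n x) * (u x \<bullet> v x))"
        by (subst adjoint_C1b[OF F p(1) un]) (simp add: mult_ac)
      finally show ?thesis .
    qed
    have 1: "(\<lambda>n. LINT x|\<nu>. \<theta> (b n x) * (R (grad u x) \<bullet> F x))
       \<longlonglongrightarrow> (LINT x|\<nu>. \<theta> (g x) * (R (grad u x) \<bullet> F x))"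
      by (rule tendsto_integral_inner[OF Lp_tendsto_const[OF uL(2)] FL(1) p(1), where C=C])
         (use \<theta> conv\<theta> in auto)
    have 2: "(\<lambda>n. LINT x|\<nu>. (u x * \<theta>' (b n x)) * (R (grad (b n) x) \<bullet> F x))
       \<longlonglongrightarrow> (LINT x|\<nu>. (u x * \<theta>' (g x)) * (Dg x \<bullet> F x))"
      by (rule tendsto_integral_inner[OF b(2) FL(1) p(1), where C="B*C"])
         (use uC conv\<theta>(2) in \<open>auto elim!: eventually_mono intro!: tendsto_intros\<close>)
    have 3: "(\<lambda>n. LINT x|\<nu>. \<theta> (b n x) * (u x \<bullet> v x)) \<longlonglongrightarrow> (LINT x|\<nu>. \<theta> (g x) * (u x \<bullet> v x))"
      by (rule tendsto_integral_inner[OF Lp_tendsto_const[OF uL(1)] FL(2) p(1), where C=C])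
         (use \<theta> conv\<theta> in auto)
    show ?thesis using tendsto_add[OF 1 2] 3 unfolding eq by (rule LIMSEQ_unique)
  qed
  have p1: "p1 > 1" using p by simp
  note FL1 = by_parts_Lp[OF p F g]
  obtain a where a: "\<And>n. a n \<in> C1b" "Lp_tendsto p1 \<nu> a \<phi>" "Lp_tendsto p1 \<nu> (\<lambda>n x. R (grad (a n) x)) G"
    using \<phi> by (auto simp: closure_graph_def)
  have 1: "(\<lambda>n. LINT x|\<nu>. \<theta> (g x) * (R (grad (a n) x) \<bullet> F x)) \<longlonglongrightarrow> (LINT x|\<nu>. \<theta> (g x) * (G x \<bullet> F x))"
    by (rule tendsto_integral_inner[OF a(3) FL1(1) p1, where C=C]) (use \<theta> in auto)
  have 2: "(\<lambda>n. LINT x|\<nu>. \<theta>' (g x) * (a n x \<bullet> (Dg x \<bullet> F x)))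
     \<longlonglongrightarrow> (LINT x|\<nu>. \<theta>' (g x) * (\<phi> x \<bullet> (Dg x \<bullet> F x)))"
    by (rule tendsto_integral_inner[OF a(2) FL1(3) p1, where C=C]) (use \<theta> in auto)
  have 3: "(\<lambda>n. LINT x|\<nu>. \<theta> (g x) * (a n x \<bullet> v x)) \<longlonglongrightarrow> (LINT x|\<nu>. \<theta> (g x) * (\<phi> x \<bullet> v x))"
    by (rule tendsto_integral_inner[OF a(2) FL1(2) p1, where C=C]) (use \<theta> in auto)
  have swap: "\<theta>' (g x) * (u x \<bullet> (Dg x \<bullet> F x)) = (u x * \<theta>' (g x)) * (Dg x \<bullet> F x)"
    for u :: "'a \<Rightarrow> real" and x
    by simp
  have eq: "(LINT x|\<nu>. \<theta> (g x) * (R (grad (a n) x) \<bullet> F x)) + (LINT x|\<nu>. \<theta>' (g x) * (a n x \<bullet> (Dg x \<bullet> F x)))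
     = (LINT x|\<nu>. \<theta> (g x) * (a n x \<bullet> v x))" for n
    unfolding swap by (rule smooth[OF a(1)])
  have "(LINT x|\<nu>. \<theta> (g x) * (G x \<bullet> F x)) + (LINT x|\<nu>. \<theta>' (g x) * (\<phi> x \<bullet> (Dg x \<bullet> F x)))
     = (LINT x|\<nu>. \<theta> (g x) * (\<phi> x \<bullet> v x))"
    using tendsto_add[OF 1 2] 3 unfolding eq by (rule LIMSEQ_unique)
  moreover have "(LINT x|\<nu>. \<theta> (g x) * (\<phi> x * v x - G x \<bullet> F x))
     = (LINT x|\<nu>. \<theta> (g x) * (\<phi> x * v x)) - (LINT x|\<nu>. \<theta> (g x) * (G x \<bullet> F x))"
    unfolding right_diff_distrib
    by (intro Bochner_Integration.integral_diff
        abs_integral_inner_le(1)[OF closure_graph_Lp(1)[OF \<phi>] FL1(2) p1, where C=C, unfolded inner_real_def]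
        abs_integral_inner_le(1)[OF closure_graph_Lp(2)[OF \<phi>] FL1(1) p1, where C=C]) (use \<theta>(3) in auto)
  ultimately show ?thesis unfolding inner_real_def by (simp add: mult.commute)
qed

end

section \<open>Differentiating integrals over sublevel sets\<close>

subsection \<open>A smooth approximation of the absolute value\<close>

text \<open>The function \<open>sqrt (t\<^sup>2 + e\<^sup>2)\<close> replaces the absolute value where a \<open>C\<^sup>1\<close> function with derivative
  in \<open>[-1, 1]\<close> is required: for ramps, for minima of functions, and for \<open>\<bar>u\<bar>\<close> with \<open>u\<close> in
  \<open>C\<^sub>b\<^sup>1\<close>.\<close>

lemma DERIV_sqrt_regularised:
  assumes "e > (0::real)"
  shows "((\<lambda>t. sqrt (t\<^sup>2 + e\<^sup>2)) has_real_derivative t / sqrt (t\<^sup>2 + e\<^sup>2)) (at t)"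
proof -
  have pos: "t\<^sup>2 + e\<^sup>2 > 0" using assms by (simp add: add_nonneg_pos)
  have "((\<lambda>t. t\<^sup>2 + e\<^sup>2) has_real_derivative 2 * t) (at t)"
    by (auto intro!: derivative_eq_intros)
  then have "((\<lambda>t. sqrt (t\<^sup>2 + e\<^sup>2)) has_real_derivative inverse (sqrt (t\<^sup>2 + e\<^sup>2)) / 2 * (2 * t)) (at t)"
    by (rule DERIV_chain2[where f=sqrt and g="\<lambda>t. t\<^sup>2 + e\<^sup>2", OF DERIV_real_sqrt[OF pos]])
  moreover have "inverse z / 2 * (2 * u) = u / z" for z u :: real
    by (simp add: inverse_eq_divide)
  ultimately show ?thesis by simp
qed

lemma abs_div_sqrt_regularised_le: "\<bar>t / sqrt (t\<^sup>2 + e\<^sup>2)\<bar> \<le> 1" if "e > (0::real)" for t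
proof -
  have "\<bar>t\<bar> \<le> sqrt (t\<^sup>2 + e\<^sup>2)" by (rule real_le_rsqrt) simp
  moreover have "sqrt (t\<^sup>2 + e\<^sup>2) > 0" using that by (simp add: add_nonneg_pos)
  ultimately show ?thesis by (simp add: divide_le_eq)
qed

lemma continuous_div_sqrt_regularised:
  assumes "e > (0::real)"
  shows "continuous_on UNIV (\<lambda>t. t / sqrt (t\<^sup>2 + e\<^sup>2))"
proof -
  have "t\<^sup>2 + e\<^sup>2 \<noteq> 0" for t using assms by (simp add: sum_power2_eq_zero_iff)
  then show ?thesis by (intro continuous_intros) auto
qed

subsection \<open>Ramps and windows\<close>

text \<open>The primitive of the indicator function of \<open>{a..b}\<close> that vanishes on the left of \<open>a\<close>.\<close>

definition ramp :: "real \<Rightarrow> real \<Rightarrow> real \<Rightarrow> real" where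
  "ramp a b t = ((b - a) + \<bar>t - a\<bar> - \<bar>t - b\<bar>) / 2"

text \<open>The derivative of \<open>ramp a b\<close>, with the mean value of both sides at the two corners.\<close>

definition window :: "real \<Rightarrow> real \<Rightarrow> real \<Rightarrow> real" where
  "window a b t = (sgn (t - a) - sgn (t - b)) / 2"

lemma ramp_measurable [measurable]: "ramp a b \<in> borel_measurable borel"
  unfolding ramp_def by measurable

lemma window_measurable [measurable]: "window a b \<in> borel_measurable borel"
  unfolding window_def by measurable

lemma abs_ramp_le: "a \<le> b \<Longrightarrow> \<bar>ramp a b t\<bar> \<le> b - a"
  unfolding ramp_def by (auto simp: abs_if)

lemma sqrt_regularised_diff_le: "\<bar>sqrt (x\<^sup>2 + e\<^sup>2) - sqrt (y\<^sup>2 + e\<^sup>2)\<bar> \<le> \<bar>x - y\<bar>"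
  using norm_triangle_ineq3[of "Complex x e" "Complex y e"] by (simp add: cmod_def)

text \<open>The identity for smooth \<open>\<theta>\<close> extends to the ramp, which is the limit of
  \<open>((t - a) + sqrt ((t - a)\<^sup>2 + \<epsilon>\<^sup>2) - (t - b) - sqrt ((t - b)\<^sup>2 + \<epsilon>\<^sup>2)) / 2\<close>.\<close>

lemma ramp_identity:
  fixes A B g :: "'a \<Rightarrow> real"
  assumes AB: "integrable M A" "integrable M B" and g [measurable]: "g \<in> borel_measurable M"
    and smooth: "\<And>\<theta> \<theta>' C. (\<And>t. (\<theta> has_real_derivative \<theta>' t) (at t)) \<Longrightarrow> continuous_on UNIV \<theta>' \<Longrightarrow>
        (\<And>t. \<bar>\<theta> t\<bar> \<le> C) \<Longrightarrow> (\<And>t. \<bar>\<theta>' t\<bar> \<le> C) \<Longrightarrow>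
        (LINT x|M. \<theta>' (g x) * B x) = (LINT x|M. \<theta> (g x) * A x)"
    and "a \<le> b"
  shows "(LINT x|M. window a b (g x) * B x) = (LINT x|M. ramp a b (g x) * A x)"
proof -
  note [measurable] = borel_measurable_integrable[OF AB(1)] borel_measurable_integrable[OF AB(2)]
  define e :: "nat \<Rightarrow> real" where "e n = 1 / (real n + 1)" for n
  have e: "e n > 0" "e \<longlonglongrightarrow> 0" for n
    using LIMSEQ_inverse_real_of_nat by (auto simp: e_def[abs_def] inverse_eq_divide add.commute)
  define \<theta> where "\<theta> n t = ((b - a) + sqrt ((t - a)\<^sup>2 + (e n)\<^sup>2) - sqrt ((t - b)\<^sup>2 + (e n)\<^sup>2)) / 2" for n t
  define d where "d n s = s / sqrt (s\<^sup>2 + (e n)\<^sup>2)" for n s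
  define \<theta>' where "\<theta>' n t = (d n (t - a) - d n (t - b)) / 2" for n t
  define C where "C = (b - a) + 1"
  have deriv_sqrt: "((\<lambda>t. sqrt ((t - c)\<^sup>2 + (e n)\<^sup>2)) has_real_derivative d n (t - c)) (at t)" for n c t
    using DERIV_chain2[where f="\<lambda>t. sqrt (t\<^sup>2 + (e n)\<^sup>2)" and g="\<lambda>t. t - c",
        OF DERIV_sqrt_regularised[OF e(1)] DERIV_diff[OF DERIV_ident DERIV_const]]
    by (simp add: d_def)
  have deriv: "(\<theta> n has_real_derivative \<theta>' n t) (at t)" for n t
    unfolding \<theta>_def[abs_def] \<theta>'_def
    by (rule DERIV_cong[OF DERIV_cdivide[OF DERIV_diff[OF DERIV_add[OF DERIV_const deriv_sqrt] deriv_sqrt]]])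
       simp
  have cont_d: "continuous_on UNIV (d n)" for n
    unfolding d_def[abs_def] by (rule continuous_div_sqrt_regularised[OF e(1)])
  have cont: "continuous_on UNIV (\<theta>' n)" for n
    unfolding \<theta>'_def
    by (intro continuous_intros continuous_on_compose2[OF cont_d[of n]]) auto
  have d1: "\<bar>d n s\<bar> \<le> 1" for n s
    unfolding d_def by (rule abs_div_sqrt_regularised_le[OF e(1)])
  have \<theta>C: "\<bar>\<theta> n t\<bar> \<le> C" for n t
    using sqrt_regularised_diff_le[of "t - a" "e n" "t - b"] \<open>a \<le> b\<close>
    unfolding \<theta>_def C_def by (simp add: abs_le_iff field_simps)
  have \<theta>'C: "\<bar>\<theta>' n t\<bar> \<le> C" for n t
    using d1[of n "t - a"] d1[of n "t - b"] \<open>a \<le> b\<close> unfolding \<theta>'_def C_def by (simp add: abs_le_iff)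
  have lim_sqrt: "(\<lambda>n. sqrt (s\<^sup>2 + (e n)\<^sup>2)) \<longlonglongrightarrow> \<bar>s\<bar>" for s
  proof -
    have "(\<lambda>n. sqrt (s\<^sup>2 + (e n)\<^sup>2)) \<longlonglongrightarrow> sqrt (s\<^sup>2 + 0\<^sup>2)" by (intro tendsto_intros e(2))
    then show ?thesis by simp
  qed
  have lim_d: "(\<lambda>n. d n s) \<longlonglongrightarrow> sgn s" for s
  proof (cases "s = 0")
    case False
    then have "(\<lambda>n. d n s) \<longlonglongrightarrow> s / \<bar>s\<bar>"
      unfolding d_def by (intro tendsto_intros lim_sqrt) auto
    then show ?thesis by (simp add: sgn_div_norm divide_inverse_commute)
  qed (simp add: d_def)
  have lim_\<theta>: "(\<lambda>n. \<theta> n t) \<longlonglongrightarrow> ramp a b t" for t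
    unfolding \<theta>_def ramp_def by (intro tendsto_intros lim_sqrt) auto
  have lim_\<theta>': "(\<lambda>n. \<theta>' n t) \<longlonglongrightarrow> window a b t" for t
    unfolding \<theta>'_def window_def by (intro tendsto_intros lim_d) auto
  have [measurable]: "\<theta> n \<in> borel_measurable borel" "\<theta>' n \<in> borel_measurable borel" for n
    unfolding \<theta>_def \<theta>'_def d_def by measurable
  have 1: "(\<lambda>n. LINT x|M. \<theta>' n (g x) * B x) \<longlonglongrightarrow> (LINT x|M. window a b (g x) * B x)"
  proof (rule integral_dominated_convergence[where w="\<lambda>x. C * \<bar>B x\<bar>"])
    show "AE x in M. (\<lambda>n. \<theta>' n (g x) * B x) \<longlonglongrightarrow> window a b (g x) * B x"
      by (intro AE_I2 tendsto_intros lim_\<theta>')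
    show "AE x in M. norm (\<theta>' n (g x) * B x) \<le> C * \<bar>B x\<bar>" for n
      by (intro AE_I2) (auto simp: abs_mult intro!: mult_right_mono \<theta>'C)
  qed (use AB(2) in auto)
  have 2: "(\<lambda>n. LINT x|M. \<theta> n (g x) * A x) \<longlonglongrightarrow> (LINT x|M. ramp a b (g x) * A x)"
  proof (rule integral_dominated_convergence[where w="\<lambda>x. C * \<bar>A x\<bar>"])
    show "AE x in M. (\<lambda>n. \<theta> n (g x) * A x) \<longlonglongrightarrow> ramp a b (g x) * A x"
      by (intro AE_I2 tendsto_intros lim_\<theta>)
    show "AE x in M. norm (\<theta> n (g x) * A x) \<le> C * \<bar>A x\<bar>" for n
      by (intro AE_I2) (auto simp: abs_mult intro!: mult_right_mono \<theta>C)
  qed (use AB(1) in auto)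
  have "(LINT x|M. \<theta>' n (g x) * B x) = (LINT x|M. \<theta> n (g x) * A x)" for n
    by (rule smooth[OF deriv cont \<theta>C \<theta>'C])
  then show ?thesis using 1 2 LIMSEQ_unique by auto
qed

text \<open>With \<open>B = 1\<close> the two sides are at least \<open>\<nu>(g = t) / 2\<close> and at most a constant times the
  length of the ramp, which is arbitrary.\<close>

lemma ramp_identity_no_atoms:
  fixes A g :: "'a \<Rightarrow> real"
  assumes "prob_space M" and A: "integrable M A" and g [measurable]: "g \<in> borel_measurable M"
    and ramp: "\<And>a b. a \<le> b \<Longrightarrow> (LINT x|M. window a b (g x)) = (LINT x|M. ramp a b (g x) * A x)"
  shows "AE x in M. g x \<noteq> t"
proof -
  interpret prob_space M by fact
  note [measurable] = borel_measurable_integrable[OF A]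
  let ?S = "{x \<in> space M. g x = t}"
  define K where "K = (LINT x|M. \<bar>A x\<bar>)"
  have K: "K \<ge> 0" by (simp add: K_def)
  have le: "prob ?S / 2 \<le> h * K" if h: "h > 0" for h
  proof -
    have "prob ?S / 2 = (LINT x|M. indicator ?S x / 2)" by simp
    also have "\<dots> \<le> (LINT x|M. window t (t + h) (g x))"
    proof (rule integral_mono)
      show "integrable M (\<lambda>x. window t (t + h) (g x))"
        by (rule integrable_const_bound[where B=1]) (auto simp: window_def sgn_if)
      show "indicator ?S x / 2 \<le> window t (t + h) (g x)" if "x \<in> space M" for x
        using h by (auto simp: window_def sgn_if indicator_def)
    qed (rule integrable_const_bound[where B=1], auto simp: indicator_def)
    also have "\<dots> = (LINT x|M. ramp t (t + h) (g x) * A x)"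
      using ramp h by simp
    also have "\<dots> \<le> (LINT x|M. h * \<bar>A x\<bar>)"
    proof (rule integral_mono_AE)
      have le: "\<bar>ramp t (t + h) s * y\<bar> \<le> h * \<bar>y\<bar>" for s y
        unfolding abs_mult using abs_ramp_le[of t "t + h" s] h by (intro mult_right_mono) auto
      show "integrable M (\<lambda>x. ramp t (t + h) (g x) * A x)"
      proof (rule Bochner_Integration.integrable_bound)
        show "integrable M (\<lambda>x. h * \<bar>A x\<bar>)" using A by simp
        show "AE x in M. norm (ramp t (t + h) (g x) * A x) \<le> norm (h * \<bar>A x\<bar>)"
          using le h by (simp add: abs_mult)
      qed simp
      show "AE x in M. ramp t (t + h) (g x) * A x \<le> h * \<bar>A x\<bar>"
        using abs_le_D1[OF le] by (intro AE_I2)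
    qed (use A in simp)
    also have "\<dots> = h * K" by (simp add: K_def)
    finally show ?thesis .
  qed
  have "prob ?S / 2 \<le> 0"
  proof (rule field_le_epsilon)
    fix e :: real assume e: "e > 0"
    have "prob ?S / 2 \<le> e / (K + 1) * K" by (rule le) (use e K in auto)
    also have "\<dots> \<le> e" using e K by (simp add: field_simps)
    finally show "prob ?S / 2 \<le> 0 + e" by simp
  qed
  then have "prob ?S = 0" using measure_nonneg[of M ?S] by linarith
  then show ?thesis
    by (intro AE_I[where N="?S"]) (auto simp: emeasure_eq_measure)
qed

text \<open>The difference quotient over \<open>{r..y}\<close> or \<open>{y..r}\<close> is the integral of \<open>A\<close> against
  \<open>ramp r y / (y - r)\<close>, a bounded function that converges to the indicator function of
  \<open>{r<..}\<close> except at \<open>r\<close>.\<close>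

lemma sublevel_integral_has_derivative:
  fixes A B g :: "'a \<Rightarrow> real"
  assumes AB: "integrable M A" "integrable M B" and g [measurable]: "g \<in> borel_measurable M"
    and noatoms: "\<And>t. AE x in M. g x \<noteq> t"
    and ramp: "\<And>a b. a \<le> b \<Longrightarrow> (LINT x|M. window a b (g x) * B x) = (LINT x|M. ramp a b (g x) * A x)"
    and space: "space M = UNIV"
  shows "((\<lambda>s. LINT x:{x. g x \<le> s}|M. B x) has_real_derivative (LINT x:{x. g x > r}|M. A x)) (at r)"
proof -
  note [measurable] = borel_measurable_integrable[OF AB(1)] borel_measurable_integrable[OF AB(2)]
  let ?f = "\<lambda>s. LINT x:{x. g x \<le> s}|M. B x"
  have sets: "{x. g x \<le> s} \<in> sets M" "{x. g x > s} \<in> sets M" for s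
    using measurable_sets[OF g, of "{..s}"] measurable_sets[OF g, of "{s<..}"] 
    by (simp_all add: space vimage_def)
  note [measurable] = sets
  have int: "set_integrable M {x. g x \<le> s} B" for s
    unfolding set_integrable_def by (rule integrable_mult_indicator[OF sets(1) AB(2)])
  have diff: "?f b - ?f a = (LINT x|M. ramp a b (g x) * A x)" if "a \<le> b" for a b
  proof -
    have "?f b - ?f a = (LINT x|M. indicator {x. g x \<le> b} x * B x - indicator {x. g x \<le> a} x * B x)"
      using int[of a] int[of b] unfolding set_lebesgue_integral_def set_integrable_def
      by simp
    also have "\<dots> = (LINT x|M. window a b (g x) * B x)"
    proof (rule integral_cong_AE)
      show "AE x in M. indicator {x. g x \<le> b} x * B x - indicator {x. g x \<le> a} x * B x = window a b (g x) * B x"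
        using noatoms[of a] noatoms[of b]
        by eventually_elim (use that in \<open>auto simp: window_def sgn_if indicator_def\<close>)
    qed measurable
    also have "\<dots> = (LINT x|M. ramp a b (g x) * A x)" using that by (rule ramp)
    finally show ?thesis .
  qed
  define c where "c y t = ((\<bar>t - r\<bar> - \<bar>t - y\<bar>) / (y - r) + 1) / 2" for y t
  have quot: "(?f y - ?f r) / (y - r) = (LINT x|M. c y (g x) * A x)" if "y \<noteq> r" for y
  proof -
    have "(?f y - ?f r) / (y - r) = (?f (max y r) - ?f (min y r)) / (max y r - min y r)"
      using minus_divide_divide[of "?f y - ?f r" "y - r"] by (auto simp: max_def min_def)
    also have "\<dots> = (LINT x|M. ramp (min y r) (max y r) (g x) * A x / (max y r - min y r))"
      by (subst diff) auto
    also have "\<dots> = (LINT x|M. c y (g x) * A x)"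
    proof (rule arg_cong[where f="integral\<^sup>L M"], rule ext)
      fix x
      have "ramp (min y r) (max y r) t / (max y r - min y r) = c y t" for t
        using that by (cases "y < r") (simp_all add: ramp_def c_def max_def min_def field_simps)
      then show "ramp (min y r) (max y r) (g x) * A x / (max y r - min y r) = c y (g x) * A x"
        by (metis times_divide_eq_left)
    qed
    finally show ?thesis .
  qed
  have c1: "\<bar>c y t\<bar> \<le> 1" if "y \<noteq> r" for y t
  proof -
    have "\<bar>(\<bar>t - r\<bar> - \<bar>t - y\<bar>) / (y - r)\<bar> \<le> 1"
      using that by (simp add: abs_divide divide_le_eq)
    moreover have "\<bar>(z + 1) / 2\<bar> \<le> 1" if "\<bar>z\<bar> \<le> 1" for z :: real
      using that by (simp add: abs_le_iff)
    ultimately show ?thesis unfolding c_def by blast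
  qed
  have [measurable]: "c y \<in> borel_measurable borel" for y
    unfolding c_def by measurable
  have "((\<lambda>y. (?f y - ?f r) / (y - r)) \<longlongrightarrow> (LINT x:{x. g x > r}|M. A x)) (at r)"
    unfolding tendsto_at_iff_sequentially
  proof (intro allI impI)
    fix y :: "nat \<Rightarrow> real" assume y: "\<forall>i. y i \<in> UNIV - {r}" "y \<longlonglongrightarrow> r"
    have lim: "(\<lambda>n. c (y n) t) \<longlonglongrightarrow> indicator {r<..} t" if "t \<noteq> r" for t
    proof (cases "t > r")
      case True
      then have "\<forall>\<^sub>F n in sequentially. y n < t" using order_tendstoD(2)[OF y(2)] by blast
      then have "\<forall>\<^sub>F n in sequentially. c (y n) t = indicator {r<..} t"
        by eventually_elim (use y(1) True in \<open>auto simp: c_def\<close>)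
      then show ?thesis by (rule tendsto_eventually)
    next
      case False
      then have "\<forall>\<^sub>F n in sequentially. y n > t" using order_tendstoD(1)[OF y(2)] that by auto
      then have "\<forall>\<^sub>F n in sequentially. c (y n) t = indicator {r<..} t"
      proof eventually_elim
        case (elim n)
        have "\<bar>t - r\<bar> - \<bar>t - y n\<bar> = - (y n - r)" using elim False by linarith
        moreover have "y n \<noteq> r" using y(1) by auto
        ultimately have "(\<bar>t - r\<bar> - \<bar>t - y n\<bar>) / (y n - r) = -1"
          by (simp add: divide_eq_eq)
        then show ?case using False by (simp add: c_def)
      qed
      then show ?thesis by (rule tendsto_eventually)
    qed
    have "(\<lambda>n. LINT x|M. c (y n) (g x) * A x) \<longlonglongrightarrow> (LINT x:{x. g x > r}|M. A x)"
      unfolding set_lebesgue_integral_def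
    proof (rule integral_dominated_convergence[where w="\<lambda>x. \<bar>A x\<bar>"])
      show "AE x in M. (\<lambda>n. c (y n) (g x) * A x) \<longlonglongrightarrow> indicator {x. g x > r} x *\<^sub>R A x"
        using noatoms[of r]
      proof eventually_elim
        case (elim x)
        then have "(\<lambda>n. c (y n) (g x) * A x) \<longlonglongrightarrow> indicator {r<..} (g x) * A x"
          by (intro tendsto_intros lim)
        then show ?case by (simp add: indicator_def)
      qed
      show "AE x in M. norm (c (y n) (g x) * A x) \<le> \<bar>A x\<bar>" for n
        using c1[of "y n"] y(1) by (intro AE_I2) (simp add: abs_mult mult_left_le_one_le)
    qed (use AB in auto)
    moreover have "(\<lambda>y. (?f y - ?f r) / (y - r)) \<circ> y = (\<lambda>n. LINT x|M. c (y n) (g x) * A x)"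
      using quot y(1) by (auto simp: fun_eq_iff)
    ultimately show "((\<lambda>y. (?f y - ?f r) / (y - r)) \<circ> y) \<longlonglongrightarrow> (LINT x:{x. g x > r}|M. A x)"
      by simp
  qed
  then show ?thesis by (simp add: has_field_derivative_iff)
qed

section \<open>The functional of a level set\<close>

text \<open>The function \<open>Dg\<close> represents \<open>M\<^sub>s g\<close> for all \<open>s > 1\<close> simultaneously.\<close>

locale level_set = sobolev \<nu> R for \<nu> :: "'a::{real_inner,polish_space} measure" and R +
  fixes g :: "'a \<Rightarrow> real" and Dg :: "'a \<Rightarrow> 'a"
  assumes g_borel: "g \<in> borel_measurable borel"
    and graph_g: "\<And>s. s > 1 \<Longrightarrow> closure_graph \<nu> R s g Dg"
    and Dg_nonzero: "AE x in \<nu>. Dg x \<noteq> 0"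
    and normal_dom: "\<And>s. s > 1 \<Longrightarrow> (\<lambda>x. (1 / (norm (Dg x))\<^sup>2) *\<^sub>R Dg x) \<in> dom_Mp_adj \<nu> R s"
begin

text \<open>The vector field along which \<open>g\<close> grows at unit speed, in the sense of \<open>Dg_Psi\<close>.\<close>

definition Psi :: "'a \<Rightarrow> 'a" where
  "Psi x = (1 / (norm (Dg x))\<^sup>2) *\<^sub>R Dg x"

lemma g_measurable [measurable]: "g \<in> borel_measurable \<nu>"
  using g_borel by (simp cong: measurable_cong_sets add: measurable_cong_sets[OF sets_nu refl])

lemma sublevel_sets [measurable]: "{x. g x \<le> s} \<in> sets \<nu>" "{x. g x > s} \<in> sets \<nu>" "{x. g x < s} \<in> sets \<nu>"
  using measurable_sets[OF g_measurable, of "{..s}"] measurable_sets[OF g_measurable, of "{s<..}"]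
    measurable_sets[OF g_measurable, of "{..<s}"] by (simp_all add: vimage_def)

text \<open>The derivative of the integral over \<open>{g \<le> s}\<close> as a relation between \<open>B\<close> and \<open>D\<close>: the same
  notion is needed for functions in \<open>C\<^sub>b\<close>, for which the derivative defines the surface measure, and
  for functions in \<open>W\<^sup>1\<^sup>,\<^sup>q\<close>, for which \<open>sobolev_derivative\<close> computes it.\<close>

definition dlevel :: "real \<Rightarrow> ('a \<Rightarrow> real) \<Rightarrow> real \<Rightarrow> bool" where
  "dlevel r B D \<longleftrightarrow> ((\<lambda>s. LINT x:{x. g x \<le> s}|\<nu>. B x) has_real_derivative D) (at r)"

lemma dlevel_unique: "dlevel r B D \<Longrightarrow> dlevel r B D' \<Longrightarrow> D = D'"
  unfolding dlevel_def by (rule DERIV_unique)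

lemma Dg_Psi: "AE x in \<nu>. Dg x \<bullet> Psi x = 1"
  using Dg_nonzero by (rule eventually_mono) (simp add: Psi_def flip: power2_norm_eq_inner)

lemma Psi_adjoint:
  assumes "s > 1"
  obtains v where "adjoint_pair \<nu> R s Psi v"
  using normal_dom[OF assms] unfolding dom_Mp_adj_def Psi_def[abs_def] by blast

lemma by_parts_integrable:
  assumes p: "p > 1" "p < p1" and F: "adjoint_pair \<nu> R p F v" and \<phi>: "closure_graph \<nu> R p1 \<phi> G"
  shows "integrable \<nu> (\<lambda>x. \<phi> x * v x)" "integrable \<nu> (\<lambda>x. G x \<bullet> F x)"
    "integrable \<nu> (\<lambda>x. (Dg x \<bullet> F x) * \<phi> x)"
proof -
  note GL = closure_graph_Lp[OF \<phi>] and FL1 = by_parts_Lp[OF p F graph_g]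
  have p1: "p1 > 1" using p by simp
  show "integrable \<nu> (\<lambda>x. \<phi> x * v x)"
    using integrable_inner_Lp[OF GL(1) FL1(2) p1] by simp
  show "integrable \<nu> (\<lambda>x. G x \<bullet> F x)"
    by (rule integrable_inner_Lp[OF GL(2) FL1(1) p1])
  show "integrable \<nu> (\<lambda>x. (Dg x \<bullet> F x) * \<phi> x)"
    using integrable_inner_Lp[OF GL(1) FL1(3) p1] by (simp add: mult.commute)
qed

lemmas by_parts = integral_by_parts[OF _ _ _ _ graph_g]

text \<open>The case \<open>\<theta> = 1\<close>.\<close>

lemma by_parts_total:
  assumes p: "p > 1" "p < p1" and F: "adjoint_pair \<nu> R p F v" and \<phi>: "closure_graph \<nu> R p1 \<phi> G"
  shows "(LINT x|\<nu>. \<phi> x * v x - G x \<bullet> F x) = 0"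
  using by_parts[OF p F \<phi>, of "\<lambda>_. 1" "\<lambda>_. 0" 1] by simp

lemma no_atoms: "AE x in \<nu>. g x \<noteq> t"
proof -
  obtain v where v: "adjoint_pair \<nu> R 2 Psi v" using Psi_adjoint[of 2] by auto
  have one: "closure_graph \<nu> R 3 (\<lambda>_. 1) (\<lambda>x. R (grad (\<lambda>_. 1) x))"
    by (rule closure_graph_C1b[OF C1b_const]) simp
  note int = by_parts_integrable[OF _ _ v one, simplified]
  let ?A = "\<lambda>x. 1 * v x - R (grad (\<lambda>_. 1) x) \<bullet> Psi x"
  have A: "integrable \<nu> ?A" using int by simp
  have [measurable]: "Psi \<in> borel_measurable \<nu>" "Dg \<in> borel_measurable \<nu>"
    using adjoint_pair_Lp(1)[OF v] closure_graph_Lp(2)[OF graph_g[of 2]] by (auto intro: Lp_measurable)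
  have drop: "(LINT x|\<nu>. k (g x) * ((Dg x \<bullet> Psi x) * 1)) = (LINT x|\<nu>. k (g x))"
    if [measurable]: "k \<in> borel_measurable borel" for k :: "real \<Rightarrow> real"
    by (rule integral_cong_AE) (use Dg_Psi in \<open>auto elim: eventually_mono\<close>)
  show ?thesis
  proof (rule ramp_identity_no_atoms[OF prob_space_axioms A g_measurable])
    fix a b :: real assume "a \<le> b"
    have "(LINT x|\<nu>. window a b (g x) * ((Dg x \<bullet> Psi x) * 1)) = (LINT x|\<nu>. ramp a b (g x) * ?A x)"
      by (rule ramp_identity[OF A _ g_measurable by_parts[OF _ _ v one] \<open>a \<le> b\<close>])
         (use by_parts_integrable(3)[OF _ _ v one] in simp_all)
    then show "(LINT x|\<nu>. window a b (g x)) = (LINT x|\<nu>. ramp a b (g x) * ?A x)"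
      by (simp only: drop window_measurable)
  qed
qed

lemma by_parts_derivative:
  assumes p: "p > 1" "p < p1" and F: "adjoint_pair \<nu> R p F v" and \<phi>: "closure_graph \<nu> R p1 \<phi> G"
  shows "dlevel r (\<lambda>x. (Dg x \<bullet> F x) * \<phi> x) (LINT x:{x. g x > r}|\<nu>. \<phi> x * v x - G x \<bullet> F x)"
  unfolding dlevel_def
proof -
  note int = by_parts_integrable[OF p F \<phi>]
  have A: "integrable \<nu> (\<lambda>x. \<phi> x * v x - G x \<bullet> F x)"
    using int by simp
  show "((\<lambda>s. LINT x:{x. g x \<le> s}|\<nu>. (Dg x \<bullet> F x) * \<phi> x) has_real_derivative
      (LINT x:{x. g x > r}|\<nu>. \<phi> x * v x - G x \<bullet> F x)) (at r)"
    by (rule sublevel_integral_has_derivative[OF A int(3) g_measurable no_atoms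
          ramp_identity[OF A int(3) g_measurable by_parts[OF p F \<phi>]]]) simp_all
qed

text \<open>For \<open>F = \<Psi>\<close> the factor \<open>\<langle>Dg, F\<rangle>\<close> is \<open>1\<close>, so the formula differentiates the integral of an
  arbitrary element of \<open>W\<^sup>1\<^sup>,\<^sup>q\<close> over the sublevel sets.\<close>

lemma sobolev_derivative:
  assumes q: "q > 1"
  obtains v where "v \<in> Lp (q / (q - 1)) \<nu>" "Psi \<in> Lp (q / (q - 1)) \<nu>"
    "\<And>f G r. closure_graph \<nu> R q f G \<Longrightarrow> dlevel r f (LINT x:{x. g x > r}|\<nu>. f x * v x - G x \<bullet> Psi x)"
proof -
  \<comment> \<open>Any exponent strictly between \<open>1\<close> and \<open>q\<close> would do.\<close>
  define p where "p = (1 + q) / 2"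
  have p: "p > 1" "p < q" using q by (auto simp: p_def)
  obtain v where v: "adjoint_pair \<nu> R p Psi v" using Psi_adjoint[OF p(1)] .
  note L = adjoint_pair_Lp[OF v] and L' = by_parts_Lp(1,2)[OF p v graph_g]
  have [measurable]: "Psi \<in> borel_measurable \<nu>" "Dg \<in> borel_measurable \<nu>"
    using L(1) closure_graph_Lp(2)[OF graph_g[of 2]] by (auto intro: Lp_measurable)
  have "dlevel r f (LINT x:{x. g x > r}|\<nu>. f x * v x - G x \<bullet> Psi x)" if f: "closure_graph \<nu> R q f G" for f G r
  proof -
    have [measurable]: "f \<in> borel_measurable \<nu>" using closure_graph_Lp(1)[OF f] by (rule Lp_measurable)
    have "(LINT x:{x. g x \<le> s}|\<nu>. (Dg x \<bullet> Psi x) * f x) = (LINT x:{x. g x \<le> s}|\<nu>. f x)" for s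
      unfolding set_lebesgue_integral_def
      by (rule integral_cong_AE) (use Dg_Psi in \<open>auto elim: eventually_mono\<close>)
    then show ?thesis using by_parts_derivative[OF p v f, of r] by (simp add: dlevel_def)
  qed
  then show thesis using that L' by blast
qed

text \<open>Hoelder's inequality. This bound is the continuity of the surface integral with respect to the
  norm of \<open>W\<^sup>1\<^sup>,\<^sup>q\<close>; both the trace and the comparison with the capacity rest on it.\<close>

lemma sobolev_derivative_bound:
  assumes q: "q > 1"
  shows "\<exists>K\<ge>0. \<forall>f G r D. closure_graph \<nu> R q f G \<longrightarrow> dlevel r f D \<longrightarrow>
      \<bar>D\<bar> \<le> K * (Lp_norm q \<nu> f + Lp_norm q \<nu> G)"
proof -
  obtain v where v: "v \<in> Lp (q / (q - 1)) \<nu>" "Psi \<in> Lp (q / (q - 1)) \<nu>"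
    "\<And>f G r. closure_graph \<nu> R q f G \<Longrightarrow> dlevel r f (LINT x:{x. g x > r}|\<nu>. f x * v x - G x \<bullet> Psi x)"
    by (blast intro: sobolev_derivative[OF q])
  define K where "K = Lp_norm (q / (q - 1)) \<nu> v + Lp_norm (q / (q - 1)) \<nu> Psi"
  show ?thesis
  proof (intro exI[of _ K] conjI allI impI)
    show "K \<ge> 0" by (simp add: K_def Lp_norm_nonneg)
    fix f G r D
    assume f: "closure_graph \<nu> R q f G" and D: "dlevel r f D"
    note L = closure_graph_Lp[OF f]
    let ?k = "indicat_real {x. g x > r}"
    have k: "?k \<in> borel_measurable \<nu>" "\<bar>?k x\<bar> \<le> 1" for x by (auto simp: indicator_def)
    note 1 = abs_integral_inner_le[OF L(1) v(1) q k] and 2 = abs_integral_inner_le[OF L(2) v(2) q k]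
    have "D = (LINT x:{x. g x > r}|\<nu>. f x * v x - G x \<bullet> Psi x)"
      by (rule dlevel_unique[OF D v(3)[OF f]])
    also have "\<dots> = (LINT x|\<nu>. ?k x * (f x \<bullet> v x)) - (LINT x|\<nu>. ?k x * (G x \<bullet> Psi x))"
      unfolding set_lebesgue_integral_def
      by (subst Bochner_Integration.integral_diff[symmetric, OF 1(1) 2(1)]) (simp add: right_diff_distrib)
    finally have "\<bar>D\<bar> \<le> \<bar>LINT x|\<nu>. ?k x * (f x \<bullet> v x)\<bar> + \<bar>LINT x|\<nu>. ?k x * (G x \<bullet> Psi x)\<bar>"
      by simp
    also have "\<dots> \<le> Lp_norm q \<nu> f * Lp_norm (q / (q - 1)) \<nu> v + Lp_norm q \<nu> G * Lp_norm (q / (q - 1)) \<nu> Psi"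
      using 1(2) 2(2) by simp
    also have "\<dots> \<le> K * (Lp_norm q \<nu> f + Lp_norm q \<nu> G)"
      by (simp add: K_def algebra_simps add_increasing2 Lp_norm_nonneg)
    finally show "\<bar>D\<bar> \<le> K * (Lp_norm q \<nu> f + Lp_norm q \<nu> G)" .
  qed
qed

end

section \<open>Representing positive functionals on \<open>C\<^sub>b\<close> by measures\<close>

lemma bcontfunI_real:
  fixes f :: "'a::topological_space \<Rightarrow> real"
  assumes "continuous_on UNIV f" "\<And>x. \<bar>f x\<bar> \<le> B"
  shows "f \<in> bcontfun"
  using assms by (auto simp: bcontfun_def bounded_iff)

lemma bcontfun_continuous: "f \<in> bcontfun \<Longrightarrow> continuous_on UNIV f"
  by (simp add: bcontfun_def)

lemma
  fixes f h :: "'a::topological_space \<Rightarrow> real"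
  assumes f: "f \<in> bcontfun" and h: "h \<in> bcontfun"
  shows bcontfun_add: "(\<lambda>x. f x + h x) \<in> bcontfun"
    and bcontfun_diff: "(\<lambda>x. f x - h x) \<in> bcontfun"
    and bcontfun_mult: "(\<lambda>x. f x * h x) \<in> bcontfun"
    and bcontfun_max: "(\<lambda>x. max (f x) (h x)) \<in> bcontfun"
    and bcontfun_min: "(\<lambda>x. min (f x) (h x)) \<in> bcontfun"
proof -
  obtain B where B: "\<And>x. \<bar>f x\<bar> \<le> B" "B \<ge> 0" using f by (blast intro: bcontfun_bounded)
  obtain C where C: "\<And>x. \<bar>h x\<bar> \<le> C" "C \<ge> 0" using h by (blast intro: bcontfun_bounded)
  note c = bcontfun_continuous[OF f] bcontfun_continuous[OF h]
  have b: "\<bar>f x + h x\<bar> \<le> B + C" "\<bar>f x - h x\<bar> \<le> B + C" "\<bar>max (f x) (h x)\<bar> \<le> B + C"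
    "\<bar>min (f x) (h x)\<bar> \<le> B + C" for x
    using B(1)[of x] C(1)[of x] B(2) C(2) by linarith+
  have m: "\<bar>f x * h x\<bar> \<le> B * C" for x
    unfolding abs_mult by (intro mult_mono B C) auto
  show "(\<lambda>x. f x + h x) \<in> bcontfun" "(\<lambda>x. f x - h x) \<in> bcontfun" "(\<lambda>x. f x * h x) \<in> bcontfun"
    "(\<lambda>x. max (f x) (h x)) \<in> bcontfun" "(\<lambda>x. min (f x) (h x)) \<in> bcontfun"
    by (rule bcontfunI_real[OF _ b(1)] bcontfunI_real[OF _ b(2)] bcontfunI_real[OF _ b(3)]
        bcontfunI_real[OF _ b(4)] bcontfunI_real[OF _ m]; intro continuous_intros c)+
qed

lemma bcontfun_cmult:
  fixes f :: "'a::topological_space \<Rightarrow> real"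
  shows "f \<in> bcontfun \<Longrightarrow> (\<lambda>x. c * f x) \<in> bcontfun"
  by (rule bcontfun_mult[OF const_bcontfun])

lemma bcontfun_sum:
  fixes f :: "'i \<Rightarrow> 'a::topological_space \<Rightarrow> real"
  shows "(\<And>i. i \<in> I \<Longrightarrow> f i \<in> bcontfun) \<Longrightarrow> (\<lambda>x. \<Sum>i\<in>I. f i x) \<in> bcontfun"
  by (induction I rule: infinite_finite_induct) (auto intro: bcontfun_add const_bcontfun)

text \<open>The functions \<open>min 1 (k * infdist x (- U))\<close>, except for \<open>U = UNIV\<close>, where \<open>infdist\<close> to the
  empty set is \<open>0\<close>. The condition \<open>u 0 x = 0\<close> makes the increments \<open>u (Suc k) - u k\<close> sum up to the
  indicator function.\<close>

lemma open_bcontfun_approximation: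
  fixes U :: "'a::metric_space set"
  assumes "open U"
  obtains u :: "nat \<Rightarrow> 'a \<Rightarrow> real" where "\<And>k. u k \<in> bcontfun" "\<And>k x. 0 \<le> u k x" "\<And>k x. u k x \<le> indicator U x"
    "\<And>k x. u k x \<le> u (Suc k) x" "\<And>x. (\<lambda>k. u k x) \<longlonglongrightarrow> indicator U x" "\<And>x. u 0 x = 0"
proof (cases "U = UNIV")
  case True
  show thesis
  proof
    fix k :: nat and x :: 'a
    show "(\<lambda>_. if k = 0 then 0 else 1 :: real) \<in> bcontfun" by (rule const_bcontfun)
    have "\<forall>\<^sub>F k in sequentially. (if k = 0 then 0 else 1 :: real) = indicator U x"
      using eventually_gt_at_top[of 0] by eventually_elim (simp add: True)
    then show "(\<lambda>k. if k = 0 then 0 else 1 :: real) \<longlonglongrightarrow> indicator U x" by (rule tendsto_eventually)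
  qed (auto simp: True)
next
  case False
  define u where "u k x = min 1 (real k * infdist x (- U))" for k x
  have U: "infdist x (- U) > 0" if "x \<in> U" for x
    using in_closed_iff_infdist_zero[of "- U" x] False assms that infdist_nonneg[of x "- U"]
    by (auto simp: less_le)
  show thesis
  proof
    fix k x
    show "u k \<in> bcontfun"
    proof (rule bcontfunI_real)
      show "continuous_on UNIV (u k)" unfolding u_def by (intro continuous_intros)
      show "\<bar>u k x\<bar> \<le> 1" for x by (simp add: u_def abs_le_iff infdist_nonneg add_increasing)
    qed
    show "0 \<le> u k x" by (simp add: u_def infdist_nonneg)
    show "u k x \<le> indicator U x"
      by (cases "x \<in> U") (auto simp: u_def infdist_zero)
    show "u k x \<le> u (Suc k) x"
      unfolding u_def by (intro min.mono mult_right_mono) (auto simp: infdist_nonneg)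
    show "(\<lambda>k. u k x) \<longlonglongrightarrow> indicator U x"
    proof (cases "x \<in> U")
      case True
      obtain N where N: "1 < real N * infdist x (- U)" 
        using reals_Archimedean3[OF U[OF True]] by blast
      have "\<forall>\<^sub>F k in sequentially. u k x = indicator U x"
        using eventually_ge_at_top[of N]
      proof eventually_elim
        case (elim k)
        have "real N * infdist x (- U) \<le> real k * infdist x (- U)"
          using elim by (intro mult_right_mono) (auto simp: infdist_nonneg)
        then show ?case using N True by (simp add: u_def)
      qed
      then show ?thesis by (rule tendsto_eventually)
    qed (simp add: u_def infdist_zero)
    show "u 0 x = 0" by (simp add: u_def)
  qed
qed

lemma sum_clamp: "y \<ge> 0 \<Longrightarrow> (\<Sum>j<n. min 1 (max 0 (y - real j))) = min y (real n)"
  by (induction n) auto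

lemma sum_count_le: "y \<ge> 0 \<Longrightarrow> (\<Sum>j<n. of_bool (real j < y)) \<le> min (real n) (y + 1)"
  by (induction n) (auto simp: min_def split: if_splits)

text \<open>A positive linear functional on \<open>C\<^sub>b\<close> that is continuous along sequences decreasing to zero is
  the integral with respect to a finite Borel measure. The measure of a set \<open>A\<close> is the infimum of
  \<open>\<Sum>n. L f\<^sub>n\<close> over the sequences of nonnegative functions in \<open>C\<^sub>b\<close> with \<open>\<Sum>n. f\<^sub>n \<ge> 1\<close> on \<open>A\<close>. This
  is an outer measure for which open sets satisfy the condition of Caratheodory.\<close>

locale Daniell_functional =
  fixes L :: "('a::metric_space \<Rightarrow> real) \<Rightarrow> real"
  assumes add: "\<And>f h. f \<in> bcontfun \<Longrightarrow> h \<in> bcontfun \<Longrightarrow> L (\<lambda>x. f x + h x) = L f + L h"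
    and cmult: "\<And>f c. f \<in> bcontfun \<Longrightarrow> L (\<lambda>x. c * f x) = c * L f"
    and nonneg: "\<And>f. f \<in> bcontfun \<Longrightarrow> (\<And>x. f x \<ge> 0) \<Longrightarrow> L f \<ge> 0"
    and decreasing: "\<And>fs. (\<And>n. fs n \<in> bcontfun) \<Longrightarrow> (\<And>n x. fs (Suc n) x \<le> fs n x) \<Longrightarrow>
        (\<And>x. (\<lambda>n. fs n x) \<longlonglongrightarrow> 0) \<Longrightarrow> (\<lambda>n. L (fs n)) \<longlonglongrightarrow> 0"
begin

lemma diff: "f \<in> bcontfun \<Longrightarrow> h \<in> bcontfun \<Longrightarrow> L (\<lambda>x. f x - h x) = L f - L h"
  using add[of "\<lambda>x. f x - h x" h] by (simp add: bcontfun_diff)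

lemma mono: "f \<in> bcontfun \<Longrightarrow> h \<in> bcontfun \<Longrightarrow> (\<And>x. f x \<le> h x) \<Longrightarrow> L f \<le> L h"
  using nonneg[of "\<lambda>x. h x - f x"] diff[of h f] by (simp add: bcontfun_diff)

lemma zero: "L (\<lambda>_. 0) = 0"
  using cmult[of "\<lambda>_. 0" 0] by (simp add: const_bcontfun)

lemma sum: 
  assumes "\<And>i. i \<in> I \<Longrightarrow> f i \<in> bcontfun" 
  shows "L (\<lambda>x. \<Sum>i\<in>I. f i x) = (\<Sum>i\<in>I. L (f i))"
  using assms by (induction I rule: infinite_finite_induct) (auto simp: zero add bcontfun_sum)

text \<open>The positive parts of \<open>u - (f\<^sub>0 + \<dots> + f\<^sub>n\<^sub>-\<^sub>1)\<close> decrease to zero, and this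
  is where \<open>decreasing\<close> enters. It gives the lower bounds on the outer measure below.\<close>

lemma le_suminf:
  assumes u: "u \<in> bcontfun" and f: "\<And>n. f n \<in> bcontfun" "\<And>n x. f n x \<ge> 0"
    and le: "\<And>x. ennreal (u x) \<le> (\<Sum>n. ennreal (f n x))"
  shows "ennreal (L u) \<le> (\<Sum>n. ennreal (L (f n)))"
proof -
  define rest where "rest n x = max 0 (u x - (\<Sum>i<n. f i x))" for n x
  have rest: "rest n \<in> bcontfun" for n
    unfolding rest_def by (intro bcontfun_max const_bcontfun bcontfun_diff u bcontfun_sum f(1))
  have "(\<lambda>n. L (rest n)) \<longlonglongrightarrow> 0"
  proof (rule decreasing[OF rest])
    show "rest (Suc n) x \<le> rest n x" for n x
      using f(2)[of n x] by (simp add: rest_def)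
    show "(\<lambda>n. rest n x) \<longlonglongrightarrow> 0" for x
    proof (rule order_tendstoI)
      fix a :: real assume a: "a > 0"
      show "\<forall>\<^sub>F n in sequentially. rest n x < a"
      proof (cases "u x < a")
        case True
        have "rest n x < a" for n
          using True a sum_nonneg[of "{..<n}" "\<lambda>i. f i x"] f(2) by (simp add: rest_def)
        then show ?thesis by simp
      next
        case False
        then have "ennreal (u x - a) < ennreal (u x)" using a by (intro ennreal_lessI) auto
        then have "ennreal (u x - a) < (\<Sum>n. ennreal (f n x))" using le[of x] by simp
        then have "\<forall>\<^sub>F n in sequentially. ennreal (u x - a) < (\<Sum>i<n. ennreal (f i x))"
          using order_tendstoD(1)[OF summable_LIMSEQ[OF summableI]] by blast
        then show ?thesis
        proof eventually_elim
          case (elim n)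
          then have "u x - a < (\<Sum>i<n. f i x)"
            using False f(2) by (simp add: sum_ennreal ennreal_less_iff)
          then show ?case using a by (simp add: rest_def)
        qed
      qed
    next
      fix a :: real assume "a < 0"
      then have "a < rest n x" for n by (simp add: rest_def less_max_iff_disj)
      then show "\<forall>\<^sub>F n in sequentially. a < rest n x" by simp
    qed
  qed
  then have lim: "(\<lambda>n. ennreal (L (rest n)) + (\<Sum>n. ennreal (L (f n)))) \<longlonglongrightarrow> ennreal 0 + (\<Sum>n. ennreal (L (f n)))"
    by (intro tendsto_add tendsto_ennrealI tendsto_const)
  have "ennreal (L u) \<le> ennreal (L (rest n)) + (\<Sum>n. ennreal (L (f n)))" for n
  proof -
    have "L u \<le> L (\<lambda>x. rest n x + (\<Sum>i<n. f i x))"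
    proof (rule mono[OF u])
      show "(\<lambda>x. rest n x + (\<Sum>i<n. f i x)) \<in> bcontfun"
        by (intro bcontfun_add bcontfun_sum rest f(1))
      show "u x \<le> rest n x + (\<Sum>i<n. f i x)" for x by (simp add: rest_def)
    qed
    also have "\<dots> = L (rest n) + (\<Sum>i<n. L (f i))"
      by (simp add: add sum rest f(1) bcontfun_sum)
    finally have "ennreal (L u) \<le> ennreal (L (rest n) + (\<Sum>i<n. L (f i)))" by (rule ennreal_leI)
    also have "\<dots> = ennreal (L (rest n)) + (\<Sum>i<n. ennreal (L (f i)))"
    proof -
      have "L (rest n) \<ge> 0" by (rule nonneg[OF rest]) (simp add: rest_def)
      moreover have "L (f i) \<ge> 0" for i by (intro nonneg f)
      ultimately show ?thesis by (simp add: sum_ennreal sum_nonneg)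
    qed
    also have "(\<Sum>i<n. ennreal (L (f i))) \<le> (\<Sum>i. ennreal (L (f i)))"
      by (rule sum_le_suminf) auto
    finally show ?thesis by (simp add: add_left_mono)
  qed
  then show ?thesis using LIMSEQ_le_const[OF lim] by simp
qed

definition covers :: "(nat \<Rightarrow> 'a \<Rightarrow> real) \<Rightarrow> 'a set \<Rightarrow> bool" where
  "covers f A \<longleftrightarrow> (\<forall>n. f n \<in> bcontfun) \<and> (\<forall>n x. f n x \<ge> 0) \<and> (\<forall>x\<in>A. 1 \<le> (\<Sum>n. ennreal (f n x)))"

definition outer :: "'a set \<Rightarrow> ennreal" where
  "outer A = (INF f\<in>{f. covers f A}. \<Sum>n. ennreal (L (f n)))"

lemma outer_le: "covers f A \<Longrightarrow> outer A \<le> (\<Sum>n. ennreal (L (f n)))"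
  unfolding outer_def by (rule INF_lower) simp

lemma outer_le_double:
  assumes f: "\<And>i n. f i n \<in> bcontfun" "\<And>i n x. f i n x \<ge> 0"
    and cov: "\<And>x. x \<in> A \<Longrightarrow> 1 \<le> (\<Sum>i. \<Sum>n. ennreal (f i n x))"
  shows "outer A \<le> (\<Sum>i. \<Sum>n. ennreal (L (f i n)))"
proof -
  define h where "h k = (case prod_decode k of (i, n) \<Rightarrow> f i n)" for k
  have sum: "(\<Sum>k. c (prod_decode k)) = (\<Sum>i. \<Sum>n. c (i, n))" for c :: "nat \<times> nat \<Rightarrow> ennreal"
    using suminf_ennreal_2dimen[of "\<lambda>i. \<Sum>n. c (i, n)" c] by (simp add: o_def)
  have "outer A \<le> (\<Sum>k. ennreal (L (h k)))"
  proof (rule outer_le, unfold covers_def, intro conjI allI ballI)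
    fix x assume "x \<in> A"
    have "(\<Sum>k. ennreal (h k x)) = (\<Sum>i. \<Sum>n. ennreal (f i n x))"
      using sum[of "\<lambda>(i, n). ennreal (f i n x)"] by (simp add: h_def split_def)
    with cov[OF \<open>x \<in> A\<close>] show "1 \<le> (\<Sum>k. ennreal (h k x))" by simp
  qed (auto simp: h_def f split: prod.split)
  also have "\<dots> = (\<Sum>i. \<Sum>n. ennreal (L (f i n)))"
    using sum[of "\<lambda>(i, n). ennreal (L (f i n))"] by (simp add: h_def split_def)
  finally show ?thesis .
qed

lemma outer_le_total: "outer A \<le> ennreal (L (\<lambda>_. 1))"
proof -
  \<comment> \<open>The sequence \<open>1, 0, 0, \<dots>\<close> covers every set.\<close>
  let ?f = "\<lambda>n::nat. \<lambda>x::'a. if n = 0 then 1 else 0 :: real"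
  have L: "L (?f n) = (if n = 0 then L (\<lambda>_. 1) else 0)" for n
    by (cases "n = 0") (simp_all add: zero)
  have s: "(\<Sum>n. ennreal (if n = 0 then a else 0)) = ennreal a" for a
    using suminf_finite[of "{0::nat}" "\<lambda>n. ennreal (if n = 0 then a else 0)"] by simp
  have "covers ?f A"
    by (auto simp: covers_def s const_bcontfun)
  then show ?thesis using outer_le[of ?f A] by (simp add: L s)
qed

text \<open>As \<open>outer A\<close> is finite, the infimum is approached within any \<open>e > 0\<close>.\<close>

lemma outer_approx:
  assumes "e > 0"
  obtains f where "covers f A" "(\<Sum>n. ennreal (L (f n))) \<le> outer A + ennreal e"
proof -
  have "outer A < \<top>" using outer_le_total[of A] ennreal_less_top le_less_trans by blast
  then have "outer A < outer A + ennreal e" 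
    using assms ennreal_add_left_cancel_less[of "outer A" 0 "ennreal e"] by simp
  then show thesis using that unfolding outer_def INF_less_iff by (auto intro: less_imp_le)
qed

lemma outer_mono: "A \<subseteq> B \<Longrightarrow> outer A \<le> outer B"
  unfolding outer_def covers_def by (intro INF_superset_mono) auto

lemma outer_subadditive: "outer (\<Union>i. A i) \<le> (\<Sum>i. outer (A i))"
proof (rule ennreal_le_epsilon)
  fix e :: real assume e: "e > 0"
  have "\<forall>i. \<exists>f. covers f (A i) \<and> (\<Sum>n. ennreal (L (f n))) \<le> outer (A i) + ennreal (e * (1/2) ^ Suc i)"
    using outer_approx e by (metis zero_less_mult_iff zero_less_power half_gt_zero_iff zero_less_one)
  then obtain f where f: "\<And>i. covers (f i) (A i)"
    "\<And>i. (\<Sum>n. ennreal (L (f i n))) \<le> outer (A i) + ennreal (e * (1/2) ^ Suc i)" by metis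
  have "outer (\<Union>i. A i) \<le> (\<Sum>i. \<Sum>n. ennreal (L (f i n)))"
  proof (rule outer_le_double)
    fix x assume "x \<in> (\<Union>i. A i)"
    then obtain i where "x \<in> A i" by blast
    then have "1 \<le> (\<Sum>n. ennreal (f i n x))" using f(1) by (auto simp: covers_def)
    also have "\<dots> \<le> (\<Sum>i. \<Sum>n. ennreal (f i n x))"
      using sum_le_suminf[of "\<lambda>i. \<Sum>n. ennreal (f i n x)" "{i}"] by simp
    finally show "1 \<le> (\<Sum>i. \<Sum>n. ennreal (f i n x))" .
  qed (use f(1) in \<open>auto simp: covers_def\<close>)
  also have "\<dots> \<le> (\<Sum>i. outer (A i) + ennreal (e * (1/2) ^ Suc i))"
    by (intro suminf_le f(2) summableI)
  also have "\<dots> = (\<Sum>i. outer (A i)) + (\<Sum>i. ennreal (e * (1/2) ^ Suc i))"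
    by (simp add: suminf_add)
  also have "(\<Sum>i. ennreal (e * (1/2) ^ Suc i)) = ennreal e"
    using e sums_mult[OF power_half_series, of e] by (intro suminf_ennreal_eq) auto
  finally show "outer (\<Union>i. A i) \<le> (\<Sum>i. outer (A i)) + ennreal e" .
qed

lemma outer_empty: "outer {} = 0"
proof -
  have "covers (\<lambda>_ _. 0) {}" by (auto simp: covers_def const_bcontfun)
  then have "outer {} \<le> (\<Sum>n::nat. ennreal (L (\<lambda>_. 0)))" by (rule outer_le)
  then show ?thesis by (simp add: zero)
qed

text \<open>Let \<open>u\<^sub>k\<close> increase to the indicator function of \<open>U\<close>, and let the \<open>f\<^sub>n\<close> cover \<open>A\<close>. The
  functions \<open>f\<^sub>n (u\<^sub>k\<^sub>+\<^sub>1 - u\<^sub>k)\<close> cover \<open>A \<inter> U\<close>, the functions \<open>f\<^sub>n (1 - u\<^sub>K)\<close> cover \<open>A - U\<close>.\<close>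

lemma outer_open_split:
  assumes "open U"
  shows "outer (U \<inter> A) + outer (- U \<inter> A) \<le> outer A"
proof (rule ennreal_le_epsilon)
  fix e :: real assume e: "e > 0"
  obtain f where f: "covers f A" "(\<Sum>n. ennreal (L (f n))) \<le> outer A + ennreal e"
    by (blast intro: outer_approx[OF e])
  have fb: "f n \<in> bcontfun" "f n x \<ge> 0" for n x using f by (auto simp: covers_def)
  obtain u where u: "\<And>k. u k \<in> bcontfun" "\<And>k x. 0 \<le> u k x" "\<And>k x. u k x \<le> indicator U x"
    "\<And>k x. u k x \<le> u (Suc k) x" "\<And>x. (\<lambda>k. u k x) \<longlonglongrightarrow> indicator U x" "\<And>x. u 0 x = (0::real)"
    using open_bcontfun_approximation[OF assms] by blast
  have u1: "u k x \<le> 1" for k x by (rule order_trans[OF u(3) indicator_le_1])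
  define S where "S = (\<Sum>n. ennreal (L (f n)))"
  define b where "b k n = L (\<lambda>x. (u (Suc k) x - u k x) * f n x)" for k n
  have bc: "(\<lambda>x. (u (Suc k) x - u k x) * f n x) \<in> bcontfun" "(\<lambda>x. (1 - u k x) * f n x) \<in> bcontfun"
    "(\<lambda>x. u k x * f n x) \<in> bcontfun" for k n
    by (intro bcontfun_mult bcontfun_diff const_bcontfun u(1) fb)+
  have b0: "b k n \<ge> 0" for k n
    unfolding b_def by (intro nonneg bc mult_nonneg_nonneg fb) (use u(4) in auto)
  have inside: "outer (U \<inter> A) \<le> (\<Sum>k. \<Sum>n. ennreal (b k n))"
    unfolding b_def
  proof (rule outer_le_double)
    fix x assume x: "x \<in> U \<inter> A"
    have "(\<lambda>k. u (Suc k) x - u k x) sums (indicator U x - u 0 x)"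
      by (rule telescope_sums[OF u(5)])
    then have "(\<Sum>k. ennreal (u (Suc k) x - u k x)) = ennreal 1"
      using u(4,6) x by (intro suminf_ennreal_eq) auto
    moreover have "(\<Sum>k. \<Sum>n. ennreal ((u (Suc k) x - u k x) * f n x))
        = (\<Sum>k. ennreal (u (Suc k) x - u k x)) * (\<Sum>n. ennreal (f n x))"
      using u(4) fb by (simp add: ennreal_mult ennreal_suminf_multc)
    moreover have "1 \<le> (\<Sum>n. ennreal (f n x))" using f(1) x by (auto simp: covers_def)
    ultimately show "1 \<le> (\<Sum>k. \<Sum>n. ennreal ((u (Suc k) x - u k x) * f n x))" by simp
  qed (use bc u(4) fb in auto)
  have "(\<Sum>k<K. \<Sum>n. ennreal (b k n)) + outer (- U \<inter> A) \<le> S" for K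
  proof -
    have "covers (\<lambda>n x. (1 - u K x) * f n x) (- U \<inter> A)"
      unfolding covers_def
    proof (intro conjI allI ballI)
      fix x assume x: "x \<in> - U \<inter> A"
      then have "u K x = 0" using u(2,3)[of K x] by simp
      then show "1 \<le> (\<Sum>n. ennreal ((1 - u K x) * f n x))" using f(1) x by (simp add: covers_def)
    qed (use bc u1 fb in auto)
    then have "outer (- U \<inter> A) \<le> (\<Sum>n. ennreal (L (\<lambda>x. (1 - u K x) * f n x)))" by (rule outer_le)
    moreover have "(\<Sum>k<K. \<Sum>n. ennreal (b k n)) = (\<Sum>n. ennreal (L (\<lambda>x. u K x * f n x)))"
    proof -
      have "(\<Sum>k<K. b k n) = L (\<lambda>x. u K x * f n x)" for n
      proof -
        have "(\<Sum>k<K. b k n) = (\<Sum>k<K. L (\<lambda>x. u (Suc k) x * f n x) - L (\<lambda>x. u k x * f n x))"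
          by (simp add: b_def left_diff_distrib diff bc)
        also have "\<dots> = L (\<lambda>x. u K x * f n x) - L (\<lambda>x. u 0 x * f n x)"
          by (rule sum_lessThan_telescope)
        finally show ?thesis by (simp add: u(6) zero)
      qed
      then have "(\<Sum>n. ennreal (L (\<lambda>x. u K x * f n x))) = (\<Sum>n. \<Sum>k<K. ennreal (b k n))"
        using b0 by (simp add: sum_ennreal)
      then show ?thesis by (simp add: suminf_sum)
    qed
    moreover have "(\<Sum>n. ennreal (L (\<lambda>x. u K x * f n x))) + (\<Sum>n. ennreal (L (\<lambda>x. (1 - u K x) * f n x))) = S"
    proof -
      have "L (\<lambda>x. u K x * f n x) + L (\<lambda>x. (1 - u K x) * f n x) = L (f n)" for n
        using add[OF bc(3,2), of K n K n] by (simp add: algebra_simps)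
      moreover have "L (\<lambda>x. u K x * f n x) \<ge> 0" "L (\<lambda>x. (1 - u K x) * f n x) \<ge> 0" for n
        by (intro nonneg bc mult_nonneg_nonneg fb; use u(2) u1 in simp)+
      ultimately have split: "ennreal (L (f n))
          = ennreal (L (\<lambda>x. u K x * f n x)) + ennreal (L (\<lambda>x. (1 - u K x) * f n x))" for n
        by (metis ennreal_plus)
      show ?thesis unfolding S_def split by (rule suminf_add[OF summableI summableI])
    qed
    ultimately show ?thesis using add_left_mono by fastforce
  qed
  then have "(\<Sum>k. \<Sum>n. ennreal (b k n)) + outer (- U \<inter> A) \<le> S"
    by (intro LIMSEQ_le_const2[OF tendsto_add[OF summable_LIMSEQ[OF summableI] tendsto_const]]) auto
  then show "outer (U \<inter> A) + outer (- U \<inter> A) \<le> outer A + ennreal e"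
    using inside f(2) unfolding S_def by (meson add_right_mono order_trans)
qed

lemma outer_lambda_system: "sets borel \<subseteq> lambda_system UNIV (Pow UNIV) outer"
  "measure_space UNIV (sets borel) outer"
proof -
  interpret P: sigma_algebra UNIV "Pow UNIV :: 'a set set" by (rule sigma_algebra_Pow)
  have pos: "positive (Pow UNIV) outer" by (simp add: positive_def outer_empty)
  have oms: "outer_measure_space (Pow UNIV) outer"
    unfolding outer_measure_space_def
    using pos outer_subadditive outer_mono
    by (auto simp: increasing_def countably_subadditive_def)
  have two: "outer A \<le> outer (U \<inter> A) + outer (- U \<inter> A)" for A U
  proof -
    have "outer A = outer (\<Union>i. binaryset (U \<inter> A) (- U \<inter> A) i)"
      by (rule arg_cong[where f=outer]) (auto simp: UN_binaryset_eq)
    also have "\<dots> \<le> (\<Sum>i. outer (binaryset (U \<inter> A) (- U \<inter> A) i))" by (rule outer_subadditive)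
    also have "\<dots> = outer (U \<inter> A) + outer (- U \<inter> A)"
      by (rule suminf_binaryset_eq) (simp add: outer_empty)
    finally show ?thesis .
  qed
  have "U \<in> lambda_system UNIV (Pow UNIV) outer" if "open U" for U
    unfolding lambda_system_def using outer_open_split[OF that] two
    by (auto intro!: antisym simp: Compl_eq_Diff_UNIV[symmetric])
  then have op: "{U. open U} \<subseteq> lambda_system UNIV (Pow UNIV) outer" by blast
  have ms: "measure_space UNIV (lambda_system UNIV (Pow UNIV) outer) outer"
    using P.caratheodory_lemma[OF oms] by simp
  then have sa: "sigma_algebra UNIV (lambda_system UNIV (Pow UNIV) outer)"
    by (simp add: measure_space_def)
  have borel: "sets borel = sigma_sets UNIV {U :: 'a set. open U}"
    by (simp add: borel_def)
  show *: "sets borel \<subseteq> lambda_system UNIV (Pow UNIV) outer"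
    unfolding borel by (rule sigma_algebra.sigma_sets_subset[OF sa op])
  show "measure_space UNIV (sets borel) outer"
    by (rule measure_down[OF ms _ *]) (use sets.sigma_algebra_axioms[of "borel :: 'a measure"] in simp)
qed

definition repr :: "'a measure" where
  "repr = measure_of UNIV (sets borel) outer"

lemma sets_repr [simp, measurable_cong]: "sets repr = sets borel"
  unfolding repr_def using sets.sigma_sets_eq[of borel] by (simp add: sets_measure_of)

lemma space_repr [simp]: "space repr = UNIV"
  unfolding repr_def by (simp add: space_measure_of_conv)

lemma emeasure_repr: "A \<in> sets borel \<Longrightarrow> emeasure repr A = outer A"
  unfolding repr_def using outer_lambda_system(2)
  by (intro emeasure_measure_of_sigma) (auto simp: measure_space_def)

lemma le_outer:
  assumes "u \<in> bcontfun" "\<And>x. u x \<le> indicator A x"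
  shows "ennreal (L u) \<le> outer A"
  unfolding outer_def
proof (rule INF_greatest, rule le_suminf[OF assms(1)])
  fix f x assume f: "f \<in> {f. covers f A}"
  show "f n \<in> bcontfun" "f n x \<ge> 0" for n x using f by (auto simp: covers_def)
  show "ennreal (u x) \<le> (\<Sum>n. ennreal (f n x))"
  proof (cases "x \<in> A")
    case True
    then have "ennreal (u x) \<le> 1" using assms(2)[of x] by (simp add: ennreal_le_1)
    also have "\<dots> \<le> (\<Sum>n. ennreal (f n x))" using f True by (auto simp: covers_def)
    finally show ?thesis .
  qed (use assms(2)[of x] in \<open>simp add: ennreal_neg\<close>)
qed

lemma outer_UNIV: "outer UNIV = ennreal (L (\<lambda>_. 1))"
  using outer_le_total le_outer[of "\<lambda>_. 1" UNIV] by (intro antisym) (auto simp: const_bcontfun)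

lemma finite_measure_repr: "finite_measure repr"
  by (rule finite_measureI) (simp add: emeasure_repr outer_UNIV)

lemma measure_repr_ge:
  assumes "u \<in> bcontfun" "\<And>x. u x \<le> indicator A x" "A \<in> sets borel"
  shows "L u \<le> measure repr A"
proof -
  interpret finite_measure repr by (rule finite_measure_repr)
  have "ennreal (L u) \<le> ennreal (measure repr A)"
    using le_outer[OF assms(1,2)] emeasure_repr[OF assms(3)] by (simp add: emeasure_eq_measure)
  then show ?thesis by (simp add: ennreal_le_iff)
qed

lemma bcontfun_integrable_repr: "f \<in> bcontfun \<Longrightarrow> integrable repr f" for f :: "'a \<Rightarrow> real"
proof -
  assume f: "f \<in> bcontfun"
  interpret finite_measure repr by (rule finite_measure_repr)
  obtain B where B: "\<And>x. \<bar>f x\<bar> \<le> B" using f by (blast intro: bcontfun_bounded)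
  have "f \<in> borel_measurable repr"
    using borel_measurable_continuous_onI[OF bcontfun_continuous[OF f]]
    by (simp cong: measurable_cong_sets)
  then show ?thesis using B by (intro integrable_const_bound[where B=B]) auto
qed

text \<open>The sum of the slices \<open>min 1 (max 0 (N f - j)) / N\<close> for \<open>j < N\<close> is \<open>f\<close>, and each slice lies
  below the indicator function of the open set \<open>{f > j / N}\<close>, divided by \<open>N\<close>.\<close>

lemma le_integral_repr:
  assumes f: "f \<in> bcontfun" "\<And>x. 0 \<le> f x" "\<And>x. f x \<le> 1"
  shows "L f \<le> (LINT x|repr. f x)"
proof (rule field_le_epsilon)
  interpret finite_measure repr by (rule finite_measure_repr)
  fix e :: real assume e: "e > 0"
  define m where "m = measure repr UNIV"
  have m: "m \<ge> 0" by (simp add: m_def)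
  obtain N :: nat where N: "m / e < real N" "N > 0"
    by (metis reals_Archimedean2 gr0I less_le_trans of_nat_0 of_nat_0_le_iff divide_nonneg_pos m e not_le)
  define c where "c j x = min 1 (max 0 (real N * f x - real j))" for j x
  have c: "c j \<in> bcontfun" for j
    unfolding c_def by (intro bcontfun_min bcontfun_max bcontfun_diff const_bcontfun bcontfun_cmult f(1))
  have sets: "{x. real j < real N * f x} \<in> sets borel" for j
    by (intro borel_open open_Collect_less continuous_intros bcontfun_continuous f(1))
  have ind: "integrable repr (indicat_real {x. real j < real N * f x})" for j
    by (rule integrable_real_indicator) (use sets in \<open>auto simp: emeasure_eq_measure\<close>)
  have "real N * f x = (\<Sum>j<N. c j x)" for x
    unfolding c_def using f(2,3)[of x] N by (subst sum_clamp) (auto simp: min_def mult_le_cancel_left1)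
  then have "real N * L f = (\<Sum>j<N. L (c j))"
    using cmult[OF f(1), of "real N"] sum[of "{..<N}" c] c by simp
  also have "\<dots> \<le> (\<Sum>j<N. measure repr {x. real j < real N * f x})"
    by (intro sum_mono measure_repr_ge c sets) (auto simp: c_def indicator_def)
  also have "\<dots> = (LINT x|repr. (\<Sum>j<N. indicator {x. real j < real N * f x} x))"
    using ind by (subst Bochner_Integration.integral_sum) (auto simp: sets)
  also have "\<dots> \<le> (LINT x|repr. real N * f x + 1)"
  proof (rule integral_mono)
    show "integrable repr (\<lambda>x. \<Sum>j<N. indicat_real {x. real j < real N * f x} x)"
      using ind by (rule Bochner_Integration.integrable_sum)
    show "integrable repr (\<lambda>x. real N * f x + 1)" using bcontfun_integrable_repr[OF f(1)] by simp
    fix x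
    show "(\<Sum>j<N. indicat_real {x. real j < real N * f x} x) \<le> real N * f x + 1"
      using sum_count_le[of "real N * f x" N] f(2)[of x] by (simp add: indicator_def of_bool_def)
  qed
  also have "\<dots> = real N * (LINT x|repr. f x) + m"
    using bcontfun_integrable_repr[OF f(1)] by (simp add: m_def)
  also have "\<dots> \<le> real N * (LINT x|repr. f x) + real N * e"
    using N e by (simp add: field_simps)
  finally have "real N * L f \<le> real N * ((LINT x|repr. f x) + e)" by (simp add: distrib_left)
  then show "L f \<le> (LINT x|repr. f x) + e" using N by simp
qed

lemma integral_repr:
  assumes f: "f \<in> bcontfun"
  shows "(LINT x|repr. f x) = L f"
proof -
  interpret finite_measure repr by (rule finite_measure_repr)
  have total: "measure repr UNIV = L (\<lambda>_. 1)"
    using outer_UNIV emeasure_repr[of UNIV] nonneg[of "\<lambda>_. 1"] by (simp add: emeasure_eq_measure const_bcontfun)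
  have unit: "(LINT x|repr. h x) = L h" if h: "h \<in> bcontfun" "\<And>x. 0 \<le> h x" "\<And>x. h x \<le> 1" for h
  proof (rule antisym)
    have "L (\<lambda>x. 1 - h x) \<le> (LINT x|repr. 1 - h x)"
      by (rule le_integral_repr) (auto intro: bcontfun_diff const_bcontfun h)
    then show "(LINT x|repr. h x) \<le> L h"
      using bcontfun_integrable_repr[OF h(1)] total by (simp add: diff const_bcontfun h(1))
  qed (rule le_integral_repr[OF h])
  obtain B where B: "\<And>x. \<bar>f x\<bar> \<le> B" using f by (blast intro: bcontfun_bounded)
  define C where "C = max B 1"
  have C: "\<bar>f x\<bar> \<le> C" "C \<ge> 1" for x using B[of x] by (auto simp: C_def)
  define h where "h x = 1/2 + (1 / (2 * C)) * f x" for x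
  have h: "h \<in> bcontfun" unfolding h_def by (intro bcontfun_add const_bcontfun bcontfun_cmult f)
  have "\<bar>(1 / (2 * C)) * f x\<bar> \<le> 1/2" for x using C(1)[of x] C(2) by (simp add: abs_mult field_simps)
  then have "0 \<le> h x" "h x \<le> 1" for x
    using abs_le_D1 abs_le_D2 unfolding h_def by (smt (verit) field_sum_of_halves)+
  then have "(LINT x|repr. h x) = L h" by (rule unit[OF h])
  moreover have "(LINT x|repr. h x) = 1/2 * L (\<lambda>_. 1) + (1 / (2 * C)) * (LINT x|repr. f x)"
    using bcontfun_integrable_repr[OF f] total by (simp add: h_def)
  moreover have "L h = 1/2 * L (\<lambda>_. 1) + (1 / (2 * C)) * L f"
    unfolding h_def[abs_def] add[OF const_bcontfun bcontfun_cmult[OF f]] cmult[OF f]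
    using cmult[OF const_bcontfun, of "1/2" 1] by simp
  ultimately show ?thesis using C(2) by simp
qed

end

lemma integral_tendsto_measure_open:
  fixes \<mu> :: "'a::metric_space measure"
  assumes \<mu>: "finite_measure \<mu>" "sets \<mu> = sets borel" and U: "open U" 
    and u: "\<And>k. u k \<in> bcontfun" "\<And>k x. 0 \<le> u k x" "\<And>k x. u k x \<le> indicator U x"
      "\<And>x. (\<lambda>k. u k x) \<longlonglongrightarrow> indicat_real U x"
  shows "(\<lambda>k. LINT x|\<mu>. u k x) \<longlonglongrightarrow> measure \<mu> U"
proof -
  interpret finite_measure \<mu> by fact
  have "(\<lambda>k. LINT x|\<mu>. u k x) \<longlonglongrightarrow> (LINT x|\<mu>. indicator U x)"
  proof (rule integral_dominated_convergence[where w="\<lambda>_. 1"])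
    show "u k \<in> borel_measurable \<mu>" for k
      using borel_measurable_continuous_onI[OF bcontfun_continuous[OF u(1)]]
      by (simp add: measurable_cong_sets[OF \<mu>(2) refl])
    show "indicat_real U \<in> borel_measurable \<mu>"
      using U \<mu>(2) by (intro borel_measurable_indicator) simp
    show "AE x in \<mu>. norm (u k x) \<le> 1" for k
      using u(2)[of k] order_trans[OF u(3) indicator_le_1] by simp
  qed (use u(4) in auto)
  moreover have "U \<inter> space \<mu> = U" using sets_eq_imp_space_eq[OF \<mu>(2)] by simp
  ultimately show ?thesis using U \<mu>(2) by simp
qed

text \<open>By the previous lemma the integrals determine the measures of the open sets, which form a
  generator of the Borel sets that is stable under intersections.\<close>

lemma finite_borel_measure_eqI:
  fixes \<sigma> \<tau> :: "'a::metric_space measure"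
  assumes "finite_measure \<sigma>" "finite_measure \<tau>" and sets: "sets \<sigma> = sets borel" "sets \<tau> = sets borel"
    and eq: "\<And>f. f \<in> bcontfun \<Longrightarrow> (LINT x|\<sigma>. f x :: real) = (LINT x|\<tau>. f x)"
  shows "\<sigma> = \<tau>"
proof -
  interpret \<sigma>: finite_measure \<sigma> by fact
  interpret \<tau>: finite_measure \<tau> by fact
  show ?thesis
  proof (rule measure_eqI_generator_eq[where E="{U. open U}" and \<Omega>=UNIV and A="\<lambda>_. UNIV"])
    show "emeasure \<sigma> U = emeasure \<tau> U" if "U \<in> {U. open U}" for U
    proof -
      have U: "open U" using that by simp
      obtain u where u6: "\<And>k. u k \<in> bcontfun" "\<And>k x. 0 \<le> u k x" "\<And>k x. u k x \<le> indicator U x"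
        "\<And>k x. u k x \<le> u (Suc k) x" "\<And>x. (\<lambda>k. u k x) \<longlonglongrightarrow> indicator U x" "\<And>x. u 0 x = (0::real)"
        using open_bcontfun_approximation[OF U] by blast
      note u = u6(1-3,5)
      have "measure \<sigma> U = measure \<tau> U"
        using integral_tendsto_measure_open[OF assms(1) sets(1) U u]
          integral_tendsto_measure_open[OF assms(2) sets(2) U u] eq[OF u(1)] LIMSEQ_unique by simp
      then show ?thesis by (simp add: \<sigma>.emeasure_eq_measure \<tau>.emeasure_eq_measure)
    qed
    show "sets \<sigma> = sigma_sets UNIV {U. open U}" "sets \<tau> = sigma_sets UNIV {U. open U}"
      using sets by (simp_all add: borel_def)
  qed (auto simp: Int_stable_def)
qed

section \<open>Smooth cut-off functions of finite unions of balls\<close>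

text \<open>Unlike the elements of \<open>C\<^sub>b\<^sup>1\<close>, these functions may be unbounded; the common bound on the
  gradients survives smooth minima of any number of them.\<close>

definition slope1 :: "('a::real_inner \<Rightarrow> real) \<Rightarrow> bool" where
  "slope1 f \<longleftrightarrow> (\<exists>D. (\<forall>x. GDERIV f x :> D x) \<and> continuous_on UNIV D \<and> (\<forall>x. norm (D x) \<le> 1))"

lemma slope1I:
  assumes "\<And>x. GDERIV f x :> D x" "continuous_on UNIV D" "\<And>x. norm (D x) \<le> 1"
  shows "slope1 f"
  using assms unfolding slope1_def by blast

text \<open>\<open>(a + b - sqrt ((a - b)\<^sup>2 + \<epsilon>\<^sup>2)) / 2\<close> lies slightly below \<open>min a b\<close>, and its gradient is a convex
  combination of the two gradients.\<close>

lemma slope1_min: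
  assumes a: "slope1 a" and b: "slope1 b" and e: "e > 0"
  shows "\<exists>m. slope1 m \<and> (\<forall>x. m x \<le> a x \<and> m x \<le> b x \<and> min (a x) (b x) - e \<le> m x)"
proof -
  obtain A where A: "\<And>x. GDERIV a x :> A x" "continuous_on UNIV A" "\<And>x. norm (A x) \<le> 1"
    using a unfolding slope1_def by blast
  obtain B where B: "\<And>x. GDERIV b x :> B x" "continuous_on UNIV B" "\<And>x. norm (B x) \<le> 1"
    using b unfolding slope1_def by blast
  define h where "h t = sqrt (t\<^sup>2 + e\<^sup>2)" for t
  define k where "k t = t / sqrt (t\<^sup>2 + e\<^sup>2)" for t
  have k1: "\<bar>k t\<bar> \<le> 1" for t using abs_div_sqrt_regularised_le[OF e] by (simp add: k_def)
  have kc: "continuous_on UNIV k" using continuous_div_sqrt_regularised[OF e] by (simp add: k_def[abs_def])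
  have hk: "(h has_real_derivative k t) (at t)" for t
    unfolding h_def[abs_def] k_def by (rule DERIV_sqrt_regularised[OF e])
  define m where "m x = (a x + b x - h (a x - b x)) / 2" for x
  define D where "D x = (1/2) *\<^sub>R (A x + B x - k (a x - b x) *\<^sub>R (A x - B x))" for x
  have "GDERIV m x :> D x" for x
  proof -
    have half: "((\<lambda>t. t / 2) has_real_derivative 1/2) (at t)" for t :: real
      by (auto intro!: derivative_eq_intros)
    show ?thesis unfolding m_def[abs_def] D_def
      by (rule GDERIV_DERIV_compose[OF GDERIV_diff[OF GDERIV_add[OF A(1) B(1)]
            GDERIV_DERIV_compose[OF GDERIV_diff[OF A(1) B(1)] hk]] half])
  qed
  moreover have "continuous_on UNIV D"
  proof -
    have "continuous_on UNIV (\<lambda>x. a x - b x)"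
      by (intro continuous_on_diff GDERIV_continuous_on[OF A(1)] GDERIV_continuous_on[OF B(1)])
    then have "continuous_on UNIV (\<lambda>x. k (a x - b x))"
      by (rule continuous_on_compose2[OF kc]) auto
    then show ?thesis unfolding D_def[abs_def] by (intro continuous_intros A(2) B(2))
  qed
  moreover have "norm (D x) \<le> 1" for x
  proof -
    let ?k = "k (a x - b x)"
    have D: "D x = ((1 - ?k) / 2) *\<^sub>R A x + ((1 + ?k) / 2) *\<^sub>R B x"
      by (simp add: D_def algebra_simps add_divide_distrib diff_divide_distrib)
    have "norm (D x) \<le> \<bar>(1 - ?k) / 2\<bar> * norm (A x) + \<bar>(1 + ?k) / 2\<bar> * norm (B x)"
      unfolding D by (rule order_trans[OF norm_triangle_ineq]) simp
    also have "\<dots> \<le> \<bar>(1 - ?k) / 2\<bar> * 1 + \<bar>(1 + ?k) / 2\<bar> * 1"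
      by (intro add_mono mult_left_mono A(3) B(3)) auto
    also have "\<dots> = 1"
    proof -
      have "\<bar>(1 - t) / 2\<bar> * 1 + \<bar>(1 + t) / 2\<bar> * 1 = 1" if "\<bar>t\<bar> \<le> 1" for t :: real
      proof -
        have "0 \<le> (1 - t) / 2" "0 \<le> (1 + t) / 2" using that by (simp_all add: abs_le_iff)
        then have "\<bar>(1 - t) / 2\<bar> = (1 - t) / 2" "\<bar>(1 + t) / 2\<bar> = (1 + t) / 2"
          by (simp_all only: abs_of_nonneg)
        then show ?thesis by (simp only: mult_1_right) (simp add: field_simps)
      qed
      then show ?thesis using k1 by blast
    qed
    finally show ?thesis .
  qed
  ultimately have "slope1 m" by (rule slope1I)
  moreover have "m x \<le> a x \<and> m x \<le> b x \<and> min (a x) (b x) - e \<le> m x" for x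
  proof -
    have "\<bar>a x - b x\<bar> \<le> h (a x - b x)" unfolding h_def by (rule real_le_rsqrt) simp
    moreover have "h (a x - b x) \<le> \<bar>a x - b x\<bar> + \<bar>e\<bar>" unfolding h_def by (rule sqrt_sum_squares_le_sum_abs)
    ultimately show ?thesis using e unfolding m_def min_def by (auto simp: field_simps)
  qed
  ultimately show ?thesis by blast
qed

lemma slope1_finite_min:
  assumes "\<And>i. slope1 (f i)" "e > 0"
  shows "\<exists>m. slope1 m \<and> (\<forall>x. (\<forall>i\<le>n::nat. m x \<le> f i x) \<and> (\<exists>i\<le>n. f i x - e \<le> m x))"
  using assms(2)
proof (induction n arbitrary: e)
  case 0
  then show ?case using assms(1)[of 0] by (intro exI[of _ "f 0"]) auto
next
  case (Suc n)
  obtain m where m: "slope1 m" "\<And>x i. i \<le> n \<Longrightarrow> m x \<le> f i x" "\<And>x. \<exists>i\<le>n. f i x - e / 2 \<le> m x"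
    using Suc.IH[of "e / 2"] Suc.prems by auto
  obtain m' where m': "slope1 m'" "\<And>x. m' x \<le> m x" "\<And>x. m' x \<le> f (Suc n) x"
    "\<And>x. min (m x) (f (Suc n) x) - e / 2 \<le> m' x"
    using slope1_min[OF m(1) assms(1)[of "Suc n"], of "e / 2"] Suc.prems by auto
  have "m' x \<le> f i x" if "i \<le> Suc n" for i x
    using that m(2)[of i x] m'(2,3)[of x] by (cases "i = Suc n") auto
  moreover have "\<exists>i\<le>Suc n. f i x - e \<le> m' x" for x
  proof (cases "m x \<le> f (Suc n) x")
    case True
    obtain i where "i \<le> n" "f i x - e / 2 \<le> m x" using m(3) by blast
    then show ?thesis using m'(4)[of x] True by (intro exI[of _ i]) auto
  next
    case False
    then show ?thesis using m'(4)[of x] Suc.prems by (intro exI[of _ "Suc n"]) auto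
  qed
  ultimately show ?case using m'(1) by blast
qed

lemma slope1_distance:
  fixes c :: "'a::real_inner"
  assumes "d > 0"
  shows "slope1 (\<lambda>x. sqrt ((norm (x - c))\<^sup>2 + d\<^sup>2) - K)"
proof (rule slope1I)
  have pos: "(norm (x - c))\<^sup>2 + d\<^sup>2 > 0" for x using assms by (simp add: add_nonneg_pos)
  show "GDERIV (\<lambda>x. sqrt ((norm (x - c))\<^sup>2 + d\<^sup>2) - K) x :> (1 / sqrt ((norm (x - c))\<^sup>2 + d\<^sup>2)) *\<^sub>R (x - c)" for x
  proof -
    have 1: "GDERIV (\<lambda>x. (norm (x - c))\<^sup>2) x :> 2 *\<^sub>R (x - c)" for x
      unfolding gderiv_def power2_norm_eq_inner
      by (auto intro!: derivative_eq_intros simp: inner_commute algebra_simps)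
    have 2: "((\<lambda>t. sqrt (t + d\<^sup>2) - K) has_real_derivative inverse (sqrt ((norm (x - c))\<^sup>2 + d\<^sup>2)) / 2) (at ((norm (x - c))\<^sup>2))"
    proof -
      have "((\<lambda>t. t + d\<^sup>2) has_real_derivative 1) (at ((norm (x - c))\<^sup>2))"
        by (auto intro!: derivative_eq_intros)
      from DERIV_chain2[where f=sqrt and g="\<lambda>t. t + d\<^sup>2", OF DERIV_real_sqrt[OF pos] this]
      show ?thesis by (auto intro!: DERIV_cong[OF DERIV_diff[OF _ DERIV_const]])
    qed
    have eq: "(inverse (sqrt ((norm (x - c))\<^sup>2 + d\<^sup>2)) / 2) *\<^sub>R 2 *\<^sub>R (x - c)
       = (1 / sqrt ((norm (x - c))\<^sup>2 + d\<^sup>2)) *\<^sub>R (x - c)"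
      by (simp add: inverse_eq_divide)
    show ?thesis using GDERIV_DERIV_compose[OF 1 2] unfolding eq .
  qed
  show "continuous_on UNIV (\<lambda>x. (1 / sqrt ((norm (x - c))\<^sup>2 + d\<^sup>2)) *\<^sub>R (x - c))"
    using assms by (intro continuous_intros) auto
  show "norm ((1 / sqrt ((norm (x - c))\<^sup>2 + d\<^sup>2)) *\<^sub>R (x - c)) \<le> 1" for x
    using abs_div_sqrt_regularised_le[OF assms, of "norm (x - c)"] by simp
qed

text \<open>A \<open>C\<^sup>1\<close> function that vanishes for \<open>t \<le> 0\<close> only. Its compositions are locally constant
  wherever the inner function is negative.\<close>

definition cutoff :: "real \<Rightarrow> real" where
  "cutoff t = (max 0 t)\<^sup>2 / (1 + (max 0 t)\<^sup>2)"

definition cutoff' :: "real \<Rightarrow> real" where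
  "cutoff' t = 2 * max 0 t / (1 + (max 0 t)\<^sup>2)\<^sup>2"

lemma DERIV_max_square: "((\<lambda>t. (max 0 t)\<^sup>2) has_real_derivative 2 * max 0 t) (at t)" for t :: real
proof -
  consider "t > 0" | "t < 0" | "t = 0" by linarith
  then show ?thesis
  proof cases
    case 1
    have "((\<lambda>t. t\<^sup>2) has_real_derivative 2 * t) (at t)" by (auto intro!: derivative_eq_intros)
    then have "((\<lambda>t. (max 0 t)\<^sup>2) has_real_derivative 2 * t) (at t)"
      by (rule DERIV_cong_ev[THEN iffD1, rotated -1])
         (use 1 eventually_nhds_in_open[of "{0<..}" t] in \<open>auto elim!: eventually_mono\<close>)
    then show ?thesis using 1 by simp
  next
    case 2
    have "((\<lambda>t. 0) has_real_derivative 0) (at t)" by simp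
    then have "((\<lambda>t. (max 0 t)\<^sup>2) has_real_derivative 0) (at t)"
      by (rule DERIV_cong_ev[THEN iffD1, rotated -1])
         (use 2 eventually_nhds_in_open[of "{..<0}" t] in \<open>auto elim!: eventually_mono\<close>)
    then show ?thesis using 2 by simp
  next
    case 3
    have "((\<lambda>h. (max 0 h)\<^sup>2 / h) \<longlongrightarrow> 0) (at (0::real))"
    proof (rule Lim_null_comparison)
      show "\<forall>\<^sub>F h in at (0::real). norm ((max 0 h)\<^sup>2 / h) \<le> \<bar>h\<bar>"
        by (intro always_eventually) (auto simp: max_def power2_eq_square)
      show "((\<lambda>h. \<bar>h\<bar>) \<longlongrightarrow> 0) (at (0::real))" by (rule tendsto_rabs_zero[OF tendsto_ident_at])
    qed
    then show ?thesis using 3 by (simp add: has_field_derivative_iff)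
  qed
qed

lemma cutoff_facts:
  "(cutoff has_real_derivative cutoff' t) (at t)" "continuous_on UNIV cutoff'"
  "0 \<le> cutoff t" "cutoff t \<le> 1" "\<bar>cutoff' t\<bar> \<le> 1"
  "t \<le> 0 \<Longrightarrow> cutoff t = 0" "t \<le> 0 \<Longrightarrow> cutoff' t = 0" "s > 0 \<Longrightarrow> 0 < cutoff s"
  "0 < s \<Longrightarrow> s \<le> t \<Longrightarrow> cutoff s \<le> cutoff t"
proof -
  have pos: "1 + (max 0 t)\<^sup>2 > 0" for t :: real by (simp add: add_pos_nonneg)
  let ?q = "\<lambda>u::real. u / (1 + u)"
  have "(?q has_real_derivative 1 / (1 + (max 0 t)\<^sup>2)\<^sup>2) (at ((max 0 t)\<^sup>2))"
    using pos[of t] by (auto intro!: derivative_eq_intros simp: power2_eq_square divide_simps)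
  from DERIV_chain2[where f="?q" and g="\<lambda>t. (max 0 t)\<^sup>2", OF this DERIV_max_square]
  show "(cutoff has_real_derivative cutoff' t) (at t)"
    by (simp add: cutoff_def[abs_def] cutoff'_def)
  show "continuous_on UNIV cutoff'"
    unfolding cutoff'_def[abs_def] using pos
    by (intro continuous_intros) (auto simp: less_imp_neq[symmetric])
  show "0 \<le> cutoff t" "cutoff t \<le> 1" "t \<le> 0 \<Longrightarrow> cutoff t = 0" "t \<le> 0 \<Longrightarrow> cutoff' t = 0"
    using pos[of t] by (auto simp: cutoff_def cutoff'_def divide_le_eq)
  show "\<bar>cutoff' t\<bar> \<le> 1"
  proof -
    have "2 * max 0 t \<le> 1 + (max 0 t)\<^sup>2" 
      using sum_squares_bound[of 1 "max 0 t"] by simp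
    also have "\<dots> \<le> (1 + (max 0 t)\<^sup>2)\<^sup>2" by (simp add: power2_eq_square[of "1 + _"] add_pos_nonneg)
    finally show ?thesis using pos[of t] by (simp add: cutoff'_def divide_le_eq)
  qed
  show "s > 0 \<Longrightarrow> 0 < cutoff s" by (simp add: cutoff_def add_pos_nonneg)
  show "cutoff s \<le> cutoff t" if "0 < s" "s \<le> t"
  proof -
    have "s\<^sup>2 \<le> t\<^sup>2" using that by (intro power_mono) auto
    then show ?thesis using that by (simp add: cutoff_def frac_le_eq divide_simps add_pos_nonneg) (simp add: field_simps)
  qed
qed

text \<open>Let \<open>m\<^sub>n\<close> be a smooth minimum of \<open>sqrt (\<parallel>x - c\<^sub>i\<parallel>\<^sup>2 + d\<^sup>2) - 2 d\<close> over \<open>i \<le> n\<close>. It is negative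
  at distance less than \<open>d\<close> from one of the \<open>c\<^sub>i\<close> and at least \<open>d / 2\<close> at distance \<open>3 d\<close> from all of
  them, and \<open>cutoff \<circ> m\<^sub>n\<close> is the required function. What matters is that the bound on the gradients does
  not depend on \<open>n\<close>, while at each point the gradients vanish for large \<open>n\<close>: this is a situation for
  dominated convergence. A product of cut-off functions of single balls has no such bound.\<close>

lemma ball_cutoffs:
  fixes c :: "nat \<Rightarrow> 'a::real_inner"
  assumes dense: "\<And>x e. e > 0 \<Longrightarrow> \<exists>i. dist x (c i) < e" and d: "d > 0"
  obtains w :: "nat \<Rightarrow> 'a \<Rightarrow> real" and \<kappa> where "\<kappa> > 0" "\<And>n. w n \<in> C1b" "\<And>n x. 0 \<le> w n x" "\<And>n x. w n x \<le> 1"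
    "\<And>n x. norm (grad (w n) x) \<le> 1"
    "\<And>n x. (\<forall>i\<le>n. dist x (c i) \<ge> 3 * d) \<Longrightarrow> w n x \<ge> \<kappa>"
    "\<And>x. \<forall>\<^sub>F n in sequentially. w n x = 0 \<and> grad (w n) x = 0"
proof -
  define f where "f i x = sqrt ((norm (x - c i))\<^sup>2 + d\<^sup>2) - 2 * d" for i x
  have f: "slope1 (f i)" for i unfolding f_def[abs_def] by (rule slope1_distance[OF d])
  have "\<forall>n. \<exists>m. slope1 m \<and> (\<forall>x. (\<forall>i\<le>n::nat. m x \<le> f i x) \<and> (\<exists>i\<le>n. f i x - d / 2 \<le> m x))"
    using slope1_finite_min[of f, OF f] d by simp
  then obtain m where m: "\<And>n. slope1 (m n)" "\<And>n i x. i \<le> n \<Longrightarrow> m n x \<le> f i x"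
    "\<And>n x. \<exists>i\<le>n. f i x - d / 2 \<le> m n x" by metis
  have "\<forall>n. \<exists>D. (\<forall>x. GDERIV (m n) x :> D x) \<and> continuous_on UNIV D \<and> (\<forall>x. norm (D x) \<le> 1)"
    using m(1) unfolding slope1_def by blast
  then obtain D where D: "\<And>n x. GDERIV (m n) x :> D n x" "\<And>n. continuous_on UNIV (D n)" "\<And>n x. norm (D n x) \<le> 1"
    by metis
  define w where "w n x = cutoff (m n x)" for n x
  have n1: "norm (cutoff' (m n x) *\<^sub>R D n x) \<le> 1" for n x
    using mult_mono[OF cutoff_facts(5)[of "m n x"] D(3)[of n x]] by simp
  have C: "w n \<in> C1b \<and> grad (w n) = (\<lambda>x. cutoff' (m n x) *\<^sub>R D n x)" for n
  proof -
    have "continuous_on UNIV (\<lambda>x. cutoff' (m n x))"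
      by (rule continuous_on_compose2[OF cutoff_facts(2) GDERIV_continuous_on[OF D(1)]]) auto
    then have cont: "continuous_on UNIV (\<lambda>x. cutoff' (m n x) *\<^sub>R D n x)"
      by (intro continuous_intros D(2))
    have der: "GDERIV (w n) x :> cutoff' (m n x) *\<^sub>R D n x" for x
      unfolding w_def[abs_def] by (rule GDERIV_DERIV_compose[OF D(1) cutoff_facts(1)])
    have "\<bar>w n x\<bar> \<le> 1" for x using cutoff_facts(3,4)[of "m n x"] by (simp add: w_def)
    then show ?thesis using C1bI[OF der cont _ n1] by blast
  qed
  show thesis
  proof
    show "cutoff (d / 2) > 0" using d by (intro cutoff_facts(8)) simp
    fix n x
    show "w n \<in> C1b" using C by blast
    show "0 \<le> w n x" "w n x \<le> 1" using cutoff_facts(3,4) by (simp_all add: w_def)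
    show "norm (grad (w n) x) \<le> 1" using C[of n] n1 by simp
    show "w n x \<ge> cutoff (d / 2)" if far: "\<forall>i\<le>n. dist x (c i) \<ge> 3 * d"
    proof -
      obtain i where i: "i \<le> n" "f i x - d / 2 \<le> m n x" using m(3) by blast
      have "3 * d \<le> norm (x - c i)" using far i(1) by (simp add: dist_norm)
      also have "\<dots> \<le> sqrt ((norm (x - c i))\<^sup>2 + d\<^sup>2)" by (rule real_le_rsqrt) simp
      finally have "d / 2 \<le> m n x" using i(2) by (simp add: f_def)
      then show ?thesis unfolding w_def using d by (intro cutoff_facts(9)) auto
    qed
  next
    fix x
    obtain i where i: "dist x (c i) < d" using dense[OF d] by blast
    have "(norm (x - c i))\<^sup>2 + d\<^sup>2 \<le> d\<^sup>2 + d\<^sup>2"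
      using i d by (intro add_mono power_mono) (auto simp: dist_norm)
    also have "\<dots> \<le> (2 * d)\<^sup>2" by (simp add: power_mult_distrib)
    finally have "f i x \<le> 0" using d unfolding f_def by (simp add: real_le_lsqrt)
    then have "m n x \<le> 0" if "i \<le> n" for n using m(2)[OF that, of x] by linarith
    then have "w n x = 0 \<and> grad (w n) x = 0" if "i \<le> n" for n
      using that C[of n] by (simp add: w_def cutoff_facts(6,7))
    then show "\<forall>\<^sub>F n in sequentially. w n x = 0 \<and> grad (w n) x = 0"
      unfolding eventually_sequentially by blast
  qed
qed

section \<open>Compact sets as intersections of closed, increasingly finely coverable sets\<close>

text \<open>The sets \<open>C k\<close> need not be decreasing. If points \<open>y n\<close> of \<open>C 0 \<inter> \<dots> \<inter> C n\<close> outside \<open>V\<close>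
  existed for all \<open>n\<close>, then all but finitely many of them would lie in a given \<open>C k\<close>, so they would be
  totally bounded and have a limit point, which would lie in the intersection but not in \<open>V\<close>.\<close>

lemma compact_Inter_totally_bounded:
  fixes C :: "nat \<Rightarrow> 'a::complete_space set"
  assumes closed: "\<And>k. closed (C k)"
    and tot: "\<And>e. e > 0 \<Longrightarrow> \<exists>k F. finite F \<and> C k \<subseteq> (\<Union>x\<in>F. ball x e)"
  shows "compact (\<Inter>k. C k)"
    and "open V \<Longrightarrow> (\<Inter>k. C k) \<subseteq> V \<Longrightarrow> \<exists>n. (\<Inter>k\<le>n. C k) \<subseteq> V"
proof -
  show "compact (\<Inter>k. C k)"
    unfolding compact_eq_totally_bounded
  proof (intro conjI allI impI)
    show "Topological_Spaces.complete (\<Inter>k. C k)" using closed by (simp add: complete_eq_closed closed_INT)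
    show "\<exists>F. finite F \<and> (\<Inter>k. C k) \<subseteq> (\<Union>x\<in>F. ball x e)" if "e > 0" for e
      using tot[OF that] by (meson INT_lower UNIV_I order_trans)
  qed
  assume V: "open V" "(\<Inter>k. C k) \<subseteq> V"
  show "\<exists>n. (\<Inter>k\<le>n. C k) \<subseteq> V"
  proof (rule ccontr)
    assume "\<not> ?thesis"
    then have "\<forall>n. \<exists>y. y \<in> (\<Inter>k\<le>n. C k) - V" by blast
    then obtain y where y: "\<And>n k. k \<le> n \<Longrightarrow> y n \<in> C k" "\<And>n. y n \<notin> V"
      by (metis DiffD1 DiffD2 INT_D atMost_iff)
    have "compact (closure (range y))"
      unfolding compact_eq_totally_bounded
    proof (intro conjI allI impI)
      show "Topological_Spaces.complete (closure (range y))" by (simp add: complete_eq_closed)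
      fix e :: real assume e: "e > 0"
      obtain k F where F: "finite F" "C k \<subseteq> (\<Union>x\<in>F. ball x (e/2))" using tot[of "e/2"] e by auto
      have "range y \<subseteq> (\<Union>x\<in>F \<union> y ` {..<k}. ball x (e/2))"
      proof
        fix z assume "z \<in> range y"
        then obtain n where n: "z = y n" by blast
        show "z \<in> (\<Union>x\<in>F \<union> y ` {..<k}. ball x (e/2))"
        proof (cases "n < k")
          case True
          then have "z \<in> ball (y n) (e/2)" using n e by simp
          then show ?thesis using True by blast
        next
          case False
          then have "z \<in> C k" using n y(1)[of k n] by simp
          then show ?thesis using F(2) by blast
        qed
      qed
      also have "\<dots> \<subseteq> (\<Union>x\<in>F \<union> y ` {..<k}. cball x (e/2))" using ball_subset_cball by blast
      finally have "closure (range y) \<subseteq> (\<Union>x\<in>F \<union> y ` {..<k}. cball x (e/2))"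
        using F(1) by (intro closure_minimal) auto
      also have "\<dots> \<subseteq> (\<Union>x\<in>F \<union> y ` {..<k}. ball x e)" using e by (intro UN_mono) auto
      finally show "\<exists>F. finite F \<and> closure (range y) \<subseteq> (\<Union>x\<in>F. ball x e)"
        using F(1) by (intro exI[of _ "F \<union> y ` {..<k}"]) auto
    qed
    then obtain l s where s: "strict_mono s" "(y \<circ> s) \<longlonglongrightarrow> l"
      unfolding compact_def using closure_subset[of "range y"] by (metis rangeI subset_iff)
    have "l \<in> C k" for k
    proof (rule Lim_in_closed_set[OF closed _ _ s(2)])
      have "(y \<circ> s) n \<in> C k" if "k \<le> n" for n
        using y(1)[OF order_trans[OF that seq_suble[OF s(1)]]] by simp
      then show "\<forall>\<^sub>F n in sequentially. (y \<circ> s) n \<in> C k"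
        unfolding eventually_sequentially by blast
    qed simp
    then have "l \<in> V" using V(2) by blast
    moreover have "l \<in> - V"
      by (rule Lim_in_closed_set[OF closed_Compl[OF V(1)] always_eventually sequentially_bot s(2)])
         (simp add: y(2))
    ultimately show False by blast
  qed
qed

section \<open>Uniform approximation on compact sets by functions of class \<open>C\<^sub>b\<^sup>1\<close>\<close>

lemma abs_arctan_diff_le: "\<bar>arctan a - arctan b\<bar> \<le> \<bar>a - b\<bar>"
proof -
  have "norm (arctan a - arctan b) \<le> 1 * norm (a - b)"
  proof (rule field_differentiable_bound[where S=UNIV and f'="\<lambda>x. inverse (1 + x\<^sup>2)"])
    fix x :: real
    show "(arctan has_field_derivative inverse (1 + x\<^sup>2)) (at x within UNIV)"
      using DERIV_arctan[of x] by simp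
    show "norm (inverse (1 + x\<^sup>2)) \<le> 1"
      by (simp add: inverse_le_1_iff add_pos_nonneg)
  qed auto
  then show ?thesis by simp
qed

lemma C1b_arctan:
  assumes "u \<in> C1b"
  shows "(\<lambda>x. arctan (u x)) \<in> C1b"
proof (rule C1b_compose[OF assms DERIV_arctan])
  have "1 + x\<^sup>2 \<noteq> 0" for x :: real by (metis add_pos_nonneg less_irrefl zero_le_power2 zero_less_one)
  then show "continuous_on UNIV (\<lambda>x::real. inverse (1 + x\<^sup>2))"
    by (intro continuous_intros) auto
qed

lemma C1b_cmult: "u \<in> C1b \<Longrightarrow> (\<lambda>x. c * u x) \<in> C1b"
  by (rule C1b_mult[OF C1b_const])

lemma C1b_sum: "(\<And>i. i \<in> I \<Longrightarrow> u i \<in> C1b) \<Longrightarrow> (\<lambda>x. \<Sum>i\<in>I. u i x) \<in> C1b"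
  by (induction I rule: infinite_finite_induct) (auto intro: C1b_add C1b_const)

text \<open>The function \<open>z \<mapsto> arctan \<langle>z, x - y\<rangle>\<close> does it.\<close>

lemma C1b_separates_points:
  fixes x y :: "'a::real_inner"
  assumes "x \<noteq> y"
  shows "\<exists>f\<in>C1b. f x \<noteq> f y"
proof -
  define f where "f z = arctan (z \<bullet> (x - y))" for z
  define D where "D z = inverse (1 + (z \<bullet> (x - y))\<^sup>2) *\<^sub>R (x - y)" for z
  have "GDERIV (\<lambda>z. z \<bullet> (x - y)) z :> x - y" for z
    unfolding gderiv_def by (auto intro!: derivative_eq_intros)
  then have 1: "GDERIV f z :> D z" for z
    unfolding f_def[abs_def] D_def by (rule GDERIV_DERIV_compose[OF _ DERIV_arctan])
  have nz: "1 + t\<^sup>2 \<noteq> 0" for t :: real by (metis add_pos_nonneg less_irrefl zero_le_power2 zero_less_one)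
  have 2: "continuous_on UNIV D"
    unfolding D_def[abs_def] using nz by (intro continuous_intros) auto
  have 3: "\<bar>f z\<bar> \<le> pi / 2" for z
    using arctan_bounded[of "z \<bullet> (x - y)"] unfolding f_def by linarith
  have 4: "norm (D z) \<le> norm (x - y)" for z
    unfolding D_def norm_scaleR
    by (rule mult_left_le_one_le) (auto simp: inverse_le_1_iff add_pos_nonneg)
  have "f \<in> C1b" by (rule C1bI(1)[OF 1 2 3 4])
  moreover have "f x \<noteq> f y"
  proof
    assume "f x = f y"
    then have "x \<bullet> (x - y) = y \<bullet> (x - y)" by (simp add: f_def arctan_eq_iff)
    then have "(x - y) \<bullet> (x - y) = 0" by (simp add: inner_diff_left)
    then show False using assms by simp
  qed
  ultimately show ?thesis by blast
qed

text \<open>Stone--Weierstrass on the compact set for \<open>tan f\<close>, followed by \<open>arctan\<close>, which keeps the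
  approximation bounded on the whole space by a constant that does not depend on the compact set.\<close>

lemma C1b_approximation_on_compact:
  fixes f :: "'a::real_inner \<Rightarrow> real"
  assumes K: "compact K" and f: "f \<in> bcontfun" "\<And>x. \<bar>f x\<bar> \<le> 1" and e: "e > 0"
  shows "\<exists>u\<in>C1b. (\<forall>x\<in>K. \<bar>f x - u x\<bar> < e) \<and> (\<forall>x. \<bar>u x\<bar> \<le> 2)"
proof -
  have pi: "1 < pi / 2" using pi_gt3 by simp
  interpret function_ring_on "C1b :: ('a \<Rightarrow> real) set" K
  proof
    show "continuous_on K u" if "u \<in> C1b" for u :: "'a \<Rightarrow> real"
      using bcontfun_continuous[OF C1b_bcontfun[OF that]] continuous_on_subset by blast
  qed (auto intro: K C1b_add C1b_mult C1b_const C1b_separates_points)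
  have cos: "cos (f x) \<noteq> 0" for x
    using f(2)[of x] pi cos_gt_zero_pi[of "f x"] by (auto simp: abs_le_iff)
  have "continuous_on UNIV (\<lambda>x. tan (f x))"
    unfolding tan_def
    by (intro continuous_on_divide continuous_on_sin continuous_on_cos bcontfun_continuous[OF f(1)])
       (use cos in auto)
  then have "continuous_on K (\<lambda>x. tan (f x))" by (rule continuous_on_subset) simp
  then obtain u where u: "u \<in> C1b" "\<And>x. x \<in> K \<Longrightarrow> \<bar>tan (f x) - u x\<bar> < e"
    using Stone_Weierstrass_basic[OF _ e] by blast
  have at: "arctan (tan (f x)) = f x" for x
    using f(2)[of x] pi by (intro arctan_tan) (auto simp: abs_le_iff)
  have "\<bar>f x - arctan (u x)\<bar> < e" if "x \<in> K" for x
    using abs_arctan_diff_le[of "tan (f x)" "u x"] u(2)[OF that] at[of x] by simp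
  moreover have "\<bar>arctan (u x)\<bar> \<le> 2" for x
    using arctan_bounded[of "u x"] pi_less_4 by linarith
  ultimately show ?thesis by (intro bexI[OF _ C1b_arctan[OF u(1)]]) auto
qed

lemma dense_sequence:
  obtains c :: "nat \<Rightarrow> 'a::polish_space" where "\<And>x e. e > 0 \<Longrightarrow> \<exists>i. dist x (c i) < e"
proof -
  obtain S :: "'a set" where S: "countable S" "\<And>X. open X \<Longrightarrow> X \<noteq> {} \<Longrightarrow> \<exists>d\<in>S. d \<in> X"
    using countable_dense_exists[where 'a='a] by blast
  have ne: "S \<noteq> {}" using S(2)[of UNIV] by auto
  show thesis
  proof
    fix x :: 'a and e :: real assume "e > 0"
    then obtain d where "d \<in> S" "d \<in> ball x e" using S(2)[of "ball x e"] by auto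
    then show "\<exists>i. dist x (from_nat_into S i) < e"
      using from_nat_into_surj[OF S(1)] by (metis mem_ball)
  qed
qed

section \<open>Existence of the surface measures\<close>

context level_set
begin

lemma integrable_sublevel: 
  fixes B :: "'a \<Rightarrow> real"
  assumes "integrable \<nu> B"
  shows "integrable \<nu> (\<lambda>x. indicator {x. g x \<le> s} x * B x)"
  using integrable_mult_indicator[OF sublevel_sets(1) assms] by simp

lemma dlevel_add:
  assumes "dlevel r B D" "dlevel r B' D'" "integrable \<nu> B" "integrable \<nu> B'"
  shows "dlevel r (\<lambda>x. B x + B' x) (D + D')"
proof -
  have "(LINT x:{x. g x \<le> s}|\<nu>. B x + B' x)
      = (LINT x:{x. g x \<le> s}|\<nu>. B x) + (LINT x:{x. g x \<le> s}|\<nu>. B' x)" for s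
    using integrable_sublevel assms(3,4) unfolding set_lebesgue_integral_def
    by (simp add: distrib_left)
  then show ?thesis using DERIV_add[OF assms(1,2)[unfolded dlevel_def]] unfolding dlevel_def by simp
qed

lemma dlevel_cmult:
  assumes "dlevel r B D"
  shows "dlevel r (\<lambda>x. c * B x) (c * D)"
  using DERIV_cmult[OF assms[unfolded dlevel_def], of c] unfolding dlevel_def
  by (simp add: set_integral_mult_right)

lemma dlevel_diff:
  assumes "dlevel r B D" "dlevel r B' D'" "integrable \<nu> B" "integrable \<nu> B'"
  shows "dlevel r (\<lambda>x. B x - B' x) (D - D')"
  using dlevel_add[OF assms(1) dlevel_cmult[OF assms(2), of "-1"]] assms(3,4) by simp

lemma dlevel_sum:
  assumes "finite I" "\<And>i. i \<in> I \<Longrightarrow> dlevel r (B i) (D i)" "\<And>i. i \<in> I \<Longrightarrow> integrable \<nu> (B i)"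
  shows "dlevel r (\<lambda>x. \<Sum>i\<in>I. B i x) (\<Sum>i\<in>I. D i)"
  using assms
proof (induction I rule: finite_induct)
  case empty
  then show ?case by (simp add: dlevel_def set_lebesgue_integral_def)
next
  case (insert i I)
  then show ?case by (simp add: dlevel_add)
qed

lemma sublevel_diff:
  fixes B :: "'a \<Rightarrow> real"
  assumes "integrable \<nu> B" "a \<le> b"
  shows "(LINT x:{x. g x \<le> b}|\<nu>. B x) - (LINT x:{x. g x \<le> a}|\<nu>. B x)
     = (LINT x|\<nu>. indicator {x. a < g x \<and> g x \<le> b} x * B x)"
    "integrable \<nu> (\<lambda>x. indicator {x. a < g x \<and> g x \<le> b} x * B x)"
proof -
  have eq: "indicator {x. a < g x \<and> g x \<le> b} x * B x
      = indicator {x. g x \<le> b} x * B x - indicator {x. g x \<le> a} x * B x" for x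
    using assms(2) by (auto simp: indicator_def)
  show "integrable \<nu> (\<lambda>x. indicator {x. a < g x \<and> g x \<le> b} x * B x)"
    unfolding eq using integrable_sublevel[OF assms(1)] by simp
  show "(LINT x:{x. g x \<le> b}|\<nu>. B x) - (LINT x:{x. g x \<le> a}|\<nu>. B x)
     = (LINT x|\<nu>. indicator {x. a < g x \<and> g x \<le> b} x * B x)"
    unfolding eq set_lebesgue_integral_def using integrable_sublevel[OF assms(1)] by simp
qed

text \<open>Only the values of the functions on the thin layers \<open>{r < g \<le> r + h}\<close> matter.\<close>

lemma dlevel_mono:
  assumes D: "dlevel r B D" "dlevel r B' D'" and int: "integrable \<nu> B" "integrable \<nu> B'" and h: "h > 0"
    and le: "AE x in \<nu>. r < g x \<and> g x \<le> r + h \<longrightarrow> B x \<le> B' x"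
  shows "D \<le> D'"
proof -
  let ?f = "\<lambda>B s. LINT x:{x. g x \<le> s}|\<nu>. B x"
  have lim: "((\<lambda>y. (?f C y - ?f C r) / (y - r)) \<longlongrightarrow> E) (at_right r)" if "dlevel r C E" for C E
    using that unfolding dlevel_def has_field_derivative_iff
    by (rule filterlim_mono) (auto simp: at_le)
  have "\<forall>\<^sub>F y in at_right r. (?f B y - ?f B r) / (y - r) \<le> (?f B' y - ?f B' r) / (y - r)"
    unfolding eventually_at_right[OF less_add_same_cancel1[THEN iffD2, OF h]]
  proof (intro exI[of _ "r + h"] conjI allI impI)
    fix y assume y: "r < y" "y < r + h"
    have "?f B y - ?f B r \<le> ?f B' y - ?f B' r"
      unfolding sublevel_diff(1)[OF int(1) less_imp_le[OF y(1)]] sublevel_diff(1)[OF int(2) less_imp_le[OF y(1)]]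
    proof (rule integral_mono_AE)
      show "AE x in \<nu>. indicator {x. r < g x \<and> g x \<le> y} x * B x \<le> indicator {x. r < g x \<and> g x \<le> y} x * B' x"
        using le by eventually_elim (use y in \<open>auto simp: indicator_def\<close>)
    qed (rule sublevel_diff(2) int less_imp_le[OF y(1)])+
    then show "(?f B y - ?f B r) / (y - r) \<le> (?f B' y - ?f B' r) / (y - r)"
      using y by (intro divide_right_mono) auto
  qed (use h in simp)
  then show ?thesis
    by (rule tendsto_le[OF _ lim[OF D(2)] lim[OF D(1)], rotated]) simp
qed

lemma dlevel_nonneg:
  assumes "dlevel r B D" "integrable \<nu> B" "AE x in \<nu>. B x \<ge> 0"
  shows "D \<ge> 0"
  by (rule dlevel_mono[where B="\<lambda>_. 0" and h=1, OF _ assms(1) _ assms(2)])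
     (use assms(3) in \<open>auto simp: dlevel_def set_lebesgue_integral_def\<close>)

text \<open>The hypothesis makes the difference quotients of \<open>B\<close> at \<open>r\<close> a Cauchy filter: they differ from
  those of \<open>\<psi>\<close> by at most those of \<open>w\<close>, because the integrals of \<open>w - (B - \<psi>)\<close> and of
  \<open>w + (B - \<psi>)\<close> over sublevel sets are nondecreasing.\<close>

lemma dlevel_sandwich:
  assumes B: "integrable \<nu> B"
    and ex: "\<And>e. e > 0 \<Longrightarrow> \<exists>\<psi> w D E. dlevel r \<psi> D \<and> dlevel r w E \<and> integrable \<nu> \<psi> \<and> integrable \<nu> w \<and>
        (\<forall>x. \<bar>B x - \<psi> x\<bar> \<le> w x) \<and> E < e"
  shows "\<exists>D. dlevel r B D"
proof -
  let ?f = "\<lambda>B s. LINT x:{x. g x \<le> s}|\<nu>. B x"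
  let ?q = "\<lambda>B y. (?f B y - ?f B r) / (y - r)"
  have quot_nonneg: "0 \<le> ?q C y" if C: "integrable \<nu> C" "\<And>x. 0 \<le> C x" for C y
  proof -
    have mono: "?f C a \<le> ?f C b" if "a \<le> b" for a b
    proof -
      have "0 \<le> ?f C b - ?f C a"
        unfolding sublevel_diff(1)[OF C(1) that] using C(2) by (intro Bochner_Integration.integral_nonneg) simp
      then show ?thesis by simp
    qed
    show ?thesis
      using mono[of r y] mono[of y r] by (cases "r \<le> y") (simp_all add: divide_nonpos_nonpos)
  qed
  have "cauchy_filter (filtermap (?q B) (at r))"
    unfolding cauchy_filter_metric_filtermap
  proof (intro allI impI)
    fix e :: real assume e: "e > 0"
    obtain \<psi> w D E where D: "dlevel r \<psi> D" "dlevel r w E" and int: "integrable \<nu> \<psi>" "integrable \<nu> w"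
      and le: "\<And>x. \<bar>B x - \<psi> x\<bar> \<le> w x" and E: "E < e / 4"
      using ex[of "e / 4"] e by auto
    have lin: "?f (\<lambda>x. w x + c * (B x - \<psi> x)) t = ?f w t + c * (?f B t - ?f \<psi> t)" for c t
    proof -
      let ?I = "indicat_real {x. g x \<le> t}"
      have "?I x * (w x + c * (B x - \<psi> x)) = ?I x * w x + c * (?I x * B x - ?I x * \<psi> x)" for x
        by (simp add: algebra_simps)
      then show ?thesis
        using int[THEN integrable_sublevel, of t] integrable_sublevel[OF B, of t]
        unfolding set_lebesgue_integral_def by simp
    qed
    have quot: "\<bar>?q B y - ?q \<psi> y\<bar> \<le> ?q w y" for y
    proof -
      have "0 \<le> ?q w y + c * (?q B y - ?q \<psi> y)" if "\<bar>c\<bar> = 1" for c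
      proof -
        have "0 \<le> ?q (\<lambda>x. w x + c * (B x - \<psi> x)) y"
        proof (rule quot_nonneg)
          show "0 \<le> w x + c * (B x - \<psi> x)" for x
            using le[of x] abs_le_D2[of "c * (B x - \<psi> x)" "w x"] that by (simp add: abs_mult)
        qed (use B int in simp)
        then show ?thesis
          unfolding lin by (simp add: diff_divide_distrib add_divide_distrib right_diff_distrib)
      qed
      from this[of 1] this[of "-1"] show ?thesis by simp
    qed
    have "\<forall>\<^sub>F y in at r. dist (?q \<psi> y) D < e / 4"
      using D(1) e unfolding dlevel_def has_field_derivative_iff by (intro tendstoD) auto
    moreover have "\<forall>\<^sub>F y in at r. ?q w y < e / 4"
      using D(2) E unfolding dlevel_def has_field_derivative_iff by (rule order_tendstoD(2))
    ultimately have ev: "\<forall>\<^sub>F y in at r. dist (?q B y) D < e / 2"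
    proof eventually_elim
      case (elim y)
      then show ?case using quot[of y] unfolding dist_real_def by linarith
    qed
    show "\<exists>P. eventually P (at r) \<and> (\<forall>x y. P x \<and> P y \<longrightarrow> dist (?q B x) (?q B y) < e)"
      using ev by (intro exI[of _ "\<lambda>y. dist (?q B y) D < e / 2"]) (blast intro: dist_triangle_half_l)
  qed
  then obtain D where "filtermap (?q B) (at r) \<le> nhds D"
    using cauchy_filter_complete_converges[OF _ complete_UNIV, of "filtermap (?q B) (at r)"]
    by (auto simp: filtermap_bot_iff)
  then show ?thesis unfolding dlevel_def has_field_derivative_iff filterlim_def by blast
qed

lemma dlevel_C1b:
  assumes "u \<in> C1b"
  shows "\<exists>D. dlevel r u D"
proof -
  obtain v where "\<And>f G r. closure_graph \<nu> R 2 f G \<Longrightarrow> dlevel r f (LINT x:{x. g x > r}|\<nu>. f x * v x - G x \<bullet> Psi x)"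
    by (rule sobolev_derivative[of 2]) auto
  then show ?thesis using closure_graph_C1b[OF assms, of 2] by auto
qed

lemma C1b_integrable: "u \<in> C1b \<Longrightarrow> integrable \<nu> u"
  by (rule bcontfun_integrable[OF C1b_bcontfun])

text \<open>Dominated convergence in the formula of \<open>sobolev_derivative\<close>. The convergence of the
  gradients gives the conclusion at each single \<open>r\<close>, not just on average over \<open>r\<close>.\<close>

lemma dlevel_tendsto_zero:
  assumes u: "\<And>n. u n \<in> C1b" "\<And>n x. \<bar>u n x\<bar> \<le> 1" "\<And>n x. norm (grad (u n) x) \<le> 1"
    and lim: "\<And>x. \<forall>\<^sub>F n in sequentially. u n x = 0 \<and> grad (u n) x = 0"
    and D: "\<And>n. dlevel r (u n) (D n)"
  shows "D \<longlonglongrightarrow> 0"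
proof -
  have two: "(2::real) > 1" by simp
  obtain v where v: "v \<in> Lp (2 / (2 - 1)) \<nu>" "Psi \<in> Lp (2 / (2 - 1)) \<nu>"
    "\<And>f G r. closure_graph \<nu> R 2 f G \<Longrightarrow> dlevel r f (LINT x:{x. g x > r}|\<nu>. f x * v x - G x \<bullet> Psi x)"
    by (blast intro: sobolev_derivative[OF two])
  have D': "D n = (LINT x:{x. g x > r}|\<nu>. u n x * v x - R (grad (u n) x) \<bullet> Psi x)" for n
    using D[of n] v(3)[OF closure_graph_C1b[OF u(1)[of n], of 2]] by (auto dest: dlevel_unique)
  obtain K where K: "\<And>x. norm (R x) \<le> norm x * K" "K \<ge> 0"
    using bounded_linear.nonneg_bounded[OF R] by blast
  have int: "integrable \<nu> (\<lambda>x. \<bar>v x\<bar>)" "integrable \<nu> (\<lambda>x. norm (Psi x))"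
    using Lp_integrable[OF Lp_mono_exponent[OF finite_measure v(1), of 1]]
      Lp_integrable[OF Lp_mono_exponent[OF finite_measure v(2), of 1]] by auto
  note [measurable] = Lp_measurable[OF v(1)] Lp_measurable[OF v(2)] C1b_measurable[OF u(1)]
  have [measurable]: "(\<lambda>x. R (grad (u n) x)) \<in> borel_measurable \<nu>" for n
    by (rule Lp_measurable[OF C1b_Lp(2)[OF u(1), of 1]]) simp
  have "(\<lambda>n. LINT x|\<nu>. indicator {x. g x > r} x *\<^sub>R (u n x * v x - R (grad (u n) x) \<bullet> Psi x)) \<longlonglongrightarrow> (LINT x|\<nu>. 0)"
  proof (rule integral_dominated_convergence[where w="\<lambda>x. \<bar>v x\<bar> + K * norm (Psi x)"])
    show "integrable \<nu> (\<lambda>x. \<bar>v x\<bar> + K * norm (Psi x))" using int by simp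
    have "\<forall>\<^sub>F n in sequentially. indicator {x. g x > r} x *\<^sub>R (u n x * v x - R (grad (u n) x) \<bullet> Psi x) = 0" for x
      using lim[of x]
      by eventually_elim (use R in \<open>simp add: linear_0 bounded_linear.linear\<close>)
    then show "AE x in \<nu>. (\<lambda>n. indicator {x. g x > r} x *\<^sub>R (u n x * v x - R (grad (u n) x) \<bullet> Psi x)) \<longlonglongrightarrow> 0"
      by (intro AE_I2 tendsto_eventually)
    have "norm (u n x * v x - R (grad (u n) x) \<bullet> Psi x) \<le> \<bar>v x\<bar> + K * norm (Psi x)" for n x
    proof -
      have "\<bar>u n x * v x\<bar> \<le> \<bar>v x\<bar>"
        using u(2)[of n x] by (simp add: abs_mult mult_left_le_one_le)
      moreover have "\<bar>R (grad (u n) x) \<bullet> Psi x\<bar> \<le> K * norm (Psi x)"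
      proof -
        have "norm (R (grad (u n) x)) \<le> K"
          using K(1)[of "grad (u n) x"] mult_right_mono[OF u(3)[of n x] K(2)] by simp
        then show ?thesis
          using Cauchy_Schwarz_ineq2[of "R (grad (u n) x)" "Psi x"] mult_right_mono[OF _ norm_ge_zero] order_trans
          by blast
      qed
      ultimately show ?thesis unfolding real_norm_def by linarith
    qed
    then show "AE x in \<nu>. norm (indicator {x. g x > r} x *\<^sub>R (u n x * v x - R (grad (u n) x) \<bullet> Psi x))
        \<le> \<bar>v x\<bar> + K * norm (Psi x)" for n
      using K(2) by (intro AE_I2) (auto simp: indicator_def)
  qed measurable
  then show ?thesis unfolding D' set_lebesgue_integral_def by simp
qed

text \<open>For each radius, \<open>ball_cutoffs\<close> and \<open>dlevel_tendsto_zero\<close> provide finitely many balls outside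
  which the functional is small. The intersection of such finite unions over a sequence of radii is
  compact, and each of its neighbourhoods contains the intersection of finitely many of them.\<close>

lemma dlevel_tight:
  assumes eta: "\<eta> > 0"
  shows "\<exists>K. compact K \<and> (\<forall>V. open V \<longrightarrow> K \<subseteq> V \<longrightarrow>
     (\<exists>u D. u \<in> C1b \<and> dlevel r u D \<and> (\<forall>x. 0 \<le> u x) \<and> (\<forall>x. x \<notin> V \<longrightarrow> 1 \<le> u x) \<and> D < \<eta>))"
proof -
  obtain c :: "nat \<Rightarrow> 'a" where c: "\<And>x e. e > 0 \<Longrightarrow> \<exists>i. dist x (c i) < e"
    by (blast intro: dense_sequence)
  define d where "d k = inverse (real (Suc k))" for k
  have d: "d k > 0" for k by (simp add: d_def)
  have scale: "\<forall>k. \<exists>n u D. u \<in> C1b \<and> dlevel r u D \<and> (\<forall>x. 0 \<le> u x) \<and>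
      (\<forall>x. (\<forall>i\<le>n::nat. dist x (c i) \<ge> 3 * d k) \<longrightarrow> 1 \<le> u x) \<and> D < \<eta> * (1/2) ^ Suc k" (is "\<forall>k. ?P k")
  proof
    fix k
    show "?P k"
    proof (rule ball_cutoffs[of c "d k", OF c d])
      fix w :: "nat \<Rightarrow> 'a \<Rightarrow> real" and \<kappa> :: real
      assume w: "\<kappa> > 0" "\<And>n. w n \<in> C1b" "\<And>n x. 0 \<le> w n x" "\<And>n x. w n x \<le> 1"
        "\<And>n x. norm (grad (w n) x) \<le> 1"
        "\<And>n x. (\<forall>i\<le>n. dist x (c i) \<ge> 3 * d k) \<Longrightarrow> w n x \<ge> \<kappa>"
        "\<And>x. \<forall>\<^sub>F n in sequentially. w n x = 0 \<and> grad (w n) x = 0"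
      obtain D where D: "\<And>n. dlevel r (w n) (D n)" using dlevel_C1b[OF w(2)] by metis
      have "\<bar>w n x\<bar> \<le> 1" for n x using w(3,4) by (simp add: abs_of_nonneg)
      then have "D \<longlonglongrightarrow> 0" by (rule dlevel_tendsto_zero[OF w(2) _ w(5) w(7) D])
      moreover have "\<kappa> * (\<eta> * (1/2) ^ Suc k) > 0" using w(1) eta by simp
      ultimately have "\<forall>\<^sub>F n in sequentially. D n < \<kappa> * (\<eta> * (1/2) ^ Suc k)"
        by (rule order_tendstoD(2))
      then obtain n where n: "D n < \<kappa> * (\<eta> * (1/2) ^ Suc k)"
        unfolding eventually_sequentially by blast
      show ?thesis
      proof (intro exI conjI allI impI)
        show "(\<lambda>x. (1 / \<kappa>) * w n x) \<in> C1b" by (rule C1b_cmult[OF w(2)])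
        show "dlevel r (\<lambda>x. (1 / \<kappa>) * w n x) ((1 / \<kappa>) * D n)" by (rule dlevel_cmult[OF D])
        show "0 \<le> (1 / \<kappa>) * w n x" for x using w(1,3) by simp
        show "1 \<le> (1 / \<kappa>) * w n x" if "\<forall>i\<le>n. dist x (c i) \<ge> 3 * d k" for x
          using w(6)[OF that] w(1) by (simp add: le_divide_eq)
        show "(1 / \<kappa>) * D n < \<eta> * (1/2) ^ Suc k" using n w(1) by (simp add: divide_less_eq mult.commute)
      qed
    qed
  qed
  obtain n u D where *: "\<And>k. u k \<in> C1b \<and> dlevel r (u k) (D k) \<and> (\<forall>x. 0 \<le> u k x) \<and>
      (\<forall>x. (\<forall>i\<le>n k::nat. dist x (c i) \<ge> 3 * d k) \<longrightarrow> 1 \<le> u k x) \<and> D k < \<eta> * (1/2) ^ Suc k"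
    using scale unfolding choice_iff by blast
  have u: "u k \<in> C1b" "dlevel r (u k) (D k)" "0 \<le> u k x"
    "(\<forall>i\<le>n k. dist x (c i) \<ge> 3 * d k) \<Longrightarrow> 1 \<le> u k x" "D k < \<eta> * (1/2) ^ Suc k" for k x
    using *[of k] by blast+
  define C where "C k = (\<Union>i\<le>n k. cball (c i) (3 * d k))" for k
  have closed: "closed (C k)" for k unfolding C_def by (intro closed_UN) auto
  have tot: "\<exists>k F. finite F \<and> C k \<subseteq> (\<Union>x\<in>F. ball x e)" if "e > 0" for e
  proof -
    obtain k where "d k < e / 3" unfolding d_def using reals_Archimedean[of "e / 3"] \<open>e > 0\<close> by auto
    then have "cball (c i) (3 * d k) \<subseteq> ball (c i) e" for i by auto
    then have "C k \<subseteq> (\<Union>x\<in>c ` {..n k}. ball x e)" unfolding C_def by blast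
    then show ?thesis by (intro exI[of _ k] exI[of _ "c ` {..n k}"]) auto
  qed
  note K = compact_Inter_totally_bounded[of C, OF closed tot]
  have "\<exists>u D. u \<in> C1b \<and> dlevel r u D \<and> (\<forall>x. 0 \<le> u x) \<and> (\<forall>x. x \<notin> V \<longrightarrow> 1 \<le> u x) \<and> D < \<eta>"
    if V: "open V" "(\<Inter>k. C k) \<subseteq> V" for V
  proof -
    obtain m where m: "(\<Inter>k\<le>m. C k) \<subseteq> V" using K(2)[OF _ V] by blast
    show ?thesis
    proof (intro exI conjI allI impI)
      show "(\<lambda>x. \<Sum>k\<le>m. u k x) \<in> C1b" by (intro C1b_sum u(1))
      show "dlevel r (\<lambda>x. \<Sum>k\<le>m. u k x) (\<Sum>k\<le>m. D k)"
        by (intro dlevel_sum u(2) C1b_integrable u(1)) simp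
      show "0 \<le> (\<Sum>k\<le>m. u k x)" for x by (intro sum_nonneg u(3))
      show "1 \<le> (\<Sum>k\<le>m. u k x)" if "x \<notin> V" for x
      proof -
        obtain k where k: "k \<le> m" "x \<notin> C k" using m \<open>x \<notin> V\<close> by blast
        then have "1 \<le> u k x" by (intro u(4)) (auto simp: C_def dist_commute not_le less_imp_le)
        also have "\<dots> \<le> (\<Sum>k\<le>m. u k x)" using k(1) u(3) by (intro member_le_sum) auto
        finally show ?thesis .
      qed
      have half: "(\<lambda>k. \<eta> * (1/2) ^ Suc k) sums (\<eta> * 1)" by (intro sums_mult power_half_series)
      have "(\<Sum>k\<le>m. D k) < (\<Sum>k\<le>m. \<eta> * (1/2) ^ Suc k)"
        by (intro sum_strict_mono u(5)) auto
      also have "\<dots> \<le> (\<Sum>k. \<eta> * (1/2) ^ Suc k)"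
        using half eta by (intro sum_le_suminf) (auto simp: sums_iff)
      also have "\<dots> = \<eta>" using half by (simp add: sums_iff)
      finally show "(\<Sum>k\<le>m. D k) < \<eta>" .
    qed
  qed
  then show ?thesis using K(1) by blast
qed

text \<open>After scaling, the function is approximated uniformly on a large compact set, hence on one of
  its neighbourhoods \<open>V\<close>, by an element of \<open>C\<^sub>b\<^sup>1\<close> that is bounded by \<open>2\<close>. Off \<open>V\<close> the error is at
  most \<open>3\<close>, and the functional of a function above the indicator of the complement of \<open>V\<close> is small.\<close>

lemma dlevel_bcontfun:
  assumes f: "f \<in> bcontfun"
  shows "\<exists>D. dlevel r f D"
proof -
  obtain B where B: "\<And>x. \<bar>f x\<bar> \<le> B" "B \<ge> 0" using f by (blast intro: bcontfun_bounded)
  define C where "C = B + 1"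
  have C: "C > 0" "\<bar>f x\<bar> \<le> C" for x using B(1)[of x] B(2) by (auto simp: C_def)
  define h where "h x = (1 / C) * f x" for x
  have h: "h \<in> bcontfun" unfolding h_def by (rule bcontfun_cmult[OF f])
  have h1: "\<bar>h x\<bar> \<le> 1" for x using C by (simp add: h_def abs_mult divide_le_eq)
  obtain D1 where D1: "dlevel r (\<lambda>_. 1) D1" using dlevel_C1b[OF C1b_const] by blast
  have D1_nonneg: "D1 \<ge> 0" by (rule dlevel_nonneg[OF D1]) auto
  have "\<exists>D. dlevel r h D"
  proof (rule dlevel_sandwich)
    show "integrable \<nu> h" by (rule bcontfun_integrable[OF h])
    fix e :: real assume e: "e > 0"
    \<comment> \<open>The constant \<open>e1\<close> contributes \<open>e1 * D1 \<le> e / 2\<close>, the complement of \<open>V\<close> at most \<open>3 * (e / 6)\<close>.\<close>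
    define e1 where "e1 = e / (2 * (D1 + 1))"
    have e1: "e1 > 0" using e D1_nonneg by (simp add: e1_def)
    obtain K where K: "compact K" "\<And>V. open V \<Longrightarrow> K \<subseteq> V \<Longrightarrow>
       (\<exists>u D. u \<in> C1b \<and> dlevel r u D \<and> (\<forall>x. 0 \<le> u x) \<and> (\<forall>x. x \<notin> V \<longrightarrow> 1 \<le> u x) \<and> D < e / 6)"
      using dlevel_tight[of "e / 6" r] e by auto
    obtain \<psi> where \<psi>: "\<psi> \<in> C1b" "\<And>x. x \<in> K \<Longrightarrow> \<bar>h x - \<psi> x\<bar> < e1" "\<And>x. \<bar>\<psi> x\<bar> \<le> 2"
      using C1b_approximation_on_compact[OF K(1) h h1 e1] by blast
    obtain D where D: "dlevel r \<psi> D" using dlevel_C1b[OF \<psi>(1)] by blast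
    define V where "V = {x. \<bar>h x - \<psi> x\<bar> < e1}"
    have "open V" unfolding V_def
      by (intro open_Collect_less continuous_on_rabs continuous_on_diff continuous_on_const
          bcontfun_continuous[OF h] bcontfun_continuous[OF C1b_bcontfun[OF \<psi>(1)]])
    moreover have "K \<subseteq> V" using \<psi>(2) by (auto simp: V_def)
    ultimately obtain u E where u: "u \<in> C1b" "dlevel r u E" "\<And>x. 0 \<le> u x" "\<And>x. x \<notin> V \<Longrightarrow> 1 \<le> u x" "E < e / 6"
      using K(2)[of V] by blast
    show "\<exists>\<psi> w D E. dlevel r \<psi> D \<and> dlevel r w E \<and> integrable \<nu> \<psi> \<and> integrable \<nu> w \<and>
        (\<forall>x. \<bar>h x - \<psi> x\<bar> \<le> w x) \<and> E < e"
    proof (intro exI conjI allI)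
      show "dlevel r \<psi> D" by (rule D)
      show "integrable \<nu> \<psi>" by (rule C1b_integrable[OF \<psi>(1)])
      show "dlevel r (\<lambda>x. e1 * 1 + 3 * u x) (e1 * D1 + 3 * E)"
        by (intro dlevel_add dlevel_cmult D1 u(2)) (use C1b_integrable[OF u(1)] in auto)
      show "integrable \<nu> (\<lambda>x. e1 * 1 + 3 * u x)" using C1b_integrable[OF u(1)] by simp
      show "\<bar>h x - \<psi> x\<bar> \<le> e1 * 1 + 3 * u x" for x
      proof (cases "x \<in> V")
        case True
        then show ?thesis using u(3)[of x] by (simp add: V_def)
      next
        case False
        then show ?thesis using u(4)[OF False] h1[of x] \<psi>(3)[of x] e1 by linarith
      qed
      have "e1 * D1 \<le> e / 2"
        using e D1_nonneg by (simp add: e1_def field_simps)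
      then show "e1 * D1 + 3 * E < e" using u(5) by linarith
    qed
  qed
  then obtain D where "dlevel r h D" by blast
  from dlevel_cmult[OF this, of C] show ?thesis using C(1) by (auto simp: h_def)
qed

definition level_functional :: "real \<Rightarrow> ('a \<Rightarrow> real) \<Rightarrow> real" where
  "level_functional r f = (THE D. dlevel r f D)"

lemma level_functional: "f \<in> bcontfun \<Longrightarrow> dlevel r f (level_functional r f)"
  unfolding level_functional_def using dlevel_bcontfun dlevel_unique by (metis theI)

lemma level_functional_eq: "dlevel r f D \<Longrightarrow> level_functional r f = D"
  unfolding level_functional_def using dlevel_unique by blast

text \<open>Convergence along decreasing sequences: by Dini's theorem the functions are uniformly small on a
  compact set, hence on one of its neighbourhoods, and \<open>dlevel_tight\<close> controls the complement.\<close>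

lemma Daniell_functional_level: "Daniell_functional (level_functional r)"
proof
  let ?L = "level_functional r"
  show "?L (\<lambda>x. f x + h x) = ?L f + ?L h" if "f \<in> bcontfun" "h \<in> bcontfun" for f h
    using that by (intro level_functional_eq dlevel_add level_functional bcontfun_integrable)
  show "?L (\<lambda>x. c * f x) = c * ?L f" if "f \<in> bcontfun" for f c
    using that by (intro level_functional_eq dlevel_cmult level_functional)
  show "0 \<le> ?L f" if "f \<in> bcontfun" "\<And>x. f x \<ge> 0" for f
    using that by (intro dlevel_nonneg[OF level_functional bcontfun_integrable]) auto
  fix f :: "nat \<Rightarrow> 'a \<Rightarrow> real"
  assume f: "\<And>n. f n \<in> bcontfun" "\<And>n x. f (Suc n) x \<le> f n x" "\<And>x. (\<lambda>n. f n x) \<longlonglongrightarrow> 0"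
  have dec: "f n x \<le> f m x" if "m \<le> n" for m n x
    using decseqD[of "\<lambda>n. f n x" m n] f(2) that by (simp add: decseq_Suc_iff)
  have nonneg: "f n x \<ge> 0" for n x
    using decseq_ge[OF _ f(3)[of x], of n] f(2) by (simp add: decseq_Suc_iff)
  obtain B where B: "\<And>x. \<bar>f 0 x\<bar> \<le> B" "B \<ge> 0" using f(1)[of 0] by (blast intro: bcontfun_bounded)
  obtain D1 where D1: "dlevel r (\<lambda>_. 1) D1" using dlevel_C1b[OF C1b_const] by blast
  have D1_nonneg: "D1 \<ge> 0" by (rule dlevel_nonneg[OF D1]) auto
  show "(\<lambda>n. ?L (f n)) \<longlonglongrightarrow> 0"
  proof (rule LIMSEQ_I)
    fix e :: real assume e: "e > 0"
    define e1 where "e1 = e / (2 * (D1 + 1))"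
    have e1: "e1 > 0" using e D1_nonneg by (simp add: e1_def)
    have e2: "e / (2 * (B + 1)) > 0" using e B(2) by simp
    obtain K where K: "compact K" "\<And>V. open V \<Longrightarrow> K \<subseteq> V \<Longrightarrow>
       (\<exists>u D. u \<in> C1b \<and> dlevel r u D \<and> (\<forall>x. 0 \<le> u x) \<and> (\<forall>x. x \<notin> V \<longrightarrow> 1 \<le> u x) \<and> D < e / (2 * (B + 1)))"
      using dlevel_tight[OF e2, of r] by auto
    define V where "V n = {x. f n x < e1}" for n
    have V: "open (V n)" for n unfolding V_def
      by (intro open_Collect_less continuous_on_const bcontfun_continuous[OF f(1)])
    have "K \<subseteq> (\<Union>n. V n)"
    proof
      fix x
      have "\<forall>\<^sub>F n in sequentially. f n x < e1" by (rule order_tendstoD(2)[OF f(3) e1])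
      then show "x \<in> (\<Union>n. V n)" unfolding eventually_sequentially V_def by blast
    qed
    then obtain I where I: "finite I" "K \<subseteq> (\<Union>n\<in>I. V n)"
      using compactE_image[OF K(1), of UNIV V] V by auto
    obtain N where N: "\<forall>n\<in>I. n \<le> N" using I(1) unfolding finite_nat_set_iff_bounded_le ..
    have "V n \<subseteq> V N" if "n \<in> I" for n
    proof
      fix x assume "x \<in> V n"
      moreover have "f N x \<le> f n x" using N that by (intro dec) blast
      ultimately show "x \<in> V N" by (simp add: V_def)
    qed
    then have "K \<subseteq> V N" using I(2) by blast
    then obtain u E where u: "u \<in> C1b" "dlevel r u E" "\<And>x. 0 \<le> u x" "\<And>x. x \<notin> V N \<Longrightarrow> 1 \<le> u x"
      "E < e / (2 * (B + 1))"
      using K(2)[OF V] by blast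
    have "norm (?L (f n) - 0) < e" if "n \<ge> N" for n
    proof -
      have "?L (f n) \<le> e1 * D1 + B * E"
      proof (rule dlevel_mono[where h=1])
        show "dlevel r (f n) (?L (f n))" by (rule level_functional[OF f(1)])
        show "dlevel r (\<lambda>x. e1 * 1 + B * u x) (e1 * D1 + B * E)"
          by (intro dlevel_add dlevel_cmult D1 u(2)) (use C1b_integrable[OF u(1)] in auto)
        show "integrable \<nu> (f n)" by (rule bcontfun_integrable[OF f(1)])
        show "integrable \<nu> (\<lambda>x. e1 * 1 + B * u x)" using C1b_integrable[OF u(1)] by simp
        have "f n x \<le> e1 * 1 + B * u x" for x
        proof (cases "x \<in> V N")
          case True
          then have "f n x \<le> e1" using dec[OF that, of x] by (simp add: V_def)
          moreover have "0 \<le> B * u x" using B(2) u(3) by simp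
          ultimately show ?thesis by simp
        next
          case False
          have "f n x \<le> B" using dec[of 0 n x] B(1)[of x] by simp
          also have "\<dots> \<le> B * u x" using B(2) u(4)[OF False] by (simp add: mult_le_cancel_left1)
          finally show ?thesis using e1 by simp
        qed
        then show "AE x in \<nu>. r < g x \<and> g x \<le> r + 1 \<longrightarrow> f n x \<le> e1 * 1 + B * u x" by simp
      qed simp
      moreover have "e1 * D1 \<le> e / 2" using e D1_nonneg by (simp add: e1_def field_simps)
      moreover have "B * E < e / 2"
      proof -
        have "E \<ge> 0" by (rule dlevel_nonneg[OF u(2) C1b_integrable[OF u(1)]]) (simp add: u(3))
        then have "B * E \<le> (B + 1) * E" by (simp add: mult_right_mono)
        also have "\<dots> < (B + 1) * (e / (2 * (B + 1)))" using u(5) B(2) by (intro mult_strict_left_mono) auto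
        also have "\<dots> = e / 2" using B(2) by (simp add: field_simps)
        finally show ?thesis .
      qed
      moreover have "0 \<le> ?L (f n)"
        using nonneg by (intro dlevel_nonneg[OF level_functional bcontfun_integrable] f(1)) auto
      ultimately show ?thesis by simp
    qed
    then show "\<exists>N. \<forall>n\<ge>N. norm (?L (f n) - 0) < e" by blast
  qed
qed

text \<open>Existence is the representation of \<open>level_functional r\<close>, uniqueness is
  \<open>finite_borel_measure_eqI\<close>.\<close>

lemma surface_measure:
  shows "finite_measure (surface_measure \<nu> g r)"
    and "sets (surface_measure \<nu> g r) = sets borel"
    and "f \<in> bcontfun \<Longrightarrow> dlevel r f (LINT x|surface_measure \<nu> g r. f x)"
proof -
  interpret D: Daniell_functional "level_functional r" by (rule Daniell_functional_level)
  let ?P = "\<lambda>\<sigma>. finite_measure \<sigma> \<and> sets \<sigma> = sets borel \<and>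
     (\<forall>\<phi> \<in> bcontfun. ((\<lambda>s. LINT x:{x. g x \<le> s}|\<nu>. \<phi> x)
         has_real_derivative (LINT x|\<sigma>. \<phi> x)) (at r))"
  have "?P D.repr"
    using D.finite_measure_repr D.sets_repr D.integral_repr level_functional unfolding dlevel_def by simp
  moreover have "\<sigma> = D.repr" if P: "?P \<sigma>" for \<sigma>
  proof (rule finite_borel_measure_eqI)
    show "(LINT x|\<sigma>. f x) = (LINT x|D.repr. f x)" if "f \<in> bcontfun" for f :: "'a \<Rightarrow> real"
      using P D.integral_repr[OF that] level_functional[OF that] that unfolding dlevel_def
      by (metis DERIV_unique)
  qed (use P D.finite_measure_repr D.sets_repr in auto)
  ultimately have "?P (surface_measure \<nu> g r)"
    unfolding surface_measure_def by (rule theI)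
  then show "finite_measure (surface_measure \<nu> g r)" "sets (surface_measure \<nu> g r) = sets borel"
    "f \<in> bcontfun \<Longrightarrow> dlevel r f (LINT x|surface_measure \<nu> g r. f x)"
    unfolding dlevel_def by blast+
qed

end

section \<open>Traces on the level set\<close>

context level_set
begin

lemma bcontfun_integrable_surface:
  fixes f :: "'a \<Rightarrow> real"
  assumes "f \<in> bcontfun"
  shows "integrable (surface_measure \<nu> g r) f"
proof -
  interpret S: finite_measure "surface_measure \<nu> g r" by (rule surface_measure(1))
  obtain B where B: "\<And>x. \<bar>f x\<bar> \<le> B" using assms by (blast intro: bcontfun_bounded)
  have "f \<in> borel_measurable (surface_measure \<nu> g r)"
    using borel_measurable_continuous_onI[OF bcontfun_continuous[OF assms]]
    by (simp add: measurable_cong_sets[OF surface_measure(2) refl])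
  then show ?thesis using B by (intro S.integrable_const_bound[where B=B]) auto
qed

text \<open>The absolute value is approximated by \<open>sqrt (u\<^sup>2 + \<epsilon>\<^sup>2)\<close>, whose gradient is not larger than
  that of \<open>u\<close>.\<close>

lemma surface_integral_abs_bound:
  assumes q: "q > 1"
  obtains K where "K \<ge> 0" "\<And>u r. u \<in> C1b \<Longrightarrow>
     (LINT x|surface_measure \<nu> g r. \<bar>u x\<bar>) \<le> K * (Lp_norm q \<nu> u + Lp_norm q \<nu> (\<lambda>x. R (grad u x)))"
proof -
  obtain K where K: "K \<ge> 0" and bound: "\<And>f G r D. closure_graph \<nu> R q f G \<Longrightarrow> dlevel r f D \<Longrightarrow>
      \<bar>D\<bar> \<le> K * (Lp_norm q \<nu> f + Lp_norm q \<nu> G)"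
    using sobolev_derivative_bound[OF q] by blast
  show thesis
  proof (rule that[of "4 * K"])
    show "4 * K \<ge> 0" using K by simp
    fix u r assume u: "u \<in> (C1b :: ('a \<Rightarrow> real) set)"
    let ?\<sigma> = "surface_measure \<nu> g r" and ?Ru = "\<lambda>x. R (grad u x)"
    note L = C1b_Lp[OF u, of q]
    have e: "(LINT x|?\<sigma>. \<bar>u x\<bar>) \<le> 4 * K * (Lp_norm q \<nu> u + Lp_norm q \<nu> ?Ru) + e" if "e > 0" for e
    proof -
      \<comment> \<open>The regularisation costs \<open>4 * K * e'\<close>.\<close>
      define e' where "e' = e / (4 * (K + 1))"
      have e': "e' > 0" using that K by (simp add: e'_def)
      define h where "h t = sqrt (t\<^sup>2 + e'\<^sup>2)" for t
      define k where "k t = t / sqrt (t\<^sup>2 + e'\<^sup>2)" for t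
      have hk: "(h has_real_derivative k t) (at t)" for t
        unfolding h_def[abs_def] k_def by (rule DERIV_sqrt_regularised[OF e'])
      have kc: "continuous_on UNIV k"
        unfolding k_def[abs_def] by (rule continuous_div_sqrt_regularised[OF e'])
      have k1: "\<bar>k t\<bar> \<le> 1" for t unfolding k_def by (rule abs_div_sqrt_regularised_le[OF e'])
      have hu: "(\<lambda>x. h (u x)) \<in> C1b" by (rule C1b_compose[OF u hk kc])
      have Rhu: "R (grad (\<lambda>x. h (u x)) x) = k (u x) *\<^sub>R R (grad u x)" for x
        using R by (simp add: grad_compose[OF u hk kc] linear_scale bounded_linear.linear)
      have h_ge: "\<bar>t\<bar> \<le> h t" for t unfolding h_def by (rule real_le_rsqrt) simp
      have h_le: "h t \<le> \<bar>t\<bar> + e'" for t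
        using sqrt_sum_squares_le_sum_abs[of t e'] e' by (simp add: h_def)
      have "(LINT x|?\<sigma>. \<bar>u x\<bar>) \<le> (LINT x|?\<sigma>. h (u x))"
        using bcontfun_integrable_surface[OF C1b_bcontfun[OF u]] bcontfun_integrable_surface[OF C1b_bcontfun[OF hu]]
        by (intro integral_mono h_ge) auto
      also have "\<dots> \<le> K * (Lp_norm q \<nu> (\<lambda>x. h (u x)) + Lp_norm q \<nu> (\<lambda>x. R (grad (\<lambda>x. h (u x)) x)))"
        using bound[OF closure_graph_C1b[OF hu] surface_measure(3)[OF C1b_bcontfun[OF hu], of r]] q
        by (simp add: abs_le_iff)
      also have "\<dots> \<le> K * (4 * (Lp_norm q \<nu> u + e') + Lp_norm q \<nu> ?Ru)"
      proof (intro mult_left_mono add_mono K)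
        show "Lp_norm q \<nu> (\<lambda>x. R (grad (\<lambda>x. h (u x)) x)) \<le> Lp_norm q \<nu> ?Ru"
        proof (rule Lp_norm_mono)
          show "norm (R (grad (\<lambda>x. h (u x)) x)) \<le> norm (R (grad u x))" for x
            unfolding Rhu using k1 by (simp add: mult_left_le_one_le)
        qed (use C1b_Lp[OF hu] L q in auto)
        have absu: "(\<lambda>x. \<bar>u x\<bar>) \<in> Lp q \<nu>" and const: "(\<lambda>_. e') \<in> Lp q \<nu>"
          using L q C1b_Lp(1)[OF C1b_const] by (auto simp: Lp_def)
        have "Lp_norm q \<nu> (\<lambda>x. h (u x)) \<le> Lp_norm q \<nu> (\<lambda>x. \<bar>u x\<bar> + e')"
        proof (rule Lp_norm_mono)
          show "norm (h (u x)) \<le> norm (\<bar>u x\<bar> + e')" for x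
            using h_le[of "u x"] h_ge[of "u x"] e' by simp
        qed (use C1b_Lp[OF hu] q Lp_add[OF absu const] in auto)
        also have "\<dots> \<le> 4 * (Lp_norm q \<nu> (\<lambda>x. \<bar>u x\<bar>) + Lp_norm q \<nu> (\<lambda>_. e'))"
          using q by (intro Lp_norm_add_le absu const) simp
        also have "Lp_norm q \<nu> (\<lambda>_. e') = e'"
          using q e' prob_space by (simp add: Lp_norm_def powr_powr)
        also have "Lp_norm q \<nu> (\<lambda>x. \<bar>u x\<bar>) = Lp_norm q \<nu> u" by (simp add: Lp_norm_def)
        finally show "Lp_norm q \<nu> (\<lambda>x. h (u x)) \<le> 4 * (Lp_norm q \<nu> u + e')" .
      qed
      also have "\<dots> = 4 * K * (Lp_norm q \<nu> u + Lp_norm q \<nu> ?Ru) + 4 * K * e' - 3 * K * Lp_norm q \<nu> ?Ru"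
        by (simp add: algebra_simps)
      also have "\<dots> \<le> 4 * K * (Lp_norm q \<nu> u + Lp_norm q \<nu> ?Ru) + e"
      proof -
        have "4 * K * e' \<le> e" using that K by (simp add: e'_def field_simps)
        moreover have "0 \<le> 3 * K * Lp_norm q \<nu> ?Ru" using K by (simp add: Lp_norm_nonneg)
        ultimately show ?thesis by linarith
      qed
      finally show ?thesis .
    qed
    show "(LINT x|?\<sigma>. \<bar>u x\<bar>) \<le> 4 * K * (Lp_norm q \<nu> u + Lp_norm q \<nu> ?Ru)"
      by (rule field_le_epsilon) (rule e)
  qed
qed

lemma W1_norm_C1b_diff:
  assumes "closure_graph \<nu> R q f G" "q > 1" "u \<in> C1b"
  shows "W1_norm \<nu> R q (\<lambda>x. u x - f x) = Lp_norm q \<nu> (\<lambda>x. u x - f x) + Lp_norm q \<nu> (\<lambda>x. R (grad u x) - G x)"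
  using W1_norm_eq[OF closure_graph_C1b_diff[OF assms(1) less_imp_le[OF assms(2)] assms(3)] assms(2)] .

lemma W1_approximating_sequence:
  assumes "closure_graph \<nu> R q f G" "q > 1"
  obtains a where "\<And>n. a n \<in> C1b" "(\<lambda>n. W1_norm \<nu> R q (\<lambda>x. a n x - f x)) \<longlonglongrightarrow> 0"
proof -
  obtain a where a: "\<And>n. a n \<in> C1b" "Lp_tendsto q \<nu> a f" "Lp_tendsto q \<nu> (\<lambda>n x. R (grad (a n) x)) G"
    using assms(1) by (auto simp: closure_graph_def)
  have "(\<lambda>n. Lp_norm q \<nu> (\<lambda>x. a n x - f x) + Lp_norm q \<nu> (\<lambda>x. R (grad (a n) x) - G x)) \<longlonglongrightarrow> 0 + 0"
    using a(2,3) by (intro tendsto_add) (simp_all add: Lp_tendsto_def)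
  then have "(\<lambda>n. W1_norm \<nu> R q (\<lambda>x. a n x - f x)) \<longlonglongrightarrow> 0"
    by (simp add: W1_norm_C1b_diff[OF assms a(1)])
  with a(1) show thesis by (rule that)
qed

text \<open>For \<open>u\<close> and \<open>w\<close> in \<open>C\<^sub>b\<^sup>1\<close>, the distance in \<open>L\<^sup>1\<close> of the surface measure is bounded by a
  multiple of the sum of the distances of \<open>u\<close> and \<open>w\<close> to \<open>f\<close> in \<open>W\<^sup>1\<^sup>,\<^sup>q\<close>. So one approximating sequence
  converges in \<open>L\<^sup>1\<close>, and all the others have the same limit.\<close>

lemma trace_exists:
  assumes q: "q > 1" and f: "f \<in> W1 \<nu> R q"
  shows "\<exists>t. is_W1_trace \<nu> R q (surface_measure \<nu> g r) f t"
proof -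
  let ?\<sigma> = "surface_measure \<nu> g r"
  obtain G where G: "closure_graph \<nu> R q f G" using f by (auto simp: W1_def)
  note fG = closure_graph_Lp[OF G]
  define N where "N u = W1_norm \<nu> R q (\<lambda>x. u x - f x)" for u
  have N: "N u = Lp_norm q \<nu> (\<lambda>x. u x - f x) + Lp_norm q \<nu> (\<lambda>x. R (grad u x) - G x)" if "u \<in> C1b" for u
    unfolding N_def by (rule W1_norm_C1b_diff[OF G q that])
  obtain K where K: "K \<ge> 0" "\<And>u r. u \<in> C1b \<Longrightarrow>
     (LINT x|surface_measure \<nu> g r. \<bar>u x\<bar>) \<le> K * (Lp_norm q \<nu> u + Lp_norm q \<nu> (\<lambda>x. R (grad u x)))"
    using surface_integral_abs_bound[OF q] by blast
  have dist: "(LINT x|?\<sigma>. \<bar>u x - w x\<bar>) \<le> 4 * K * (N u + N w)" if u: "u \<in> C1b" and w: "w \<in> C1b" for u w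
  proof -
    have Lu: "(\<lambda>x. u x - f x) \<in> Lp q \<nu>" "(\<lambda>x. R (grad u x) - G x) \<in> Lp q \<nu>"
      and Lw: "(\<lambda>x. w x - f x) \<in> Lp q \<nu>" "(\<lambda>x. R (grad w x) - G x) \<in> Lp q \<nu>"
      using C1b_Lp[OF u, of q] C1b_Lp[OF w, of q] fG q by (auto intro!: Lp_diff)
    have "(LINT x|?\<sigma>. \<bar>u x - w x\<bar>)
        \<le> K * (Lp_norm q \<nu> (\<lambda>x. u x - w x) + Lp_norm q \<nu> (\<lambda>x. R (grad (\<lambda>x. u x - w x) x)))"
      by (rule K(2)[OF C1b_diff[OF u w]])
    also have "\<dots> = K * (Lp_norm q \<nu> (\<lambda>x. (u x - f x) - (w x - f x))
        + Lp_norm q \<nu> (\<lambda>x. (R (grad u x) - G x) - (R (grad w x) - G x)))"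
      by (simp add: R_grad_diff[OF u w])
    also have "\<dots> \<le> K * (4 * (Lp_norm q \<nu> (\<lambda>x. u x - f x) + Lp_norm q \<nu> (\<lambda>x. w x - f x))
        + 4 * (Lp_norm q \<nu> (\<lambda>x. R (grad u x) - G x) + Lp_norm q \<nu> (\<lambda>x. R (grad w x) - G x)))"
      using q by (intro mult_left_mono add_mono Lp_norm_diff_le Lu Lw K(1)) auto
    also have "\<dots> = 4 * K * (N u + N w)" by (simp add: N[OF u] N[OF w] algebra_simps)
    finally show ?thesis .
  qed
  obtain a where a: "\<And>n. a n \<in> C1b" "(\<lambda>n. N (a n)) \<longlonglongrightarrow> 0"
    unfolding N_def by (blast intro: W1_approximating_sequence[OF G q])
  have Npos: "N u \<ge> 0" if "u \<in> C1b" for u by (simp add: N[OF that] Lp_norm_nonneg)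
  have int: "integrable ?\<sigma> u" if "u \<in> C1b" for u
    by (rule bcontfun_integrable_surface[OF C1b_bcontfun[OF that]])
  have "\<exists>t. integrable ?\<sigma> t \<and> (\<lambda>n. LINT x|?\<sigma>. \<bar>a n x - t x\<bar>) \<longlonglongrightarrow> 0"
  proof (rule L1_complete[OF int[OF a(1)]])
    fix e :: real assume e: "e > 0"
    define c where "c = e / (8 * (K + 1))"
    have c: "c > 0" "8 * (K + 1) * c = e" using e K(1) by (simp_all add: c_def)
    have "\<forall>\<^sub>F n in sequentially. N (a n) < c" by (rule order_tendstoD(2)[OF a(2) c(1)])
    then obtain n0 where n0: "\<And>n. n \<ge> n0 \<Longrightarrow> N (a n) < c"
      unfolding eventually_sequentially by blast
    have "(LINT x|?\<sigma>. \<bar>a i x - a j x\<bar>) < e" if "i \<ge> n0" "j \<ge> n0" for i j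
    proof -
      have "4 * K * (N (a i) + N (a j)) \<le> 4 * (K + 1) * (N (a i) + N (a j))"
        using Npos[OF a(1)[of i]] Npos[OF a(1)[of j]] by (intro mult_right_mono) auto
      also have "\<dots> < 4 * (K + 1) * (c + c)"
        using n0[OF that(1)] n0[OF that(2)] K(1) by (intro mult_strict_left_mono add_strict_mono) auto
      also have "\<dots> = e" using c(2) by (simp add: algebra_simps)
      finally show ?thesis using dist[OF a(1)[of i] a(1)[of j]] by linarith
    qed
    then show "\<exists>n. \<forall>i\<ge>n. \<forall>j\<ge>n. (LINT x|?\<sigma>. \<bar>a i x - a j x\<bar>) < e" by blast
  qed
  then obtain t where t: "integrable ?\<sigma> t" "(\<lambda>n. LINT x|?\<sigma>. \<bar>a n x - t x\<bar>) \<longlonglongrightarrow> 0" by blast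
  have "Lp_tendsto 1 ?\<sigma> b t" if b: "\<And>n. b n \<in> C1b" "(\<lambda>n. N (b n)) \<longlonglongrightarrow> 0" for b
    unfolding Lp_tendsto_1_iff
  proof (intro conjI allI)
    show "integrable ?\<sigma> (b n)" for n by (rule int[OF b(1)])
    show "integrable ?\<sigma> t" by (rule t(1))
    show "(\<lambda>n. LINT x|?\<sigma>. \<bar>b n x - t x\<bar>) \<longlonglongrightarrow> 0"
    proof (rule tendsto_sandwich[OF always_eventually always_eventually])
      show "\<forall>n. 0 \<le> (LINT x|?\<sigma>. \<bar>b n x - t x\<bar>)" by simp
      show "\<forall>n. (LINT x|?\<sigma>. \<bar>b n x - t x\<bar>) \<le> 4 * K * (N (b n) + N (a n)) + (LINT x|?\<sigma>. \<bar>a n x - t x\<bar>)"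
      proof
        fix n
        have "(LINT x|?\<sigma>. \<bar>b n x - t x\<bar>) \<le> (LINT x|?\<sigma>. \<bar>b n x - a n x\<bar> + \<bar>a n x - t x\<bar>)"
          using int[OF b(1)[of n]] int[OF a(1)[of n]] t(1) by (intro integral_mono) auto
        also have "\<dots> = (LINT x|?\<sigma>. \<bar>b n x - a n x\<bar>) + (LINT x|?\<sigma>. \<bar>a n x - t x\<bar>)"
          using int[OF b(1)[of n]] int[OF a(1)[of n]] t(1) by (intro Bochner_Integration.integral_add) auto
        finally show "(LINT x|?\<sigma>. \<bar>b n x - t x\<bar>) \<le> 4 * K * (N (b n) + N (a n)) + (LINT x|?\<sigma>. \<bar>a n x - t x\<bar>)"
          using dist[OF b(1)[of n] a(1)[of n]] by linarith
      qed
      have "(\<lambda>n. 4 * K * (N (b n) + N (a n)) + (LINT x|?\<sigma>. \<bar>a n x - t x\<bar>)) \<longlonglongrightarrow> 4 * K * (0 + 0) + 0"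
        by (intro tendsto_intros b(2) a(2) t(2))
      then show "(\<lambda>n. 4 * K * (N (b n) + N (a n)) + (LINT x|?\<sigma>. \<bar>a n x - t x\<bar>)) \<longlonglongrightarrow> 0" by simp
    qed simp
  qed
  then show ?thesis unfolding is_W1_trace_def using f t(1) by (intro exI[of _ t]) (simp add: N_def)
qed

text \<open>Both sides are continuous on \<open>W\<^sup>1\<^sup>,\<^sup>q\<close> and agree on \<open>C\<^sub>b\<^sup>1\<close>, where the trace is the function
  itself.\<close>

lemma dlevel_is_W1_trace:
  assumes t: "is_W1_trace \<nu> R q (surface_measure \<nu> g r) f t" and q: "q > 1" and D: "dlevel r f D"
    and int_f: "integrable \<nu> f"
  shows "(LINT x|surface_measure \<nu> g r. t x) = D"
proof -
  let ?\<sigma> = "surface_measure \<nu> g r"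
  have f: "f \<in> W1 \<nu> R q" using t by (simp add: is_W1_trace_def)
  note G = closure_graph_Mp[OF f]
  obtain a where a: "\<And>n. a n \<in> C1b" "(\<lambda>n. W1_norm \<nu> R q (\<lambda>x. a n x - f x)) \<longlonglongrightarrow> 0"
    by (blast intro: W1_approximating_sequence[OF G q])
  have "Lp_tendsto 1 ?\<sigma> a t" using t a by (simp add: is_W1_trace_def)
  then have L1: "\<And>n. integrable ?\<sigma> (a n)" "integrable ?\<sigma> t" "(\<lambda>n. LINT x|?\<sigma>. \<bar>a n x - t x\<bar>) \<longlonglongrightarrow> 0"
    unfolding Lp_tendsto_1_iff by auto
  have 1: "(\<lambda>n. LINT x|?\<sigma>. a n x) \<longlonglongrightarrow> (LINT x|?\<sigma>. t x)"
  proof (rule LIM_zero_cancel, rule Lim_null_comparison[OF always_eventually L1(3)], rule allI)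
    fix n
    have "(LINT x|?\<sigma>. a n x) - (LINT x|?\<sigma>. t x) = (LINT x|?\<sigma>. a n x - t x)"
      by (rule Bochner_Integration.integral_diff[symmetric, OF L1(1,2)])
    then show "norm ((LINT x|?\<sigma>. a n x) - (LINT x|?\<sigma>. t x)) \<le> (LINT x|?\<sigma>. \<bar>a n x - t x\<bar>)"
      using integral_abs_bound[of ?\<sigma> "\<lambda>x. a n x - t x"] by simp
  qed
  obtain K where K: "K \<ge> 0" "\<And>f G r D. closure_graph \<nu> R q f G \<Longrightarrow> dlevel r f D \<Longrightarrow>
      \<bar>D\<bar> \<le> K * (Lp_norm q \<nu> f + Lp_norm q \<nu> G)"
    using sobolev_derivative_bound[OF q] by blast
  have 2: "(\<lambda>n. LINT x|?\<sigma>. a n x) \<longlonglongrightarrow> D"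
  proof (rule LIM_zero_cancel, rule Lim_null_comparison[OF always_eventually], rule allI)
    fix n
    have "dlevel r (\<lambda>x. a n x - f x) ((LINT x|?\<sigma>. a n x) - D)"
      by (intro dlevel_diff surface_measure(3) C1b_bcontfun a(1) D C1b_integrable int_f)
    then have "\<bar>(LINT x|?\<sigma>. a n x) - D\<bar>
        \<le> K * (Lp_norm q \<nu> (\<lambda>x. a n x - f x) + Lp_norm q \<nu> (\<lambda>x. R (grad (a n) x) - Mp \<nu> R q f x))"
      using q by (intro K(2) closure_graph_C1b_diff[OF G] a(1)) auto
    then show "norm ((LINT x|?\<sigma>. a n x) - D) \<le> K * W1_norm \<nu> R q (\<lambda>x. a n x - f x)"
      by (simp add: W1_norm_C1b_diff[OF G q a(1)])
  next
    show "(\<lambda>n. K * W1_norm \<nu> R q (\<lambda>x. a n x - f x)) \<longlonglongrightarrow> 0"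
      using tendsto_mult_right_zero[OF a(2), of K] by simp
  qed
  show ?thesis using LIMSEQ_unique[OF 1 2] .
qed

text \<open>Whichever representative \<open>trace_op\<close> selects, of a version in \<open>C\<^sub>b\<close> or of a trace for some
  exponent \<open>q\<close>, its integral is the derivative \<open>D\<close>, which only depends on \<open>f\<close>.\<close>

lemma trace_op_integral:
  assumes f: "has_Cb_version \<nu> f \<or> (\<exists>q>1. f \<in> W1 \<nu> R q)" and D: "dlevel r f D" and int_f: "integrable \<nu> f"
  shows "(LINT x|surface_measure \<nu> g r. trace_op \<nu> R (surface_measure \<nu> g r) f x) = D"
    and "trace_op \<nu> R (surface_measure \<nu> g r) f \<in> borel_measurable (surface_measure \<nu> g r)"
proof -
  let ?\<sigma> = "surface_measure \<nu> g r"
  have "(LINT x|?\<sigma>. trace_op \<nu> R ?\<sigma> f x) = D \<and> integrable ?\<sigma> (trace_op \<nu> R ?\<sigma> f)"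
  proof (cases "has_Cb_version \<nu> f")
    case True
    define h where "h = trace_op \<nu> R ?\<sigma> f"
    have h_eq: "h = (SOME h. h \<in> bcontfun \<and> (AE x in \<nu>. h x = f x))"
      using True by (simp add: h_def trace_op_def)
    have "\<exists>h. h \<in> bcontfun \<and> (AE x in \<nu>. h x = f x)"
      using True unfolding has_Cb_version_def by blast
    then have "h \<in> bcontfun \<and> (AE x in \<nu>. h x = f x)"
      unfolding h_eq by (rule someI_ex)
    then have h: "h \<in> bcontfun" "AE x in \<nu>. h x = f x" by auto
    note [measurable] = bcontfun_measurable[OF h(1)] borel_measurable_integrable[OF int_f]
    have "(LINT x:{x. g x \<le> s}|\<nu>. h x) = (LINT x:{x. g x \<le> s}|\<nu>. f x)" for s
      unfolding set_lebesgue_integral_def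
    proof (rule integral_cong_AE)
      show "AE x in \<nu>. indicator {x. g x \<le> s} x *\<^sub>R h x = indicator {x. g x \<le> s} x *\<^sub>R f x"
        using h(2) by eventually_elim simp
    qed measurable
    then have "dlevel r h D" using D unfolding dlevel_def by simp
    then have "(LINT x|?\<sigma>. h x) = D" by (rule dlevel_unique[OF surface_measure(3)[OF h(1)]])
    then show ?thesis using bcontfun_integrable_surface[OF h(1)] unfolding h_def by blast
  next
    case False
    define t where "t = trace_op \<nu> R ?\<sigma> f"
    have t_eq: "t = (SOME t. \<exists>q>1. is_W1_trace \<nu> R q ?\<sigma> f t)"
      using False by (simp add: t_def trace_op_def)
    have "\<exists>t. \<exists>q>1. is_W1_trace \<nu> R q ?\<sigma> f t" using f False trace_exists by blast
    then have "\<exists>q>1. is_W1_trace \<nu> R q ?\<sigma> f t" unfolding t_eq by (rule someI_ex)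
    then obtain q where q: "q > 1" "is_W1_trace \<nu> R q ?\<sigma> f t" by blast
    have "integrable ?\<sigma> t" using q(2) by (simp add: is_W1_trace_def)
    then show ?thesis using dlevel_is_W1_trace[OF q(2,1) D int_f] unfolding t_def by blast
  qed
  then show "(LINT x|?\<sigma>. trace_op \<nu> R ?\<sigma> f x) = D" "trace_op \<nu> R ?\<sigma> f \<in> borel_measurable ?\<sigma>"
    using borel_measurable_integrable by blast+
qed

end

section \<open>The level set of a quasicontinuous version\<close>

context level_set
begin

text \<open>Where \<open>g\<^sup>*\<close> is continuous, \<open>{\<bar>g\<^sup>* - r\<bar> > \<delta>}\<close> is relatively open, so its union with the
  exceptional open set is open. On a layer \<open>{r < g \<le> r + \<delta>}\<close>, up to a null set, the union is
  contained in the exceptional set, and the derivative that defines the surface measure only sees such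
  layers.\<close>

lemma surface_measure_off_level:
  assumes q: "q > 1" and qc: "quasicontinuous \<nu> R q gstar" and ver: "AE x in \<nu>. gstar x = g x"
    and \<delta>: "\<delta> > 0" and e: "e > 0"
  shows "\<exists>W. open W \<and> {x. \<bar>gstar x - r\<bar> > \<delta>} \<subseteq> W \<and> measure (surface_measure \<nu> g r) W \<le> e"
proof -
  let ?\<sigma> = "surface_measure \<nu> g r"
  obtain K where K: "K \<ge> 0" "\<And>f G r D. closure_graph \<nu> R q f G \<Longrightarrow> dlevel r f D \<Longrightarrow>
      \<bar>D\<bar> \<le> K * (Lp_norm q \<nu> f + Lp_norm q \<nu> G)"
    using sobolev_derivative_bound[OF q] by blast
  \<comment> \<open>The bound on the capacity for which \<open>K\<close> times the norm of \<open>f\<close> is at most \<open>e\<close>.\<close>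
  define c where "c = e / (K + 1)"
  have c: "c > 0" "K * c \<le> e" using e K(1) by (simp_all add: c_def field_simps)
  obtain U where U: "open U" "capacity \<nu> R q U < c" "continuous_on (- U) gstar"
    using qc c(1) unfolding quasicontinuous_def by blast
  let ?S = "{W1_norm \<nu> R q f |f. f \<in> W1 \<nu> R q \<and> (AE x in \<nu>. f x \<ge> indicator U x)}"
  have "(\<lambda>_. 1) \<in> W1 \<nu> R q"
    using closure_graph_W1[OF closure_graph_C1b[OF C1b_const]] q by simp
  then have "?S \<noteq> {}" by (auto intro!: exI[of _ "\<lambda>_. 1 :: real"])
  then obtain f where f: "f \<in> W1 \<nu> R q" "AE x in \<nu>. f x \<ge> indicator U x" "W1_norm \<nu> R q f < c"
    using cInf_lessD[of ?S c] U(2) unfolding capacity_def by blast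
  note G = closure_graph_Mp[OF f(1)]
  have int_f: "integrable \<nu> f"
  proof -
    have "f \<in> Lp 1 \<nu>" using q by (intro Lp_mono_exponent[OF finite_measure closure_graph_Lp(1)[OF G]]) auto
    then show ?thesis using integrable_abs_iff[of f \<nu>] by (auto simp: Lp_def)
  qed
  have "\<exists>D. dlevel r f D" by (rule sobolev_derivative[OF q]) (use G in blast)
  then obtain D where D: "dlevel r f D" by blast
  have "\<bar>D\<bar> \<le> K * W1_norm \<nu> R q f" using K(2)[OF G D] by (simp add: W1_norm_def)
  also have "\<dots> \<le> K * c" using f(3) K(1) by (intro mult_left_mono) auto
  finally have De: "D \<le> e" using c(2) by linarith
  have "open {y. \<bar>y - r\<bar> > \<delta>}" by (intro open_Collect_less continuous_intros)
  then obtain A where A: "open A" "A \<inter> - U = gstar -` {y. \<bar>y - r\<bar> > \<delta>} \<inter> - U"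
    using U(3) unfolding continuous_on_open_invariant by blast
  define W where "W = A \<union> U"
  have W: "open W" using A(1) U(1) by (simp add: W_def open_Un)
  obtain u where u: "\<And>k. u k \<in> bcontfun" "\<And>k x. 0 \<le> u k x" "\<And>k x. u k x \<le> indicator W x"
    "\<And>k x. u k x \<le> u (Suc k) x" "\<And>x. (\<lambda>k. u k x) \<longlonglongrightarrow> indicator W x" "\<And>x. u 0 x = (0::real)"
    using open_bcontfun_approximation[OF W] by blast
  have "(LINT x|?\<sigma>. u k x) \<le> D" for k
  proof (rule dlevel_mono[OF surface_measure(3)[OF u(1)] D bcontfun_integrable[OF u(1)] int_f \<delta>])
    show "AE x in \<nu>. r < g x \<and> g x \<le> r + \<delta> \<longrightarrow> u k x \<le> f x"
      using ver f(2)
    proof eventually_elim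
      case (elim x)
      show ?case
      proof (cases "x \<in> U")
        case True
        then show ?thesis using elim(2) order_trans[OF u(3)[of k x] indicator_le_1] by simp
      next
        case False
        have "x \<notin> W" if "r < g x" "g x \<le> r + \<delta>"
        proof
          assume "x \<in> W"
          then have "x \<in> gstar -` {y. \<bar>y - r\<bar> > \<delta>} \<inter> - U" using False A(2) by (auto simp: W_def)
          then show False using that elim(1) by simp
        qed
        then show ?thesis using False elim(2) u(3)[of k x] by auto
      qed
    qed
  qed
  moreover have "(\<lambda>k. LINT x|?\<sigma>. u k x) \<longlonglongrightarrow> measure ?\<sigma> W"
    by (rule integral_tendsto_measure_open[OF surface_measure(1,2) W u(1-3,5)])
  ultimately have "measure ?\<sigma> W \<le> D" by (intro LIMSEQ_le_const2) auto
  moreover have "{x. \<bar>gstar x - r\<bar> > \<delta>} \<subseteq> W" using A(2) by (auto simp: W_def)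
  ultimately show ?thesis using W De by (intro exI[of _ W]) auto
qed

text \<open>The open sets of the previous lemma all contain \<open>{\<bar>g\<^sup>* - r\<bar> > \<delta>}\<close>, so their intersection over
  \<open>e = 1 / n\<close> is a Borel null set that contains it.\<close>

lemma surface_measure_concentrated:
  assumes q: "q > 1" and qc: "quasicontinuous \<nu> R q gstar" and ver: "AE x in \<nu>. gstar x = g x"
  shows "AE x in surface_measure \<nu> g r. gstar x = r"
proof -
  let ?\<sigma> = "surface_measure \<nu> g r"
  interpret S: finite_measure ?\<sigma> by (rule surface_measure(1))
  have "AE x in ?\<sigma>. \<bar>gstar x - r\<bar> \<le> \<delta>" if \<delta>: "\<delta> > 0" for \<delta>
  proof -
    have "\<forall>n. \<exists>W. open W \<and> {x. \<bar>gstar x - r\<bar> > \<delta>} \<subseteq> W \<and> measure ?\<sigma> W \<le> inverse (real (Suc n))"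
      using surface_measure_off_level[OF q qc ver \<delta>] by simp
    then obtain W where W: "\<And>n. open (W n)" "\<And>n. {x. \<bar>gstar x - r\<bar> > \<delta>} \<subseteq> W n"
      "\<And>n. measure ?\<sigma> (W n) \<le> inverse (real (Suc n))" by metis
    have sets: "W n \<in> sets ?\<sigma>" for n using W(1) by (simp add: surface_measure(2))
    let ?N = "\<Inter>n. W n"
    have N: "?N \<in> sets ?\<sigma>" using sets by auto
    have "measure ?\<sigma> ?N \<le> inverse (real (Suc n))" for n
      using S.finite_measure_mono[of ?N "W n"] sets W(3)[of n] by (meson INT_lower UNIV_I order_trans)
    then have "measure ?\<sigma> ?N \<le> 0"
      by (intro LIMSEQ_le_const[OF LIMSEQ_inverse_real_of_nat]) auto
    then have "emeasure ?\<sigma> ?N = 0" using S.emeasure_eq_measure measure_nonneg[of ?\<sigma> ?N] by (simp add: order_antisym)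
    then show ?thesis
      by (intro AE_I[OF _ _ N]) (use W(2) in \<open>auto simp: not_le\<close>)
  qed
  then have "AE x in ?\<sigma>. \<forall>n. \<bar>gstar x - r\<bar> \<le> inverse (real (Suc n))"
    by (simp add: AE_all_countable)
  then show ?thesis
  proof eventually_elim
    case (elim x)
    then have "\<bar>gstar x - r\<bar> \<le> 0" by (intro LIMSEQ_le_const[OF LIMSEQ_inverse_real_of_nat]) auto
    then show ?case by simp
  qed
qed

text \<open>The set \<open>{g\<^sup>* = r}\<close> need not be a Borel set, but its complement is contained in a Borel null
  set.\<close>

lemma surface_integral_on_level:
  fixes t :: "'a \<Rightarrow> real"
  assumes ae: "AE x in surface_measure \<nu> g r. gstar x = r"
    and t: "t \<in> borel_measurable (surface_measure \<nu> g r)"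
  shows "(LINT x:{x. gstar x = r}|completion (surface_measure \<nu> g r). t x) = (LINT x|surface_measure \<nu> g r. t x)"
proof -
  let ?\<sigma> = "surface_measure \<nu> g r"
  have space: "space ?\<sigma> = UNIV" using sets_eq_imp_space_eq[OF surface_measure(2)] by simp
  have "Measurable.pred (completion ?\<sigma>) (\<lambda>x. gstar x \<noteq> r)"
    by (rule sets_completion_AE) (use ae in simp)
  then have "{x. gstar x \<noteq> r} \<in> sets (completion ?\<sigma>)" by (simp add: pred_def space)
  then have "UNIV - {x. gstar x \<noteq> r} \<in> sets (completion ?\<sigma>)"
    using sets.compl_sets[of _ "completion ?\<sigma>"] by (simp add: space)
  then have [measurable]: "{x. gstar x = r} \<in> sets (completion ?\<sigma>)"
    by (simp add: set_diff_eq)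
  have [measurable]: "t \<in> borel_measurable (completion ?\<sigma>)" by (rule measurable_completion[OF t])
  have "(LINT x:{x. gstar x = r}|completion ?\<sigma>. t x) = (LINT x|completion ?\<sigma>. t x)"
    unfolding set_lebesgue_integral_def
  proof (rule integral_cong_AE)
    show "AE x in completion ?\<sigma>. indicator {x. gstar x = r} x *\<^sub>R t x = t x"
      using AE_completion[OF ae] by eventually_elim simp
  qed measurable
  also have "\<dots> = (LINT x|?\<sigma>. t x)" by (rule integral_completion[OF t])
  finally show ?thesis .
qed

text \<open>The derivative at \<open>r\<close> of the integral of \<open>\<langle>Dg, F\<rangle> \<phi>\<close> is the integral of \<open>\<phi> v - \<langle>G, F\<rangle>\<close> over
  \<open>{g > r}\<close>. That function has integral zero over the whole space, and \<open>{g = r}\<close> is a null set, so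
  this is the integral of \<open>\<langle>G, F\<rangle> - \<phi> v\<close> over \<open>{g < r}\<close>.\<close>

lemma integration_by_parts_sublevel:
  assumes p: "p > 1" "p < p1" and F: "adjoint_pair \<nu> R p F v" and \<phi>: "closure_graph \<nu> R p1 \<phi> G"
    and trace: "has_Cb_version \<nu> (\<lambda>x. (Dg x \<bullet> F x) * \<phi> x) \<or> (\<exists>q>1. (\<lambda>x. (Dg x \<bullet> F x) * \<phi> x) \<in> W1 \<nu> R q)"
  shows "(LINT x:{x. g x < r}|\<nu>. G x \<bullet> F x) = (LINT x:{x. g x < r}|\<nu>. \<phi> x * v x)
      + (LINT x|surface_measure \<nu> g r. trace_op \<nu> R (surface_measure \<nu> g r) (\<lambda>y. (Dg y \<bullet> F y) * \<phi> y) x)"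
proof -
  note int = by_parts_integrable[OF p F \<phi>]
  let ?A = "\<lambda>x. \<phi> x * v x - G x \<bullet> F x"
  have A: "integrable \<nu> ?A" using int by simp
  have "dlevel r (\<lambda>x. (Dg x \<bullet> F x) * \<phi> x) (LINT x:{x. g x > r}|\<nu>. ?A x)"
    by (rule by_parts_derivative[OF p F \<phi>])
  note tr = trace_op_integral(1)[OF trace this int(3)]
  have ind: "integrable \<nu> (\<lambda>x. indicator {x. g x > r} x * B x)" "integrable \<nu> (\<lambda>x. indicator {x. g x < r} x * B x)"
    if "integrable \<nu> B" for B :: "'a \<Rightarrow> real"
    using integrable_mult_indicator[OF sublevel_sets(2) that] integrable_mult_indicator[OF sublevel_sets(3) that]
    by simp_all
  note [measurable] = borel_measurable_integrable[OF A]
  have "0 = (LINT x|\<nu>. ?A x)" by (simp add: by_parts_total[OF p F \<phi>])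
  also have "\<dots> = (LINT x|\<nu>. indicator {x. g x > r} x * ?A x + indicator {x. g x < r} x * ?A x)"
  proof (rule integral_cong_AE)
    show "AE x in \<nu>. ?A x = indicator {x. g x > r} x * ?A x + indicator {x. g x < r} x * ?A x"
      using no_atoms[of r] by eventually_elim (auto simp: indicator_def)
  qed measurable
  also have "\<dots> = (LINT x:{x. g x > r}|\<nu>. ?A x) + (LINT x:{x. g x < r}|\<nu>. ?A x)"
    unfolding set_lebesgue_integral_def using ind[OF A] by simp
  also have "(LINT x:{x. g x < r}|\<nu>. ?A x)
     = (LINT x:{x. g x < r}|\<nu>. \<phi> x * v x) - (LINT x:{x. g x < r}|\<nu>. G x \<bullet> F x)"
    unfolding set_lebesgue_integral_def using ind(2)[OF int(1)] ind(2)[OF int(2)]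
    by (simp add: right_diff_distrib)
  finally show ?thesis using tr by linarith
qed

end

theorem corollary4p7:
  fixes \<nu> :: "'a::{real_inner,polish_space} measure"
    and R :: "'a \<Rightarrow> 'a"
    and g gstar \<phi> :: "'a \<Rightarrow> real"
    and F :: "'a \<Rightarrow> 'a"
    and p p1 pbar r :: real
  assumes "infinite_dimensional TYPE('a)"
    and "prob_space \<nu>" and "sets \<nu> = sets borel" and "nondegenerate \<nu>"
    and "bounded_linear R"
    and "\<And>s. s > 1 \<Longrightarrow> Rgrad_closable \<nu> R s"
    and "g \<in> borel_measurable borel"
    and "\<And>s. s > 1 \<Longrightarrow> g \<in> W1 \<nu> R s"
    and "AE x in \<nu>. M_op \<nu> R g x \<noteq> 0"
    and "\<And>s. s > 1 \<Longrightarrow>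
           (\<lambda>x. (1 / (norm (M_op \<nu> R g x))\<^sup>2) *\<^sub>R M_op \<nu> R g x) \<in> dom_Mp_adj \<nu> R s"
    and "pbar > 1" and "quasicontinuous \<nu> R pbar gstar" and "AE x in \<nu>. gstar x = g x"
    and "p > 1" and "F \<in> dom_Mp_adj \<nu> R p"
    and "p1 > p" and "\<phi> \<in> W1 \<nu> R p1"
    and "has_Cb_version \<nu> (\<lambda>x. (M_op \<nu> R g x \<bullet> F x) * \<phi> x) \<or>
         (\<exists>q>1. (\<lambda>x. (M_op \<nu> R g x \<bullet> F x) * \<phi> x) \<in> W1 \<nu> R q)"
  shows "((LINT x:{x. g x < r}|\<nu>. Mp \<nu> R p1 \<phi> x \<bullet> F x) =
           (LINT x:{x. g x < r}|\<nu>. \<phi> x * Mp_adj \<nu> R p F x) +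
           (LINT x|surface_measure \<nu> g r.
              trace_op \<nu> R (surface_measure \<nu> g r) (\<lambda>y. (M_op \<nu> R g y \<bullet> F y) * \<phi> y) x)) \<and>
         ((LINT x:{x. g x < r}|\<nu>. \<phi> x * Mp_adj \<nu> R p F x) +
           (LINT x|surface_measure \<nu> g r.
              trace_op \<nu> R (surface_measure \<nu> g r) (\<lambda>y. (M_op \<nu> R g y \<bullet> F y) * \<phi> y) x) =
         (LINT x:{x. g x < r}|\<nu>. \<phi> x * Mp_adj \<nu> R p F x) +
           (LINT x:{x. gstar x = r}|completion (surface_measure \<nu> g r).
              trace_op \<nu> R (surface_measure \<nu> g r) (\<lambda>y. (M_op \<nu> R g y \<bullet> F y) * \<phi> y) x))"
proof -
  interpret S: sobolev \<nu> R
    using assms(2,3,5,6) by (simp add: sobolev_def sobolev_axioms_def)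
  interpret level_set \<nu> R g "M_op \<nu> R g"
    by unfold_locales (use assms(7-10) S.closure_graph_M_op in auto)
  have F: "adjoint_pair \<nu> R p F (Mp_adj \<nu> R p F)"
    using assms(15) by (simp add: dom_Mp_adj_def Mp_adj_def some_eq_ex)
  note \<phi> = S.closure_graph_Mp[OF assms(17)]
  note by_parts = integration_by_parts_sublevel[OF assms(14,16) F \<phi> assms(18), of r]
  note meas = trace_op_integral(2)[OF assms(18) by_parts_derivative[OF assms(14,16) F \<phi>]
      by_parts_integrable(3)[OF assms(14,16) F \<phi>]]
  show ?thesis
    using by_parts surface_integral_on_level[OF surface_measure_concentrated[OF assms(11-13)] meas]
    by simp
qed

end
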